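(* There is an FPT algorithm for the (decoupled) \textsc{Spanner} problem w.r.t. $(\mu,h)$, where $\mu$ is the maximum number of nontrivial edges in the spanner and $h$ is the local neighborhood size of the instance, with running time $$\mathcal{O}\big(h^{2\mu}\cdot\mathrm{APSP}(n,m)+m^3+m^2n\log n\big).$$ That is, given a connected undirected graph $G=(V,E)$ with $n=|V|$, $m=|E|$, edge weights $w\colon E\to\mathbb{N}_{\ge0}$, edge lengths $\ell\colon E\to\mathbb{N}_{\ge1}$, a stretch factor $\alpha\ge1$, a weight bound $W\in\mathbb{N}$ and a number $\mu$, the algorithm decides within this time whether $G$ has an $\alpha$-spanner $H=(V,F)$ with $w(H)\le W$ and $|F\cap N|\le\mu$, where $N$ is the set of nontrivial edges.
   Context: For a subgraph $G'\subseteq G$ and $u,v\in V$, $\ell_{G'}[u,v]$ is the length of a shortest $u$-$v$-path in $G'$ w.r.t. $\ell$. A subgraph $H=(V,F)$, $F\subseteq E$, is an $\alpha$-spanner of $G$ if $\ell_H[u,v]\le\alpha\,\ell_G[u,v]$ for all $u,v\in V$; equivalently, for all $\{u,v\}\in E$. Its weight is $w(H)=\sum_{e\in F}w(e)$. The set of terminal pairs is $K=E$. For $\{u,v\}\in E$, a simple $u$-$v$-path $P$ is settling if $\ell(P)\le\alpha\,\ell_G[u,v]$; it is alternative if it does not contain the edge $\{u,v\}$. $\mathcal{P}_{uv}$ is the set of all settling $u$-$v$-paths. As a preprocessing convention, edges that do not settle themselves (i.e., $\ell(\{u,v\})>\alpha\,\ell_G[u,v]$) are assumed to have been removed from the instance.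 An edge $\{u,v\}$ is mandatory if $\mathcal{P}_{uv}$ contains no alternative path. The trivial edges $T\subseteq E$ are the mandatory edges and the edges of weight $0$; the nontrivial edges are $N=E\setminus T$. A terminal pair $\{u,v\}\in E$ is critical if no settling $u$-$v$-path consists only of trivial edges; $C$ denotes the set of critical terminal pairs. The local neighborhood size is $h=\max_{\{u,v\}\in C}\big|\bigcup_{P\in\mathcal{P}_{uv}}V(P)\big|$, the maximum number of nodes visited by settling paths, over all critical terminal pairs. $\mathrm{APSP}(n,m)$ denotes the running time of a suitable algorithm for the all-pairs shortest paths problem on a graph with $n$ nodes and $m$ edges. An algorithm is FPT w.r.t. a (possibly combined) parameter $k$ if on instance $I$ it runs in $\mathcal{O}(f(k)\cdot p(\langle I\rangle))$ time for a computable function $f$ and a polynomial $p$ in the encoding length $\langle I\rangle$. *)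

theory Defs
  imports
    Complex_Main
    "HOL-Library.Extended_Real"
    "HOL-Library.Landau_Symbols"
    "HOL-Library.Log_Nat"
    "HOL-Computational_Algebra.Polynomial"
begin

section \<open>Graphs, paths and distances\<close>

definition simple_graph :: "'a set \<Rightarrow> 'a set set \<Rightarrow> bool" where
  "simple_graph V E \<longleftrightarrow>
     finite V \<and> (\<forall>e\<in>E. \<exists>u\<in>V. \<exists>v\<in>V. u \<noteq> v \<and> e = {u, v})"

fun path_edges :: "'a list \<Rightarrow> 'a set list" where
  "path_edges (x # y # p) = {x, y} # path_edges (y # p)"
| "path_edges _ = []"

definition simple_path :: "'a set set \<Rightarrow> 'a \<Rightarrow> 'a \<Rightarrow> 'a list \<Rightarrow> bool" where
  "simple_path E u v p \<longleftrightarrow>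
     p \<noteq> [] \<and> hd p = u \<and> last p = v \<and> distinct p \<and> set (path_edges p) \<subseteq> E"

definition path_length :: "('a set \<Rightarrow> nat) \<Rightarrow> 'a list \<Rightarrow> nat" where
  "path_length l p = sum_list (map l (path_edges p))"

definition connected_graph :: "'a set \<Rightarrow> 'a set set \<Rightarrow> bool" where
  "connected_graph V E \<longleftrightarrow> V \<noteq> {} \<and> (\<forall>u\<in>V. \<forall>v\<in>V. \<exists>p. simple_path E u v p)"

text \<open>The value is \<open>\<infinity>\<close> if \<open>u\<close> and \<open>v\<close> are in different components; this happens for spanner
  candidates.\<close>

definition sp_dist :: "'a set set \<Rightarrow> ('a set \<Rightarrow> nat) \<Rightarrow> 'a \<Rightarrow> 'a \<Rightarrow> ereal" where
  "sp_dist E l u v = (INF p\<in>{p. simple_path E u v p}. ereal (real (path_length l p)))"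


section \<open>The decoupled spanner problem\<close>

text \<open>The vertex set is \<open>{..<nverts I}\<close>; functions on edges matter only on \<open>edges I\<close>.\<close>

record spanner_inst =
  nverts :: nat
  edges :: "nat set set"
  weight :: "nat set \<Rightarrow> nat"
  elen :: "nat set \<Rightarrow> nat"
  stretch :: rat
  budget :: nat
  mu :: nat

abbreviation verts :: "spanner_inst \<Rightarrow> nat set" where
  "verts I \<equiv> {..<nverts I}"

abbreviation nedges :: "spanner_inst \<Rightarrow> nat" where
  "nedges I \<equiv> card (edges I)"

definition valid_inst :: "spanner_inst \<Rightarrow> bool" where
  "valid_inst I \<longleftrightarrow>
     simple_graph (verts I) (edges I) \<and> connected_graph (verts I) (edges I) \<and>
     (\<forall>e\<in>edges I. 1 \<le> elen I e) \<and> 1 \<le> stretch I"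

definition alpha_dist :: "spanner_inst \<Rightarrow> nat \<Rightarrow> nat \<Rightarrow> ereal" where
  "alpha_dist I u v = ereal (of_rat (stretch I)) * sp_dist (edges I) (elen I) u v"

definition is_spanner :: "spanner_inst \<Rightarrow> nat set set \<Rightarrow> bool" where
  "is_spanner I F \<longleftrightarrow>
     F \<subseteq> edges I \<and> (\<forall>u\<in>verts I. \<forall>v\<in>verts I. sp_dist F (elen I) u v \<le> alpha_dist I u v)"

text \<open>Removal of the edges that do not settle themselves. Such an edge is on no shortest path,
  so distances do not change.\<close>

definition preprocess :: "spanner_inst \<Rightarrow> spanner_inst" where
  "preprocess I =
     I\<lparr>edges := {{u, v} | u v. {u, v} \<in> edges I \<and> ereal (real (elen I {u, v})) \<le> alpha_dist I u v}\<rparr>"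

lemma preprocess_id:
  assumes "simple_graph (verts I) (edges I)"
    and "\<And>u v. {u, v} \<in> edges I \<Longrightarrow> ereal (real (elen I {u, v})) \<le> alpha_dist I u v"
  shows "preprocess I = I"
proof -
  have "e \<in> {{u, v} | u v. {u, v} \<in> edges I \<and> ereal (real (elen I {u, v})) \<le> alpha_dist I u v}"
    if "e \<in> edges I" for e
  proof -
    obtain u v where "e = {u, v}"
      using assms(1) \<open>e \<in> edges I\<close> unfolding simple_graph_def by blast
    with assms(2) \<open>e \<in> edges I\<close> show ?thesis by blast
  qed
  then have "{{u, v} | u v. {u, v} \<in> edges I \<and> ereal (real (elen I {u, v})) \<le> alpha_dist I u v}
      = edges I"
    by blast
  then show ?thesis unfolding preprocess_def by simp
qed

definition settling_paths :: "spanner_inst \<Rightarrow> nat \<Rightarrow> nat \<Rightarrow> nat list set" where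
  "settling_paths I u v =
     {p. simple_path (edges I) u v p \<and> ereal (real (path_length (elen I) p)) \<le> alpha_dist I u v}"

definition mandatory_edges :: "spanner_inst \<Rightarrow> nat set set" where
  "mandatory_edges I =
     {{u, v} | u v. {u, v} \<in> edges I \<and>
        \<not> (\<exists>p\<in>settling_paths I u v. {u, v} \<notin> set (path_edges p))}"

definition trivial_edges :: "spanner_inst \<Rightarrow> nat set set" where
  "trivial_edges I = mandatory_edges I \<union> {e \<in> edges I. weight I e = 0}"

definition nontrivial_edges :: "spanner_inst \<Rightarrow> nat set set" where
  "nontrivial_edges I = edges I - trivial_edges I"

definition critical_pairs :: "spanner_inst \<Rightarrow> nat set set" where
  "critical_pairs I =
     {{u, v} | u v. {u, v} \<in> edges I \<and>
        \<not> (\<exists>p\<in>settling_paths I u v. set (path_edges p) \<subseteq> trivial_edges I)}"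

text \<open>The maximum over an empty set of critical pairs is taken to be \<open>0\<close>.\<close>

definition nbhd_size :: "spanner_inst \<Rightarrow> nat" where
  "nbhd_size I =
     Max (insert 0 {card (\<Union>p\<in>settling_paths I u v. set p) | u v. {u, v} \<in> critical_pairs I})"

definition yes_inst :: "spanner_inst \<Rightarrow> bool" where
  "yes_inst I \<longleftrightarrow>
     (\<exists>F. is_spanner I F \<and> sum (weight I) F \<le> budget I \<and> card (F \<inter> nontrivial_edges I) \<le> mu I)"


section \<open>Machine model: a structured word RAM\<close>

text \<open>The memory consists of named arrays of words. A word is a natural number of size at most
  \<open>B\<close>; an operation whose result is larger has no successor state. A program fixes the number of
  arrays it uses and the size of its expressions, so unit cost per command and per test counts
  elementary word operations up to a constant factor.\<close>

datatype binop = Add | Sub | Mul | Div | Less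

fun apply_op :: "binop \<Rightarrow> nat \<Rightarrow> nat \<Rightarrow> nat" where
  "apply_op Add x y = x + y"
| "apply_op Sub x y = x - y"
| "apply_op Mul x y = x * y"
| "apply_op Div x y = x div y"
| "apply_op Less x y = (if x < y then 1 else 0)"

datatype expr = Num nat | Cell nat expr | Bin binop expr expr

type_synonym store = "nat \<Rightarrow> nat \<Rightarrow> nat"

fun eval_expr :: "store \<Rightarrow> expr \<Rightarrow> nat" where
  "eval_expr s (Num k) = k"
| "eval_expr s (Cell a i) = s a (eval_expr s i)"
| "eval_expr s (Bin f x y) = apply_op f (eval_expr s x) (eval_expr s y)"

fun fits :: "nat \<Rightarrow> store \<Rightarrow> expr \<Rightarrow> bool" where
  "fits B s (Num k) \<longleftrightarrow> k \<le> B"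
| "fits B s (Cell a i) \<longleftrightarrow> fits B s i \<and> s a (eval_expr s i) \<le> B"
| "fits B s (Bin f x y) \<longleftrightarrow> fits B s x \<and> fits B s y \<and> eval_expr s (Bin f x y) \<le> B"

datatype com =
    Skip
  | Store nat expr expr
  | Seq com com
  | If expr com com
  | While expr com

text \<open>\<open>exec B c s t s'\<close>: with word bound \<open>B\<close>, the program \<open>c\<close> started in \<open>s\<close> halts after \<open>t\<close>
  steps in \<open>s'\<close>.\<close>

inductive exec :: "nat \<Rightarrow> com \<Rightarrow> store \<Rightarrow> nat \<Rightarrow> store \<Rightarrow> bool" for B :: nat where
  Skip: "exec B Skip s 1 s"
| Store: "fits B s i \<Longrightarrow> fits B s x \<Longrightarrow>
    exec B (Store a i x) s 1 (s(a := (s a)(eval_expr s i := eval_expr s x)))"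
| Seq: "exec B c1 s t1 s1 \<Longrightarrow> exec B c2 s1 t2 s2 \<Longrightarrow> exec B (Seq c1 c2) s (t1 + t2) s2"
| If_True: "fits B s b \<Longrightarrow> eval_expr s b \<noteq> 0 \<Longrightarrow> exec B c1 s t s1 \<Longrightarrow>
    exec B (If b c1 c2) s (t + 1) s1"
| If_False: "fits B s b \<Longrightarrow> eval_expr s b = 0 \<Longrightarrow> exec B c2 s t s1 \<Longrightarrow>
    exec B (If b c1 c2) s (t + 1) s1"
| While_True: "fits B s b \<Longrightarrow> eval_expr s b \<noteq> 0 \<Longrightarrow> exec B c s t1 s1 \<Longrightarrow>
    exec B (While b c) s1 t2 s2 \<Longrightarrow> exec B (While b c) s (t1 + t2 + 1) s2"
| While_False: "fits B s b \<Longrightarrow> eval_expr s b = 0 \<Longrightarrow> exec B (While b c) s 1 s"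

lemma exec_deterministic:
  "exec B c s t s' \<Longrightarrow> exec B c s t2 s2 \<Longrightarrow> t2 = t \<and> s2 = s'"
proof (induction arbitrary: t2 s2 rule: exec.induct)
  case (Skip s)
  from Skip.prems show ?case by cases simp_all
next
  case (Store s i x a)
  from Store.prems show ?case by cases simp_all
next
  case (Seq c1 s t1 s1 c2 t2' s2')
  from Seq.prems show ?case by cases (metis Seq.IH)
next
  case (If_True s b c1 t s1 c2)
  from If_True.prems show ?case by cases (metis If_True.IH If_True.hyps(2))+
next
  case (If_False s b c2 t s1 c1)
  from If_False.prems show ?case by cases (metis If_False.IH If_False.hyps(2))+
next
  case (While_True s b c t1 s1 t2' s2')
  from While_True.prems show ?case by cases (metis While_True.IH While_True.hyps(2))+
next
  case (While_False s b c)
  from While_False.prems show ?case by cases (simp_all add: While_False.hyps(2))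
qed

definition word_store :: "nat \<Rightarrow> store \<Rightarrow> bool" where
  "word_store B s \<longleftrightarrow> (\<forall>a i. s a i \<le> B)"


section \<open>Input encoding and running times\<close>

text \<open>Array 0 holds scalars, arrays 1 and 2 the end points of the edges in an arbitrary order,
  array 3 the edge lengths, and array 4 the edge weights. All other cells contain arbitrary words.\<close>

definition encodes_graph :: "nat \<Rightarrow> nat set set \<Rightarrow> (nat set \<Rightarrow> nat) \<Rightarrow> store \<Rightarrow> bool" where
  "encodes_graph n E l s \<longleftrightarrow>
     s 0 0 = n \<and> s 0 1 = card E \<and>
     bij_betw (\<lambda>i. {s 1 i, s 2 i}) {..<card E} E \<and>
     (\<forall>i<card E. s 3 i = l {s 1 i, s 2 i})"

definition stretch_num :: "spanner_inst \<Rightarrow> nat" where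
  "stretch_num I = nat (fst (quotient_of (stretch I)))"

definition stretch_den :: "spanner_inst \<Rightarrow> nat" where
  "stretch_den I = nat (snd (quotient_of (stretch I)))"

definition encodes_inst :: "spanner_inst \<Rightarrow> store \<Rightarrow> bool" where
  "encodes_inst I s \<longleftrightarrow>
     encodes_graph (nverts I) (edges I) (elen I) s \<and>
     (\<forall>i<nedges I. s 4 i = weight I {s 1 i, s 2 i}) \<and>
     s 0 2 = stretch_num I \<and> s 0 3 = stretch_den I \<and> s 0 4 = budget I \<and> s 0 5 = mu I"

text \<open>Words of \<open>O(log N)\<close> bits, where \<open>N\<close> bounds the input numbers, are expressed as
  \<open>N ^ k \<le> B\<close> for a constant \<open>k\<close>; correctness and the time bound hold for all such \<open>B\<close>.\<close>

definition graph_magnitude :: "nat \<Rightarrow> nat set set \<Rightarrow> (nat set \<Rightarrow> nat) \<Rightarrow> nat" where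
  "graph_magnitude n E l = 2 + n + (\<Sum>e\<in>E. l e)"

definition inst_magnitude :: "spanner_inst \<Rightarrow> nat" where
  "inst_magnitude I =
     graph_magnitude (nverts I) (edges I) (elen I) + (\<Sum>e\<in>edges I. weight I e) +
     stretch_num I + stretch_den I + budget I + mu I"

text \<open>The distance matrix is output in row-major order in array 4.\<close>

definition apsp_algorithm :: "com \<Rightarrow> (nat \<Rightarrow> nat \<Rightarrow> nat) \<Rightarrow> bool" where
  "apsp_algorithm Q A \<longleftrightarrow>
     (\<exists>k. \<forall>n E l B s.
        simple_graph {..<n} E \<and> connected_graph {..<n} E \<and> (\<forall>e\<in>E. 1 \<le> l e) \<and>
        graph_magnitude n E l ^ k \<le> B \<and> word_store B s \<and> encodes_graph n E l s \<longrightarrow>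
        (\<exists>t s'. exec B Q s t s' \<and> t \<le> A n (card E) \<and>
           (\<forall>u<n. \<forall>v<n. ereal (real (s' 4 (u * n + v))) = sp_dist E l u v)))"

definition polynomially_bounded :: "(nat \<Rightarrow> nat \<Rightarrow> nat) \<Rightarrow> bool" where
  "polynomially_bounded A \<longleftrightarrow> (\<exists>p :: nat poly. \<forall>n m. A n m \<le> poly p (n + m))"

text \<open>The input is the instance before preprocessing; the answer refers to the instance after
  removal of the edges that do not settle themselves.\<close>

definition decides_spanner :: "com \<Rightarrow> (spanner_inst \<Rightarrow> nat) \<Rightarrow> bool" where
  "decides_spanner P T \<longleftrightarrow>
     (\<exists>k. \<forall>I B s.
        valid_inst I \<and> inst_magnitude I ^ k \<le> B \<and> word_store B s \<and> encodes_inst I s \<longrightarrow>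
        (\<exists>t s'. exec B P s t s' \<and> t \<le> T I \<and>
           s' 0 0 = (if yes_inst (preprocess I) then 1 else 0)))"

definition bits :: "nat \<Rightarrow> nat" where
  "bits k = Suc (floorlog 2 k)"

definition encoding_length :: "spanner_inst \<Rightarrow> nat" where
  "encoding_length I =
     bits (nverts I) + bits (nedges I) +
     (\<Sum>e\<in>edges I. (\<Sum>v\<in>e. bits v) + bits (elen I e) + bits (weight I e)) +
     bits (stretch_num I) + bits (stretch_den I) + bits (budget I) + bits (mu I)"

definition computable2 :: "(nat \<Rightarrow> nat \<Rightarrow> nat) \<Rightarrow> bool" where
  "computable2 f \<longleftrightarrow>
     (\<exists>P. \<forall>x y. \<exists>B0. \<forall>B\<ge>B0. \<forall>s. word_store B s \<and> s 0 0 = x \<and> s 0 1 = y \<longrightarrow>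
        (\<exists>t s'. exec B P s t s' \<and> s' 0 0 = f x y))"

text \<open>The filter \<open>principal S\<close> in a Landau symbol means that one constant works for all of \<open>S\<close>.\<close>

definition fpt_time ::
  "(spanner_inst \<Rightarrow> nat) \<Rightarrow> (spanner_inst \<Rightarrow> nat) \<Rightarrow> (spanner_inst \<Rightarrow> nat) \<Rightarrow> bool" where
  "fpt_time T k1 k2 \<longleftrightarrow>
     (\<exists>f (p :: nat poly). computable2 f \<and>
        (\<lambda>I. real (T I)) \<in> O[principal {I. valid_inst I}](\<lambda>I.
          real (f (k1 I) (k2 I) * poly p (encoding_length I))))"

text \<open>The summand 1 matters only for the graph with a single vertex, where \<open>m = 0\<close> and \<open>h = 0\<close>
  would otherwise leave the bound 0; with at least one edge, \<open>m ^ 3 \<ge> 1\<close> already.\<close>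

definition spanner_time_bound :: "(nat \<Rightarrow> nat \<Rightarrow> nat) \<Rightarrow> spanner_inst \<Rightarrow> real" where
  "spanner_time_bound A I =
     (let n = nverts I; m = nedges I; h = nbhd_size (preprocess I) in
        real h ^ (2 * mu I) * real (A n m) + real m ^ 3
        + real m ^ 2 * real n * log 2 (real n) + 1)"

end

theory Submission
  imports Defs
begin

text \<open>Zero-weight edges can be added to a spanner for free and mandatory edges lie in every spanner,
  so it suffices to search for spanners that contain all trivial edges. Starting from \<open>F = T\<close>, take
  a pair \<open>{u, v}\<close> not settled by \<open>F\<close>; it is critical. Any spanner \<open>H \<supseteq> F\<close> contains a shortest
  \<open>u\<close>-\<open>v\<close>-path whose part before its first edge \<open>{x, y} \<notin> F\<close> may be taken from a fixed shortest path
  tree of \<open>F\<close> rooted at \<open>u\<close>. One branches over all edges \<open>{x, y}\<close> that arise in this way: those for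
  which the tree path to \<open>x\<close>, the edge, and a shortest path from \<open>y\<close> to \<open>v\<close> that avoids this tree path
  form a settling path. Such a path is simple, so \<open>x\<close> and \<open>y\<close> lie in the neighborhood of the pair and there
  are at most \<open>h (h - 1) / 2\<close> branches; moreover only tree vertices in the neighborhood have to be
  examined, so \<open>h + 1\<close> calls of the shortest path algorithm per node suffice. Since every branch
  adds a nontrivial edge, the search tree has depth at most \<open>\<mu>\<close>.

  If there is no critical pair, then \<open>h = 0\<close> and the bound does not leave room for a single call of the
  given algorithm. The alive, trivial and critical edges are therefore determined by \<open>O(m)\<close> runs of the
  Bellman-Ford algorithm, in time \<open>O(m\<^sup>2 n)\<close>.\<close>

section \<open>Reasoning about programs\<close>

text \<open>The bound leaves little slack, and this shapes the proof. A node at depth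
  \<open>mu\<close> may pay for a constant number of calls of the given algorithm, an inner node for
  about \<open>h\<close>. As \<open>h >= 2\<close> once a critical pair exists, the recurrence over
  the depth closes within a constant factor. The remaining work of a node is linear in the numbers
  of vertices and edges and is charged to a call: started on an output array that is wrong
  everywhere, the given algorithm has to write all \<open>n * n\<close> cells, so its time bound
  dominates \<open>n\<close> and \<open>m\<close>. To keep \<open>n\<close> out of the number of
  calls, the tree is explored from its root, and a child is entered only if the edge to it passes
  the completion test. Every vertex entered lies in the neighborhood, and no branching edge is lost
  because all tree prefixes of a settling path pass the test. The given algorithm is specified only
  for connected graphs with positive lengths. Subgraphs are therefore represented by giving the
  other edges a length that exceeds every settling path. The language has no recursion: one loop
  with an explicit stack traverses the search tree, and the recursion lives in the proof
  only.\<close>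

fun writes :: "com \<Rightarrow> nat set" where
  "writes Skip = {}"
| "writes (Store a i x) = {a}"
| "writes (Seq c d) = writes c \<union> writes d"
| "writes (If b c d) = writes c \<union> writes d"
| "writes (While b c) = writes c"

lemma exec_frame: "exec B c s t s' \<Longrightarrow> a \<notin> writes c \<Longrightarrow> s' a = s a"
  by (induction rule: exec.induct) auto

lemma fits_le: "fits B s e \<Longrightarrow> eval_expr s e \<le> B"
  by (cases e) auto

lemma exec_word_store: "exec B c s t s' \<Longrightarrow> word_store B s \<Longrightarrow> word_store B s'"
  by (induction rule: exec.induct) (auto simp: word_store_def fits_le)

text \<open>Each \<open>Store\<close> touches one cell and costs one step. This yields the lower
  bound on the time of the shortest path algorithm in \<open>A_ge\<close>.\<close>

lemma exec_changed:
  "exec B c s t s' \<Longrightarrow> finite {i. s' a i \<noteq> s a i} \<and> card {i. s' a i \<noteq> s a i} \<le> t"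
proof (induction rule: exec.induct)
  case (Store s i x b)
  have "{j. (s(b := (s b)(eval_expr s i := eval_expr s x))) a j \<noteq> s a j} \<subseteq> {eval_expr s i}"
    by (auto simp: fun_upd_def)
  from finite_subset[OF this] card_mono[OF _ this] show ?case by simp
next
  case (Seq c1 s t1 s1 c2 t2 s2)
  have sub: "{i. s2 a i \<noteq> s a i} \<subseteq> {i. s1 a i \<noteq> s a i} \<union> {i. s2 a i \<noteq> s1 a i}"
    by auto
  have "card ({i. s1 a i \<noteq> s a i} \<union> {i. s2 a i \<noteq> s1 a i}) \<le> t1 + t2"
    using card_Un_le[of "{i. s1 a i \<noteq> s a i}" "{i. s2 a i \<noteq> s1 a i}"] Seq.IH by linarith
  then show ?case
    using Seq.IH finite_subset[OF sub] card_mono[OF _ sub] by auto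
next
  case (While_True s b c t1 s1 t2 s2)
  have sub: "{i. s2 a i \<noteq> s a i} \<subseteq> {i. s1 a i \<noteq> s a i} \<union> {i. s2 a i \<noteq> s1 a i}"
    by auto
  have "card ({i. s1 a i \<noteq> s a i} \<union> {i. s2 a i \<noteq> s1 a i}) \<le> t1 + t2"
    using card_Un_le[of "{i. s1 a i \<noteq> s a i}" "{i. s2 a i \<noteq> s1 a i}"] While_True.IH by linarith
  then show ?case
    using While_True.IH finite_subset[OF sub] card_mono[OF _ sub] by auto
qed auto

section \<open>Renaming the arrays of a program\<close>

fun ren_expr :: "(nat \<Rightarrow> nat) \<Rightarrow> expr \<Rightarrow> expr" where
  "ren_expr r (Num k) = Num k"
| "ren_expr r (Cell a i) = Cell (r a) (ren_expr r i)"
| "ren_expr r (Bin f x y) = Bin f (ren_expr r x) (ren_expr r y)"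

fun ren_com :: "(nat \<Rightarrow> nat) \<Rightarrow> com \<Rightarrow> com" where
  "ren_com r Skip = Skip"
| "ren_com r (Store a i x) = Store (r a) (ren_expr r i) (ren_expr r x)"
| "ren_com r (Seq c d) = Seq (ren_com r c) (ren_com r d)"
| "ren_com r (If b c d) = If (ren_expr r b) (ren_com r c) (ren_com r d)"
| "ren_com r (While b c) = While (ren_expr r b) (ren_com r c)"

lemma eval_ren [simp]: "eval_expr s (ren_expr r e) = eval_expr (s \<circ> r) e"
  by (induction e) auto

lemma fits_ren [simp]: "fits B s (ren_expr r e) = fits B (s \<circ> r) e"
  by (induction e) (simp_all add: o_def eval_ren[unfolded o_def])

lemma writes_ren: "writes (ren_com r c) = r ` writes c"
  by (induction c) auto

text \<open>\<open>s \<circ> r\<close> is the memory as the original program sees it. Injectivity of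
  \<open>r\<close> ensures that a write to \<open>r a\<close> shows up in this view as a write to
  \<open>a\<close> alone; step count and word bound carry over.\<close>

lemma exec_ren:
  assumes "inj r"
  shows "exec B c \<sigma> t \<sigma>' \<Longrightarrow> s \<circ> r = \<sigma> \<Longrightarrow> \<exists>s'. exec B (ren_com r c) s t s' \<and> s' \<circ> r = \<sigma>'"
proof (induction arbitrary: s rule: exec.induct)
  case (Store \<sigma> i x a)
  let ?s = "s(r a := (s (r a))(eval_expr \<sigma> i := eval_expr \<sigma> x))"
  have "exec B (ren_com r (Store a i x)) s 1 ?s"
    using exec.Store[of B s "ren_expr r i" "ren_expr r x" "r a"] Store by simp
  moreover have "?s \<circ> r = \<sigma>(a := (\<sigma> a)(eval_expr \<sigma> i := eval_expr \<sigma> x))"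
    using Store.prems assms by (auto simp: fun_eq_iff inj_eq)
  ultimately show ?case by blast
next
  case (Seq c1 \<sigma> t1 \<sigma>1 c2 t2 \<sigma>2)
  from Seq.IH(1)[OF Seq.prems] obtain s1
    where 1: "exec B (ren_com r c1) s t1 s1" "s1 \<circ> r = \<sigma>1" by blast
  from Seq.IH(2)[OF 1(2)] obtain s2
    where 2: "exec B (ren_com r c2) s1 t2 s2" "s2 \<circ> r = \<sigma>2" by blast
  from exec.Seq[OF 1(1) 2(1)] 2(2) show ?case by auto
next
  case (If_True \<sigma> b c1 t \<sigma>1 c2)
  from If_True.IH[OF If_True.prems] obtain s1
    where 1: "exec B (ren_com r c1) s t s1" "s1 \<circ> r = \<sigma>1" by blast
  from exec.If_True[of B s "ren_expr r b" _ _ _ "ren_com r c2", OF _ _ 1(1)] 1(2) If_True(1,2) If_True.prems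
  show ?case by auto
next
  case (If_False \<sigma> b c2 t \<sigma>1 c1)
  from If_False.IH[OF If_False.prems] obtain s1
    where 1: "exec B (ren_com r c2) s t s1" "s1 \<circ> r = \<sigma>1" by blast
  from exec.If_False[of B s "ren_expr r b" _ _ _ "ren_com r c1", OF _ _ 1(1)] 1(2) If_False(1,2) If_False.prems
  show ?case by auto
next
  case (While_True \<sigma> b c t1 \<sigma>1 t2 \<sigma>2)
  from While_True.IH(1)[OF While_True.prems] obtain s1
    where 1: "exec B (ren_com r c) s t1 s1" "s1 \<circ> r = \<sigma>1" by blast
  from While_True.IH(2)[OF 1(2)] obtain s2
    where 2: "exec B (ren_com r (While b c)) s1 t2 s2" "s2 \<circ> r = \<sigma>2" by blast
  from exec.While_True[of B s "ren_expr r b", OF _ _ 1(1)] 2 While_True(1,2) While_True.prems show ?case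
    by (auto intro!: exI[of _ s2])
next
  case (While_False \<sigma> b c)
  then have "exec B (While (ren_expr r b) (ren_com r c)) s 1 s"
    using While_False.hyps unfolding While_False.prems[symmetric] by (intro exec.While_False) simp_all
  with While_False.prems show ?case by auto
next
  case (Skip \<sigma>)
  then show ?case using exec.Skip[of B s] by auto
qed


\<comment> \<open>Weakest preconditions with a step count\<close>
inductive_simps exec_Skip_iff: "exec B Skip s t s'"
inductive_simps exec_Store_iff: "exec B (Store a i x) s t s'"
inductive_simps exec_Seq_iff: "exec B (Seq c d) s t s'"
inductive_simps exec_If_iff: "exec B (If b c d) s t s'"

text \<open>Total correctness: halting within the word bound is part of the claim, and the step
  count is an argument of the postcondition, so results and running times are proved
  together.\<close>

definition wp :: "nat \<Rightarrow> com \<Rightarrow> (nat \<Rightarrow> store \<Rightarrow> bool) \<Rightarrow> store \<Rightarrow> bool" where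
  "wp B c R s \<longleftrightarrow> (\<exists>t s'. exec B c s t s' \<and> R t s')"

lemma wp_Skip [simp]: "wp B Skip R s \<longleftrightarrow> R 1 s"
  by (simp add: wp_def exec_Skip_iff)

lemma wp_Store [simp]: "wp B (Store a i x) R s \<longleftrightarrow>
    fits B s i \<and> fits B s x \<and> R 1 (s(a := (s a)(eval_expr s i := eval_expr s x)))"
  by (auto simp add: wp_def exec_Store_iff)

lemma wp_Seq [simp]:
  "wp B (Seq c d) R s \<longleftrightarrow> wp B c (\<lambda>t s'. wp B d (\<lambda>t'. R (t + t')) s') s"
  unfolding wp_def exec_Seq_iff by blast

lemma wp_If [simp]:
  "wp B (If b c d) R s \<longleftrightarrow> fits B s b \<and>
     (if eval_expr s b \<noteq> 0 then wp B c (\<lambda>t. R (t + 1)) s else wp B d (\<lambda>t. R (t + 1)) s)"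
  unfolding wp_def exec_If_iff by auto

text \<open>The frame property and the preservation of word bounds are supplied here once, so a
  specification need only mention the arrays of interest.\<close>

lemma wp_conseq:
  assumes "wp B c R s" "word_store B s"
    and "\<And>t s'. \<lbrakk>R t s'; word_store B s'; \<And>a. a \<notin> writes c \<Longrightarrow> s' a = s a\<rbrakk> \<Longrightarrow> R' t s'"
  shows "wp B c R' s"
  using assms exec_frame exec_word_store unfolding wp_def by blast

lemma word_storeD [simp, intro]: "word_store B s \<Longrightarrow> s a i \<le> B"
  by (simp add: word_store_def)

abbreviation Sc :: "nat \<Rightarrow> expr" where "Sc a \<equiv> Cell a (Num 0)"

abbreviation Assign :: "nat \<Rightarrow> expr \<Rightarrow> com" (infix "::=" 61) where
  "a ::= e \<equiv> Store a (Num 0) e"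

abbreviation Update :: "nat \<Rightarrow> expr \<Rightarrow> expr \<Rightarrow> com" ("_[_] ::= _" [61, 0, 61] 61) where
  "a[i] ::= e \<equiv> Store a i e"

notation Seq (infixr ";;" 60)

abbreviation badd (infixl "\<oplus>" 65) where "x \<oplus> y \<equiv> Bin Add x y"
abbreviation bsub (infixl "\<ominus>" 65) where "x \<ominus> y \<equiv> Bin Sub x y"
abbreviation bmul (infixl "\<otimes>" 70) where "x \<otimes> y \<equiv> Bin Mul x y"
abbreviation bless (infix "\<prec>" 50) where "x \<prec> y \<equiv> Bin Less x y"

text \<open>Scalars are kept in cell 0 of an array of their own. The limit is read again at every
  test, hence the condition in the rules below that the body does not write
  \<open>y\<close>.\<close>

definition For :: "nat \<Rightarrow> nat \<Rightarrow> com \<Rightarrow> com" where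
  "For x y c = (x ::= Num 0 ;; While (Sc x \<prec> Sc y) (c ;; x ::= Sc x \<oplus> Num 1))"

lemma writes_For [simp]: "writes (For x y c) = insert x (writes c)"
  by (auto simp: For_def)

text \<open>Induction on the number of remaining iterations. The counter is an explicit argument of
  \<open>I\<close>, and by \<open>ins\<close> the invariant ignores the counter array, so it
  survives the increment. Each iteration adds 2 to the body: the test and the increment.\<close>

lemma wp_For_aux:
  assumes xy: "x \<noteq> y" and wr: "x \<notin> writes c" "y \<notin> writes c" and y: "s0 y 0 = n"
    and ins: "\<And>k s v. I k s \<Longrightarrow> I k (s(x := v))"
    and body: "\<And>k s. \<lbrakk>k < n; s x 0 = k; word_store B s; \<And>a. a \<notin> insert x (writes c) \<Longrightarrow> s a = s0 a;
        I k s\<rbrakk> \<Longrightarrow> wp B c (\<lambda>t s'. t \<le> tb \<and> I (Suc k) s') s"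
  shows "\<lbrakk>k \<le> n; s x 0 = k; word_store B s; \<And>a. a \<notin> insert x (writes c) \<Longrightarrow> s a = s0 a; I k s\<rbrakk> \<Longrightarrow>
    wp B (While (Sc x \<prec> Sc y) (c ;; x ::= Sc x \<oplus> Num 1)) (\<lambda>t s'. t \<le> (n - k) * (tb + 2) + 1 \<and> I n s') s"
proof (induction "n - k" arbitrary: k s)
  case 0
  have sy: "s y 0 = n" using 0(5)[of y] xy wr y by simp
  have "exec B (While (Sc x \<prec> Sc y) (c ;; x ::= Sc x \<oplus> Num 1)) s 1 s"
    by (rule exec.While_False) (use 0 sy in auto)
  with 0 show ?case unfolding wp_def by auto
next
  case (Suc d)
  have sy: "s y 0 = n" using Suc(6)[of y] xy wr y by simp
  have kn: "k < n" using Suc.hyps(2) by simp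
  have nB: "n \<le> B" using word_storeD[OF Suc(5), of y 0] sy by simp
  have "wp B c (\<lambda>t s'. t \<le> tb \<and> I (Suc k) s') s"
    using body kn Suc.prems by blast
  then obtain t1 s1 where e1: "exec B c s t1 s1" and t1: "t1 \<le> tb" and I1: "I (Suc k) s1"
    unfolding wp_def by blast
  let ?s2 = "s1(x := (s1 x)(0 := Suc k))"
  have s1x: "s1 x 0 = k" using exec_frame[OF e1 wr(1)] Suc.prems(2) by simp
  have ws1: "word_store B s1" using exec_word_store[OF e1] Suc.prems(3) by simp
  have e2: "exec B (c ;; x ::= Sc x \<oplus> Num 1) s (t1 + 1) ?s2"
    using exec.Seq[OF e1 exec.Store[of B s1 "Num 0" "Sc x \<oplus> Num 1" x]] s1x kn nB ws1 by simp
  have ws2: "word_store B ?s2" using exec_word_store[OF e2] Suc.prems(3) by simp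
  have fr2: "?s2 a = s0 a" if "a \<notin> insert x (writes c)" for a
    using that exec_frame[OF e1, of a] Suc.prems(4)[of a] by simp
  have "wp B (While (Sc x \<prec> Sc y) (c ;; x ::= Sc x \<oplus> Num 1))
      (\<lambda>t s'. t \<le> (n - Suc k) * (tb + 2) + 1 \<and> I n s') ?s2"
    by (rule Suc.hyps(1)) (use Suc.hyps(2) kn ws2 fr2 ins[OF I1] in auto)
  then obtain t3 s3 where e3: "exec B (While (Sc x \<prec> Sc y) (c ;; x ::= Sc x \<oplus> Num 1)) ?s2 t3 s3"
    and t3: "t3 \<le> (n - Suc k) * (tb + 2) + 1" and I3: "I n s3"
    unfolding wp_def by blast
  have "exec B (While (Sc x \<prec> Sc y) (c ;; x ::= Sc x \<oplus> Num 1)) s (t1 + 1 + t3 + 1) s3"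
    by (rule exec.While_True[OF _ _ e2 e3]) (use sy kn nB Suc.prems in auto)
  moreover have "t1 + 1 + t3 + 1 \<le> (n - k) * (tb + 2) + 1"
  proof -
    have "n - k = Suc (n - Suc k)" using kn by simp
    then show ?thesis using t1 t3 by simp
  qed
  ultimately show ?case using I3 unfolding wp_def by blast
qed

text \<open>The final \<open>+ 2\<close> pays for the initial assignment and the failing last
  test.\<close>

lemma wp_For:
  assumes "word_store B s0" and xy: "x \<noteq> y" and wr: "x \<notin> writes c" "y \<notin> writes c" and y: "s0 y 0 = n"
    and I0: "I 0 s0"
    and ins: "\<And>k s v. I k s \<Longrightarrow> I k (s(x := v))"
    and body: "\<And>k s. \<lbrakk>k < n; s x 0 = k; word_store B s; \<And>a. a \<notin> insert x (writes c) \<Longrightarrow> s a = s0 a;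
        I k s\<rbrakk> \<Longrightarrow> wp B c (\<lambda>t s'. t \<le> tb \<and> I (Suc k) s') s"
  shows "wp B (For x y c) (\<lambda>t s'. t \<le> n * (tb + 2) + 2 \<and> I n s') s0"
proof -
  have "wp B (While (Sc x \<prec> Sc y) (c ;; x ::= Sc x \<oplus> Num 1)) (\<lambda>t s'. t \<le> (n - 0) * (tb + 2) + 1 \<and> I n s')
      (s0(x := (s0 x)(0 := 0)))"
    by (rule wp_For_aux[where I = I and ?s0.0 = s0, OF xy wr y ins body])
      (use assms(1) ins[OF I0] in \<open>auto simp: word_store_def\<close>)
  then have "wp B (While (Sc x \<prec> Sc y) (c ;; x ::= Sc x \<oplus> Num 1)) (\<lambda>t s'. 1 + t \<le> n * (tb + 2) + 2 \<and> I n s')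
      (s0(x := (s0 x)(0 := 0)))"
    unfolding wp_def by (auto simp del: mult_Suc_right)
  then show ?thesis
    unfolding For_def wp_Seq wp_Store by simp
qed

text \<open>Some rounds of a loop without its final failing test. Such segments compose by
  \<open>iters_trans\<close>, so the part of the single search loop that handles one subtree can be
  treated as a unit.\<close>

inductive iters :: "nat \<Rightarrow> expr \<Rightarrow> com \<Rightarrow> store \<Rightarrow> nat \<Rightarrow> store \<Rightarrow> bool" for B b c where
  iters_refl: "iters B b c s 0 s"
| iters_step: "fits B s b \<Longrightarrow> eval_expr s b \<noteq> 0 \<Longrightarrow> exec B c s t1 s1 \<Longrightarrow> iters B b c s1 t2 s2 \<Longrightarrow>
    iters B b c s (t1 + t2 + 1) s2"

lemma iters_trans: "iters B b c s t1 s1 \<Longrightarrow> iters B b c s1 t2 s2 \<Longrightarrow> iters B b c s (t1 + t2) s2"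
proof (induction rule: iters.induct)
  case (iters_step s t1 s1 t2' s2')
  from iters.iters_step[OF iters_step(1,2,3) iters_step.IH[OF iters_step.prems]]
  show ?case by (simp add: ac_simps)
qed simp

lemma iters_While:
  "iters B b c s t1 s1 \<Longrightarrow> exec B (While b c) s1 t2 s2 \<Longrightarrow> exec B (While b c) s (t1 + t2) s2"
proof (induction rule: iters.induct)
  case (iters_step s t1 s1 t2' s2')
  from exec.While_True[OF iters_step(1,2,3) iters_step.IH[OF iters_step.prems]]
  show ?case by (simp add: ac_simps)
qed simp

section \<open>Paths and distances\<close>

lemma path_edges_Cons: "p \<noteq> [] \<Longrightarrow> path_edges (x # p) = {x, hd p} # path_edges p"
  by (cases p) auto

lemma path_edges_append:
  "p \<noteq> [] \<Longrightarrow> q \<noteq> [] \<Longrightarrow> path_edges (p @ q) = path_edges p @ {last p, hd q} # path_edges q"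
proof (induction p)
  case (Cons x p)
  then show ?case
    by (cases "p = []") (auto simp: path_edges_Cons)
qed simp

lemma path_edges_join:
  "p \<noteq> [] \<Longrightarrow> q \<noteq> [] \<Longrightarrow> last p = hd q \<Longrightarrow> path_edges (p @ tl q) = path_edges p @ path_edges q"
  by (cases q; cases "tl q = []") (auto simp: path_edges_append path_edges_Cons)

lemma last_join: "p \<noteq> [] \<Longrightarrow> q \<noteq> [] \<Longrightarrow> last p = hd q \<Longrightarrow> last (p @ tl q) = last q"
  by (cases q; cases "tl q = []") auto

lemma path_edges_rev: "path_edges (rev p) = rev (path_edges p)"
proof (induction p)
  case (Cons x p)
  then show ?case
    by (cases "p = []") (auto simp: path_edges_append path_edges_Cons last_rev insert_commute)
qed simp

lemma path_edges_subset: "e \<in> set (path_edges p) \<Longrightarrow> e \<subseteq> set p"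
  by (induction p rule: path_edges.induct) auto

lemma distinct_path_edges: "distinct p \<Longrightarrow> distinct (path_edges p)"
  by (induction p rule: path_edges.induct) (use path_edges_subset in fastforce)+

lemma ex_edge_of_vertex:
  "x \<in> set p \<Longrightarrow> length p \<ge> 2 \<Longrightarrow> \<exists>e\<in>set (path_edges p). x \<in> e"
proof (induction p rule: path_edges.induct)
  case (1 a b p)
  then show ?case by (cases p) auto
qed auto

lemma path_length_Nil [simp]: "path_length l [] = 0" "path_length l [x] = 0"
  by (simp_all add: path_length_def)

lemma path_length_Cons: "p \<noteq> [] \<Longrightarrow> path_length l (x # p) = l {x, hd p} + path_length l p"
  by (simp add: path_length_def path_edges_Cons)

lemma path_length_append:
  "p \<noteq> [] \<Longrightarrow> q \<noteq> [] \<Longrightarrow>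
    path_length l (p @ q) = path_length l p + l {last p, hd q} + path_length l q"
  by (simp add: path_length_def path_edges_append)

lemma path_length_join:
  "p \<noteq> [] \<Longrightarrow> q \<noteq> [] \<Longrightarrow> last p = hd q \<Longrightarrow>
    path_length l (p @ tl q) = path_length l p + path_length l q"
  by (simp add: path_length_def path_edges_join)

lemma path_length_rev: "path_length l (rev p) = path_length l p"
  by (simp add: path_length_def path_edges_rev rev_map[symmetric] sum_list_rev)

lemma path_length_edge_le: "e \<in> set (path_edges p) \<Longrightarrow> l e \<le> path_length l p"
  unfolding path_length_def by (rule member_le_sum_list) auto

lemma simple_path_rev: "simple_path E u v p \<Longrightarrow> simple_path E v u (rev p)"
  by (auto simp: simple_path_def path_edges_rev hd_rev last_rev)

lemma simple_path_mono: "simple_path E u v p \<Longrightarrow> E \<subseteq> E' \<Longrightarrow> simple_path E' u v p"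
  by (auto simp: simple_path_def)

lemma simple_path_singleton: "simple_path E u u [u]"
  by (auto simp: simple_path_def)

lemma simple_path_edge: "{u, v} \<in> E \<Longrightarrow> u \<noteq> v \<Longrightarrow> simple_path E u v [u, v]"
  by (auto simp: simple_path_def)

text \<open>The tail is made simple first; if the first vertex occurs in it, everything before that
  occurrence is cut off. With positive lengths every cut saves something, which is the strictness in
  the last conjunct.\<close>

lemma shorten_walk_aux:
  assumes "p \<noteq> []"
  shows "\<exists>q. q \<noteq> [] \<and> hd q = hd p \<and> last q = last p \<and> distinct q \<and>
    set (path_edges q) \<subseteq> set (path_edges p) \<and> path_length l q \<le> path_length l p \<and>
    (q = p \<or> (\<forall>e\<in>set (path_edges p). 1 \<le> l e) \<longrightarrow> q = p \<or> path_length l q < path_length l p)"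
  using assms
proof (induction p)
  case (Cons x p)
  show ?case
  proof (cases "p = []")
    case True
    then show ?thesis by (intro exI[of _ "[x]"]) auto
  next
    case False
    from Cons.IH[OF False] obtain q where q: "q \<noteq> []" "hd q = hd p" "last q = last p" "distinct q"
      "set (path_edges q) \<subseteq> set (path_edges p)" "path_length l q \<le> path_length l p"
      "(\<forall>e\<in>set (path_edges p). 1 \<le> l e) \<longrightarrow> q = p \<or> path_length l q < path_length l p" by blast
    show ?thesis
    proof (cases "x \<in> set q")
      case False
      then show ?thesis
        using q \<open>p \<noteq> []\<close> by (intro exI[of _ "x # q"]) (auto simp: path_edges_Cons path_length_Cons)
    next
      case True
      then obtain q1 q2 where q12: "q = q1 @ x # q2" by (meson split_list)
      have sub: "set (path_edges (x # q2)) \<subseteq> set (path_edges q)"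
        unfolding q12 by (cases "q1 = []") (auto simp: path_edges_append)
      have le: "path_length l (x # q2) \<le> path_length l q"
        unfolding q12 by (cases "q1 = []") (auto simp: path_length_append)
      have "1 \<le> l {x, hd p} \<Longrightarrow> path_length l (x # q2) < path_length l (x # p)"
        using le q(6) False by (simp add: path_length_Cons)
      then show ?thesis
        using q q12 False sub le
        by (intro exI[of _ "x # q2"]) (auto simp: path_edges_Cons path_length_Cons)
    qed
  qed
qed simp

lemma shorten_walk:
  assumes "p \<noteq> []" "hd p = u" "last p = v" "set (path_edges p) \<subseteq> F"
  obtains q where "simple_path F u v q" "path_length l q \<le> path_length l p"
    "set (path_edges q) \<subseteq> set (path_edges p)"
proof -
  from shorten_walk_aux[OF assms(1), of l] obtain q where
    "q \<noteq> []" "hd q = hd p" "last q = last p" "distinct q"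
    "set (path_edges q) \<subseteq> set (path_edges p)" "path_length l q \<le> path_length l p" by blast
  with assms show thesis by (intro that[of q]) (auto simp: simple_path_def)
qed

text \<open>Shortening a non-simple walk would give a strictly shorter simple path. This is how an
  exchange of initial parts, which a priori yields a walk only, still leads to a simple
  path.\<close>

lemma shortest_walk_simple:
  assumes "p \<noteq> []" "hd p = u" "last p = v" "set (path_edges p) \<subseteq> F" "\<And>e. e \<in> F \<Longrightarrow> 1 \<le> l e"
    and "\<And>q. simple_path F u v q \<Longrightarrow> path_length l p \<le> path_length l q"
  shows "simple_path F u v p"
proof -
  from shorten_walk_aux[OF assms(1), of l] obtain q where q: "simple_path F u v q"
    "(\<forall>e\<in>set (path_edges p). 1 \<le> l e) \<longrightarrow> q = p \<or> path_length l q < path_length l p"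
    using assms(2,3,4) by (auto simp: simple_path_def)
  have "q = p" using q(2) assms(4,5) assms(6)[OF q(1)] by auto
  with q(1) show ?thesis by simp
qed

lemma simple_path_in_verts:
  assumes "simple_graph V E" "simple_path E u v p" "u \<in> V"
  shows "set p \<subseteq> V"
proof
  fix x assume x: "x \<in> set p"
  show "x \<in> V"
  proof (cases "length p \<ge> 2")
    case True
    from ex_edge_of_vertex[OF x True] obtain e where "e \<in> set (path_edges p)" "x \<in> e" by blast
    then have "e \<in> E" using assms(2) by (auto simp: simple_path_def)
    with assms(1) obtain a b where "a \<in> V" "b \<in> V" "e = {a, b}"
      unfolding simple_graph_def by blast
    with \<open>x \<in> e\<close> show ?thesis by auto
  next
    case False
    then obtain y where "p = [y]"
      using x by (cases p; cases "tl p") auto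
    then show ?thesis using assms(2,3) x by (auto simp: simple_path_def)
  qed
qed

lemma simple_graph_finite: "simple_graph V E \<Longrightarrow> finite E"
proof -
  assume a: "simple_graph V E"
  then have "E \<subseteq> Pow V" "finite V" unfolding simple_graph_def by fastforce+
  then show ?thesis by (simp add: finite_subset)
qed

lemma simple_graph_edge:
  "simple_graph V E \<Longrightarrow> {u, v} \<in> E \<Longrightarrow> u \<in> V \<and> v \<in> V \<and> u \<noteq> v"
  unfolding simple_graph_def by (fastforce simp: doubleton_eq_iff)

lemma path_length_le_sum:
  assumes "finite E" "simple_path E u v p"
  shows "path_length l p \<le> sum l E"
proof -
  have "path_length l p = sum l (set (path_edges p))"
    unfolding path_length_def using assms(2)
    by (intro sum_list_distinct_conv_sum_set distinct_path_edges) (simp add: simple_path_def)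
  also have "\<dots> \<le> sum l E"
    using assms by (intro sum_mono2) (auto simp: simple_path_def)
  finally show ?thesis .
qed

text \<open>The distance as a natural number, the form in which programs compute it. If
  \<open>u\<close> and \<open>v\<close> are not joined by a path, the value is unspecified, so
  several facts below assume a path.\<close>

definition dst :: "'a set set \<Rightarrow> ('a set \<Rightarrow> nat) \<Rightarrow> 'a \<Rightarrow> 'a \<Rightarrow> nat" where
  "dst E l u v = (LEAST k. \<exists>p. simple_path E u v p \<and> path_length l p = k)"

lemma dst_le: "simple_path E u v p \<Longrightarrow> dst E l u v \<le> path_length l p"
  unfolding dst_def by (rule Least_le) blast

lemma dst_attained:
  assumes "simple_path E u v p0"
  obtains p where "simple_path E u v p" "path_length l p = dst E l u v"
proof -
  have "\<exists>k p. simple_path E u v p \<and> path_length l p = k" using assms by blast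
  from LeastI_ex[OF this] show ?thesis unfolding dst_def[symmetric] using that by blast
qed

lemma dst_le_walk:
  assumes "p \<noteq> []" "hd p = u" "last p = v" "set (path_edges p) \<subseteq> E"
  shows "dst E l u v \<le> path_length l p"
proof -
  obtain q where "simple_path E u v q" "path_length l q \<le> path_length l p"
    using shorten_walk[OF assms, of l] by blast
  with dst_le[of E u v q l] show ?thesis by simp
qed

lemma dst_self [simp]: "dst E l u u = 0"
  using dst_le[OF simple_path_singleton, of E l u] by simp

lemma dst_edge: "{u, v} \<in> E \<Longrightarrow> dst E l u v \<le> l {u, v}"
  using dst_le_walk[of "[u, v]" u v E l] by (simp add: path_length_def)

lemma dst_triangle:
  assumes "simple_path E u v p" "simple_path E v w q"
  shows "dst E l u w \<le> dst E l u v + dst E l v w"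
proof -
  obtain p' where p': "simple_path E u v p'" "path_length l p' = dst E l u v"
    using dst_attained[OF assms(1)] by blast
  obtain q' where q': "simple_path E v w q'" "path_length l q' = dst E l v w"
    using dst_attained[OF assms(2)] by blast
  have "dst E l u w \<le> path_length l (p' @ tl q')"
    by (rule dst_le_walk) (use p'(1) q'(1) in \<open>auto simp: simple_path_def path_edges_join last_join\<close>)
  then show ?thesis using p' q' by (simp add: path_length_join simple_path_def)
qed

lemma dst_commute: "dst E l u v = dst E l v u"
proof -
  have "(\<exists>p. simple_path E u v p \<and> path_length l p = k) \<longleftrightarrow>
      (\<exists>p. simple_path E v u p \<and> path_length l p = k)" for k
    using simple_path_rev path_length_rev by metis
  then show ?thesis unfolding dst_def by simp
qed

lemma connected_graph_path:
  "connected_graph V E \<Longrightarrow> u \<in> V \<Longrightarrow> v \<in> V \<Longrightarrow> \<exists>p. simple_path E u v p"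
  by (auto simp: connected_graph_def)

lemma sp_dist_eq_dst:
  assumes "simple_path E u v p0"
  shows "sp_dist E l u v = ereal (real (dst E l u v))"
proof -
  obtain p where p: "simple_path E u v p" "path_length l p = dst E l u v"
    using dst_attained[OF assms] by blast
  show ?thesis unfolding sp_dist_def
  proof (rule antisym)
    show "(INF q\<in>{q. simple_path E u v q}. ereal (real (path_length l q))) \<le> ereal (real (dst E l u v))"
      by (rule INF_lower2[of p]) (use p in auto)
    show "ereal (real (dst E l u v)) \<le> (INF q\<in>{q. simple_path E u v q}. ereal (real (path_length l q)))"
      by (rule INF_greatest) (simp add: dst_le)
  qed
qed

text \<open>Lengths are natural numbers, so the infimum is attained if there is a path, and it is
  infinite otherwise.\<close>

lemma sp_dist_le_iff:
  "sp_dist E l u v \<le> ereal c \<longleftrightarrow> (\<exists>p. simple_path E u v p \<and> real (path_length l p) \<le> c)"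
proof (cases "\<exists>p. simple_path E u v p")
  case True
  then obtain p0 where p0: "simple_path E u v p0" by blast
  obtain p where p: "simple_path E u v p" "path_length l p = dst E l u v"
    using dst_attained[OF p0] by blast
  have "real (dst E l u v) \<le> real (path_length l q)" if "simple_path E u v q" for q
    using dst_le[OF that, of l] by simp
  then show ?thesis unfolding sp_dist_eq_dst[OF p0] using p
    using order_trans by fastforce
next
  case False
  then have "sp_dist E l u v = \<infinity>" by (simp add: sp_dist_def top_ereal_def)
  with False show ?thesis by simp
qed

definition mask_len :: "'a set set \<Rightarrow> nat \<Rightarrow> ('a set \<Rightarrow> nat) \<Rightarrow> 'a set \<Rightarrow> nat" where
  "mask_len F M l e = (if e \<in> F then l e else M)"

lemma path_length_mask:
  assumes "set (path_edges p) \<subseteq> F"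
  shows "path_length (mask_len F M l) p = path_length l p"
  unfolding path_length_def mask_len_def using assms
  by (intro arg_cong[where f = sum_list] map_cong) auto

lemma path_avoids_mask:
  assumes "path_length (mask_len F M l) p < M"
  shows "set (path_edges p) \<subseteq> F"
proof
  fix e assume "e \<in> set (path_edges p)"
  then have "mask_len F M l e < M"
    using path_length_edge_le[of e p "mask_len F M l"] assms by simp
  then show "e \<in> F" by (simp add: mask_len_def split: if_splits)
qed

text \<open>Forbidden edges get a length \<open>M\<close> beyond every bound of interest, so that the distance
  algorithms always run on the whole, connected graph.\<close>

lemma dst_mask_le_iff:
  assumes "simple_path E u v p0" "F \<subseteq> E" "k < M"
  shows "dst E (mask_len F M l) u v \<le> k \<longleftrightarrow> (\<exists>p. simple_path F u v p \<and> path_length l p \<le> k)"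
proof
  assume a: "dst E (mask_len F M l) u v \<le> k"
  obtain p where p: "simple_path E u v p"
    "path_length (mask_len F M l) p = dst E (mask_len F M l) u v"
    using dst_attained[OF assms(1)] by blast
  have F: "set (path_edges p) \<subseteq> F"
    using path_avoids_mask[of F M l p] p(2) a assms(3) by simp
  then show "\<exists>p. simple_path F u v p \<and> path_length l p \<le> k"
    using p a path_length_mask[OF F, of M l] by (intro exI[of _ p]) (auto simp: simple_path_def)
next
  assume "\<exists>p. simple_path F u v p \<and> path_length l p \<le> k"
  then obtain p where p: "simple_path F u v p" "path_length l p \<le> k" by blast
  have "path_length (mask_len F M l) p = path_length l p"
    by (rule path_length_mask) (use p in \<open>auto simp: simple_path_def\<close>)
  then show "dst E (mask_len F M l) u v \<le> k"
    using dst_le[OF simple_path_mono[OF p(1) assms(2)], of "mask_len F M l"] p(2) by simp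
qed

section \<open>The spanner problem\<close>

lemma path_edges_split:
  "e \<in> set (path_edges p) \<Longrightarrow> \<exists>p1 a b p2. p = p1 @ a # b # p2 \<and> e = {a, b}"
proof (induction p rule: path_edges.induct)
  case (1 x y p)
  show ?case
  proof (cases "e = {x, y}")
    case True
    then show ?thesis by (intro exI[of _ "[]"]) auto
  next
    case False
    with 1 obtain p1 a b p2 where "y # p = p1 @ a # b # p2" "e = {a, b}" by auto
    then show ?thesis by (intro exI[of _ "x # p1"]) auto
  qed
qed auto

locale inst =
  fixes I :: spanner_inst
  assumes valid: "valid_inst I"
begin

abbreviation "n \<equiv> nverts I"
abbreviation "E \<equiv> edges I"
abbreviation "l \<equiv> elen I"
abbreviation "num \<equiv> stretch_num I"
abbreviation "den \<equiv> stretch_den I"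
abbreviation "dG \<equiv> dst E l"

lemma graph: "simple_graph {..<n} E" and conn: "connected_graph {..<n} E"
  and len_pos: "e \<in> E \<Longrightarrow> 1 \<le> l e" and stretch_ge: "1 \<le> stretch I"
  using valid by (auto simp: valid_inst_def)

lemma n_pos: "0 < n"
  using conn by (cases n) (auto simp: connected_graph_def)

lemma finE: "finite E" using simple_graph_finite[OF graph] .

lemma edgeD: "{u, v} \<in> E \<Longrightarrow> u < n \<and> v < n \<and> u \<noteq> v"
  using simple_graph_edge[OF graph] by auto

lemma pathE: "u < n \<Longrightarrow> v < n \<Longrightarrow> \<exists>p. simple_path E u v p"
  using connected_graph_path[OF conn] by simp

lemma stretch_quot:
  shows "den \<ge> 1" and "den \<le> num" and "of_rat (stretch I) = real num / real den"
proof -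
  obtain a b where ab: "quotient_of (stretch I) = (a, b)" by fastforce
  have b: "b > 0" using quotient_of_denom_pos[OF ab] .
  have eq: "stretch I = of_int a / of_int b" using quotient_of_div[OF ab] .
  have "of_int b \<le> (of_int a :: rat)" using stretch_ge b by (simp add: eq)
  then have ba: "b \<le> a" by simp
  show "den \<ge> 1" "den \<le> num"
    using b ba by (auto simp: stretch_den_def stretch_num_def ab)
  have "num = nat a" "den = nat b" by (simp_all add: stretch_den_def stretch_num_def ab)
  then show "of_rat (stretch I) = real num / real den"
    using b ba by (simp add: eq of_rat_divide)
qed

lemma alpha_dist_eq:
  "u < n \<Longrightarrow> v < n \<Longrightarrow> alpha_dist I u v = ereal (real (num * dG u v) / real den)"
proof -
  assume "u < n" "v < n"
  then obtain p where "simple_path E u v p" using pathE by blast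
  from sp_dist_eq_dst[OF this, of l] show ?thesis
    using stretch_quot(3) by (simp add: alpha_dist_def)
qed

section \<open>The preprocessed instance\<close>

definition alive :: "nat set set" where "alive = edges (preprocess I)"

text \<open>Clearing the positive denominator turns a stretch condition into a comparison of
  integers, the form in which the program tests it.\<close>

lemma le_quot_iff: "real k \<le> real (num * d) / real den \<longleftrightarrow> k * den \<le> num * d"
proof -
  have "real k \<le> real (num * d) / real den \<longleftrightarrow> real (k * den) \<le> real (num * d)"
    using stretch_quot(1) by (simp add: field_simps)
  then show ?thesis by (simp only: of_nat_le_iff)
qed

lemma alive_iff: "{u, v} \<in> alive \<longleftrightarrow> {u, v} \<in> E \<and> l {u, v} * den \<le> num * dG u v"
proof -
  have "{u, v} \<in> alive \<longleftrightarrow>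
      (\<exists>a b. {u, v} = {a, b} \<and> {a, b} \<in> E \<and> ereal (real (l {a, b})) \<le> alpha_dist I a b)"
    by (auto simp: alive_def preprocess_def)
  also have "\<dots> \<longleftrightarrow> (\<exists>a b. {u, v} = {a, b} \<and> {a, b} \<in> E \<and> l {a, b} * den \<le> num * dG a b)"
  proof -
    have "ereal (real (l {a, b})) \<le> alpha_dist I a b \<longleftrightarrow> l {a, b} * den \<le> num * dG a b"
      if "{a, b} \<in> E" for a b
      using edgeD[OF that] le_quot_iff[of "l {a, b}" "dG a b"] by (simp add: alpha_dist_eq)
    then show ?thesis by meson
  qed
  also have "\<dots> \<longleftrightarrow> {u, v} \<in> E \<and> l {u, v} * den \<le> num * dG u v"
    by (auto simp: doubleton_eq_iff insert_commute dst_commute)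
  finally show ?thesis .
qed

lemma alive_sub: "alive \<subseteq> E"
  by (auto simp: alive_def preprocess_def)

lemma fin_alive: "finite alive" using alive_sub finE finite_subset by blast

lemma alive_edge: "{u, v} \<in> alive \<Longrightarrow> u < n \<and> v < n \<and> u \<noteq> v"
  using alive_sub edgeD by blast

text \<open>By the triangle inequality an edge on a shortest path is no longer than the distance of
  its ends; as the stretch is at least 1, it settles itself. Hence the preprocessing changes no
  distance.\<close>

lemma shortest_path_alive:
  assumes "u < n" "v < n"
  obtains p where "simple_path alive u v p" "path_length l p = dG u v"
proof -
  obtain p where p: "simple_path E u v p" "path_length l p = dG u v"
    using pathE[OF assms] dst_attained by metis
  have "e \<in> alive" if "e \<in> set (path_edges p)" for e
  proof -
    obtain p1 a b p2 where s: "p = p1 @ a # b # p2" and e: "e = {a, b}"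
      using path_edges_split[OF \<open>e \<in> set (path_edges p)\<close>] by blast
    have "e \<in> E" using p(1) that by (auto simp: simple_path_def)
    then have ab: "a < n" "b < n" using edgeD e by auto
    have "path_length l p = path_length l (p1 @ [a]) + l e + path_length l (b # p2)"
      unfolding s e using path_length_append[of "p1 @ [a]" "b # p2" l] by simp
    moreover have "dG u a \<le> path_length l (p1 @ [a])"
      by (rule dst_le_walk)
        (use p(1) s path_edges_append[of "p1 @ [a]" "b # p2"] in \<open>auto simp: simple_path_def hd_append\<close>)
    moreover have "dG b v \<le> path_length l (b # p2)"
      by (rule dst_le_walk)
        (use p(1) s path_edges_append[of "p1 @ [a]" "b # p2"] in \<open>auto simp: simple_path_def hd_append\<close>)
    moreover have "dG u v \<le> dG u a + dG a v" "dG a v \<le> dG a b + dG b v"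
      using dst_triangle pathE assms ab by meson+
    ultimately have "l e \<le> dG a b" using p(2) by linarith
    then have "l e * den \<le> dG a b * num" using stretch_quot(2) mult_le_mono by blast
    then show "e \<in> alive" using \<open>e \<in> E\<close> e alive_iff by (simp add: mult.commute)
  qed
  then show thesis using that[of p] p by (auto simp: simple_path_def)
qed

lemma dst_alive: "u < n \<Longrightarrow> v < n \<Longrightarrow> dst alive l u v = dG u v"
proof (rule antisym)
  assume uv: "u < n" "v < n"
  obtain p where p: "simple_path alive u v p" "path_length l p = dG u v"
    using shortest_path_alive[OF uv] by blast
  show "dst alive l u v \<le> dG u v" using dst_le[OF p(1), of l] p(2) by simp
  obtain q where q: "simple_path alive u v q" "path_length l q = dst alive l u v"
    using dst_attained[OF p(1)] by blast
  show "dG u v \<le> dst alive l u v"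
    using dst_le[OF simple_path_mono[OF q(1) alive_sub], of l] q(2) by simp
qed

lemma preprocess_sel [simp]:
  "edges (preprocess I) = alive" "nverts (preprocess I) = n" "weight (preprocess I) = weight I"
  "elen (preprocess I) = l" "stretch (preprocess I) = stretch I" "budget (preprocess I) = budget I"
  "mu (preprocess I) = mu I"
  by (simp_all add: alive_def preprocess_def)

lemma alpha_dist_preprocess:
  assumes "u < n" "v < n"
  shows "alpha_dist (preprocess I) u v = ereal (real (num * dG u v) / real den)"
proof -
  obtain p where p: "simple_path alive u v p" using shortest_path_alive[OF assms] by blast
  show ?thesis
    using sp_dist_eq_dst[OF p, of l] stretch_quot(3) dst_alive[OF assms] by (simp add: alpha_dist_def)
qed

text \<open>The stretch bound in cross-multiplied form. \<open>dG\<close> refers to the original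
  graph, which by \<open>dst_alive\<close> gives the same distances as the preprocessed one.\<close>

definition settled :: "nat set set \<Rightarrow> nat \<Rightarrow> nat \<Rightarrow> bool" where
  "settled F u v \<longleftrightarrow> (\<exists>p. simple_path F u v p \<and> path_length l p * den \<le> num * dG u v)"

definition settles_all :: "nat set set \<Rightarrow> bool" where
  "settles_all F \<longleftrightarrow> (\<forall>u v. {u, v} \<in> alive \<longrightarrow> settled F u v)"

lemma settled_mono: "settled F u v \<Longrightarrow> F \<subseteq> F' \<Longrightarrow> settled F' u v"
  using simple_path_mono unfolding settled_def by meson

lemma settled_commute: "settled F u v \<longleftrightarrow> settled F v u"
  using simple_path_rev path_length_rev dst_commute unfolding settled_def by metis

lemma settled_edge: "{u, v} \<in> alive \<Longrightarrow> {u, v} \<in> F \<Longrightarrow> settled F u v"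
  unfolding settled_def using alive_iff alive_edge
  by (intro exI[of _ "[u, v]"]) (auto simp: simple_path_edge path_length_def)

lemma settled_iff_dist:
  "u < n \<Longrightarrow> v < n \<Longrightarrow>
    settled F u v \<longleftrightarrow> sp_dist F l u v \<le> alpha_dist (preprocess I) u v"
  by (simp add: alpha_dist_preprocess sp_dist_le_iff settled_def le_quot_iff del: of_nat_mult)

lemma settling_paths_iff:
  "u < n \<Longrightarrow> v < n \<Longrightarrow> p \<in> settling_paths (preprocess I) u v \<longleftrightarrow>
    simple_path alive u v p \<and> path_length l p * den \<le> num * dG u v"
  by (simp add: settling_paths_def alpha_dist_preprocess le_quot_iff del: of_nat_mult)

text \<open>Each edge is replaced by a path of \<open>F\<close> that settles its ends; this path is
  at most the stretch times the distance of the ends, hence at most the stretch times the edge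
  length. Concatenation gives a walk.\<close>

lemma settles_all_path:
  assumes "settles_all F" "p \<noteq> []" "set (path_edges p) \<subseteq> alive"
  shows "\<exists>q. q \<noteq> [] \<and> hd q = hd p \<and> last q = last p \<and> set (path_edges q) \<subseteq> F \<and>
    path_length l q * den \<le> num * path_length l p"
  using assms(2,3)
proof (induction p)
  case (Cons x p)
  show ?case
  proof (cases "p = []")
    case True
    then show ?thesis by (intro exI[of _ "[x]"]) auto
  next
    case False
    with Cons obtain q where q: "q \<noteq> []" "hd q = hd p" "last q = last p"
      "set (path_edges q) \<subseteq> F" "path_length l q * den \<le> num * path_length l p"
      by (auto simp: path_edges_Cons)
    have al: "{x, hd p} \<in> alive" using Cons.prems False by (simp add: path_edges_Cons)
    then obtain r where r: "simple_path F x (hd p) r" "path_length l r * den \<le> num * dG x (hd p)"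
      using assms(1) unfolding settles_all_def settled_def by blast
    have "num * dG x (hd p) \<le> num * l {x, hd p}"
      using dst_edge[of x "hd p" E l] al alive_sub by auto
    with r(2) have "path_length l r * den \<le> num * l {x, hd p}" by linarith
    moreover have "path_length l (r @ tl q) = path_length l r + path_length l q"
      using r q by (intro path_length_join) (auto simp: simple_path_def)
    ultimately have "path_length l (r @ tl q) * den \<le> num * path_length l (x # p)"
      using q(5) False by (simp add: path_length_Cons add_mult_distrib add_mult_distrib2)
    then show ?thesis using r q False
      by (intro exI[of _ "r @ tl q"]) (auto simp: simple_path_def path_edges_join last_join)
  qed
qed simp

text \<open>To pass from edges to arbitrary pairs, \<open>settles_all_path\<close> is applied to a
  shortest path of surviving edges, and the resulting walk is shortened to a simple path.\<close>

lemma is_spanner_iff: "is_spanner (preprocess I) F \<longleftrightarrow> F \<subseteq> alive \<and> settles_all F"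
proof -
  have "settled F u v" if sa: "settles_all F" and un: "u < n" and vn: "v < n" for u v
  proof -
    obtain p where p: "simple_path alive u v p" "path_length l p = dG u v"
      using shortest_path_alive[OF un vn] by blast
    with settles_all_path[OF sa, of p] obtain q where q: "q \<noteq> []" "hd q = u" "last q = v"
      "set (path_edges q) \<subseteq> F" "path_length l q * den \<le> num * dG u v"
      by (auto simp: simple_path_def)
    obtain r where r: "simple_path F u v r" "path_length l r \<le> path_length l q"
      using shorten_walk[OF q(1-4), of l] by blast
    have "path_length l r * den \<le> path_length l q * den" using r(2) by simp
    with q(5) r(1) show ?thesis unfolding settled_def by (meson le_trans)
  qed
  moreover have "settles_all F" if "\<And>u v. u < n \<Longrightarrow> v < n \<Longrightarrow> settled F u v"
    unfolding settles_all_def using that alive_edge by blast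
  ultimately show ?thesis
    unfolding is_spanner_def by (auto simp: settled_iff_dist[symmetric])
qed

section \<open>Trivial edges, critical pairs and solutions\<close>

definition triv :: "nat set set" where "triv = trivial_edges (preprocess I)"

text \<open>An alternative settling path is a settling path in the graph without the edge. So one
  distance computation with this edge forbidden decides the property.\<close>

lemma mandatory_iff:
  "{u, v} \<in> mandatory_edges (preprocess I) \<longleftrightarrow> {u, v} \<in> alive \<and> \<not> settled (alive - {{u, v}}) u v"
proof -
  have *: "(\<exists>p\<in>settling_paths (preprocess I) a b. {a, b} \<notin> set (path_edges p)) \<longleftrightarrow>
      settled (alive - {{a, b}}) a b" if "{a, b} \<in> alive" for a b
  proof -
    have "p \<in> settling_paths (preprocess I) a b \<longleftrightarrow>
      simple_path alive a b p \<and> path_length l p * den \<le> num * dG a b" for p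
      using settling_paths_iff alive_edge[OF that] by simp
    then show ?thesis by (auto simp: settled_def simple_path_def)
  qed
  have "{u, v} \<in> mandatory_edges (preprocess I) \<longleftrightarrow>
      (\<exists>a b. {u, v} = {a, b} \<and> {a, b} \<in> alive \<and> \<not> settled (alive - {{a, b}}) a b)"
    unfolding mandatory_edges_def using * by (auto simp del: settling_paths_def) blast+
  also have "\<dots> \<longleftrightarrow> {u, v} \<in> alive \<and> \<not> settled (alive - {{u, v}}) u v"
    using settled_commute by (auto simp: doubleton_eq_iff insert_commute)
  finally show ?thesis .
qed

lemma triv_sub: "triv \<subseteq> alive"
  by (auto simp: triv_def trivial_edges_def mandatory_edges_def)

lemma triv_iff:
  "{u, v} \<in> triv \<longleftrightarrow>
    {u, v} \<in> alive \<and> (\<not> settled (alive - {{u, v}}) u v \<or> weight I {u, v} = 0)"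
  by (auto simp: triv_def trivial_edges_def mandatory_iff)

lemma critical_iff:
  "{u, v} \<in> critical_pairs (preprocess I) \<longleftrightarrow> {u, v} \<in> alive \<and> \<not> settled triv u v"
proof -
  have *: "(\<exists>p\<in>settling_paths (preprocess I) a b. set (path_edges p) \<subseteq> triv) \<longleftrightarrow>
      settled triv a b" if "{a, b} \<in> alive" for a b
  proof -
    have "p \<in> settling_paths (preprocess I) a b \<longleftrightarrow>
      simple_path alive a b p \<and> path_length l p * den \<le> num * dG a b" for p
      using settling_paths_iff alive_edge[OF that] by simp
    then show ?thesis using triv_sub by (auto simp: settled_def simple_path_def)
  qed
  have "{u, v} \<in> critical_pairs (preprocess I) \<longleftrightarrow>
      (\<exists>a b. {u, v} = {a, b} \<and> {a, b} \<in> alive \<and> \<not> settled triv a b)"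
    unfolding critical_pairs_def triv_def[symmetric] using * by auto blast+
  also have "\<dots> \<longleftrightarrow> {u, v} \<in> alive \<and> \<not> settled triv u v"
    using settled_commute by (auto simp: doubleton_eq_iff insert_commute)
  finally show ?thesis .
qed

text \<open>A solution normalised to contain all trivial edges; \<open>H - triv\<close> is then
  exactly its set of nontrivial edges.\<close>

definition good :: "nat set set \<Rightarrow> bool" where
  "good H \<longleftrightarrow> triv \<subseteq> H \<and> H \<subseteq> alive \<and> settles_all H \<and> sum (weight I) H \<le> budget I \<and>
     card (H - triv) \<le> mu I"

text \<open>If \<open>F\<close> missed the edge, the path by which \<open>F\<close> settles its ends
  would be an alternative one.\<close>

lemma mandatory_sub:
  assumes "settles_all F" "F \<subseteq> alive"
  shows "mandatory_edges (preprocess I) \<subseteq> F"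
proof
  fix e assume e: "e \<in> mandatory_edges (preprocess I)"
  then obtain u v where uv: "e = {u, v}" by (auto simp: mandatory_edges_def)
  show "e \<in> F"
  proof (rule ccontr)
    assume "e \<notin> F"
    moreover have "settled F u v" using assms(1) e uv mandatory_iff settles_all_def by blast
    ultimately have "settled (alive - {e}) u v"
      using assms(2) by (intro settled_mono[of F u v "alive - {e}"]) auto
    then show False using e mandatory_iff[of u v] unfolding uv by simp
  qed
qed

lemma yes_inst_iff: "yes_inst (preprocess I) \<longleftrightarrow> (\<exists>H. good H)"
proof -
  have nt: "F \<inter> nontrivial_edges (preprocess I) = F - triv" if "F \<subseteq> alive" for F
    using that by (auto simp: nontrivial_edges_def triv_def)
  have yi: "yes_inst (preprocess I) \<longleftrightarrow> (\<exists>F. F \<subseteq> alive \<and> settles_all F \<and>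
      sum (weight I) F \<le> budget I \<and> card (F - triv) \<le> mu I)"
    unfolding yes_inst_def is_spanner_iff using nt by (auto; metis)
  show ?thesis
  proof
    assume "yes_inst (preprocess I)"
    then obtain F where F: "F \<subseteq> alive" "settles_all F" "sum (weight I) F \<le> budget I"
      "card (F - triv) \<le> mu I" unfolding yi by blast
    have fin: "finite F" "finite triv" using F(1) triv_sub fin_alive finite_subset by blast+
    have "weight I e = 0" if "e \<in> triv - F" for e
      using that mandatory_sub[OF F(2,1)] by (auto simp: triv_def trivial_edges_def)
    then have "sum (weight I) (F \<union> triv) = sum (weight I) F"
      using fin by (intro sum.mono_neutral_right) auto
    moreover have "settles_all (F \<union> triv)"
      using F(2) settled_mono unfolding settles_all_def by blast
    moreover have "(F \<union> triv) - triv = F - triv" by auto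
    ultimately have "good (F \<union> triv)" using F triv_sub by (simp add: good_def)
    then show "\<exists>H. good H" by blast
  next
    assume "\<exists>H. good H"
    then show "yes_inst (preprocess I)" unfolding yi good_def by blast
  qed
qed

section \<open>Neighborhoods, and nodes without branching\<close>

definition nbhd :: "nat \<Rightarrow> nat \<Rightarrow> nat set" where
  "nbhd u v = \<Union> (set ` settling_paths (preprocess I) u v)"

abbreviation "h \<equiv> nbhd_size (preprocess I)"

lemma nbhd_sub:
  assumes "u < n" "v < n"
  shows "nbhd u v \<subseteq> {..<n}"
proof -
  have "set p \<subseteq> {..<n}" if "p \<in> settling_paths (preprocess I) u v" for p
  proof -
    have "simple_path alive u v p" using that settling_paths_iff[OF assms] by simp
    from simple_path_in_verts[OF graph simple_path_mono[OF this alive_sub]] assms(1)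
    show ?thesis by simp
  qed
  then show ?thesis by (auto simp: nbhd_def)
qed

lemma nbhd_path:
  assumes "{u, v} \<in> alive" "simple_path alive u v p" "path_length l p * den \<le> num * dG u v"
  shows "set p \<subseteq> nbhd u v"
proof -
  have "p \<in> settling_paths (preprocess I) u v"
    using assms(2,3) alive_edge[OF assms(1)] by (simp add: settling_paths_iff)
  then show ?thesis by (auto simp: nbhd_def)
qed

lemma nbhd_size_ge:
  assumes "{u, v} \<in> critical_pairs (preprocess I)"
  shows "card (nbhd u v) \<le> h"
proof -
  let ?S = "{card (\<Union>p\<in>settling_paths (preprocess I) u v. set p) | u v. {u, v} \<in> critical_pairs (preprocess I)}"
  have "?S \<subseteq> (\<lambda>(u, v). card (nbhd u v)) ` ({..<n} \<times> {..<n})"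
    using critical_iff alive_edge by (fastforce simp: nbhd_def)
  then have "finite ?S" by (rule finite_subset) simp
  moreover have "card (nbhd u v) \<in> ?S" unfolding nbhd_def using assms by blast
  ultimately show ?thesis unfolding nbhd_size_def by (intro Max_ge) auto
qed

text \<open>The edge is itself a settling path, so both of its ends are counted. The recurrence for
  the search tree relies on this bound.\<close>

lemma nbhd_size_ge2:
  assumes "{u, v} \<in> critical_pairs (preprocess I)"
  shows "2 \<le> h"
proof -
  have al: "{u, v} \<in> alive" using assms critical_iff by blast
  have uv: "u < n" "v < n" "u \<noteq> v" using alive_edge[OF al] by auto
  have "set [u, v] \<subseteq> nbhd u v"
    by (rule nbhd_path[OF al]) (use al uv alive_iff in \<open>auto simp: simple_path_edge path_length_def\<close>)
  then have "card {u, v} \<le> card (nbhd u v)"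
    using nbhd_sub[OF uv(1,2)] finite_subset by (intro card_mono) auto
  then show ?thesis using uv nbhd_size_ge[OF assms] by simp
qed

text \<open>Weights are non-negative, so among the supersets of a spanner \<open>F\<close> none is
  lighter than \<open>F\<close> itself.\<close>

lemma good_leaf:
  assumes "triv \<subseteq> F" "F \<subseteq> alive" "card (F - triv) \<le> mu I" "settles_all F"
  shows "(\<exists>H. good H \<and> F \<subseteq> H) \<longleftrightarrow> sum (weight I) F \<le> budget I"
proof
  assume "\<exists>H. good H \<and> F \<subseteq> H"
  then obtain H where "good H" "F \<subseteq> H" by blast
  moreover from this have "sum (weight I) F \<le> sum (weight I) H"
    using fin_alive finite_subset unfolding good_def by (intro sum_mono2) auto
  ultimately show "sum (weight I) F \<le> budget I" by (simp add: good_def)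
qed (use assms in \<open>auto simp: good_def\<close>)

text \<open>The number of nontrivial edges is used up, so no further edge fits. An unsettled pair at
  depth \<open>mu\<close> is therefore a dead end.\<close>

lemma good_full:
  assumes "triv \<subseteq> F" "card (F - triv) = mu I" "good H" "F \<subseteq> H"
  shows "H = F"
proof -
  have "finite (H - triv)" using assms(3) fin_alive finite_subset unfolding good_def by blast
  moreover have "F - triv \<subseteq> H - triv" using assms(4) by auto
  moreover have "card (H - triv) \<le> card (F - triv)" using assms(2,3) by (simp add: good_def)
  ultimately have "F - triv = H - triv" by (simp add: card_seteq)
  then show ?thesis using assms(1,4) by auto
qed

end

section \<open>Branching on an unsettled pair\<close>

context inst
begin

abbreviation "S \<equiv> sum l E"

text \<open>As \<open>den >= 1\<close> and every distance is at most the sum \<open>S\<close> of all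
  lengths, a path that settles a pair has length at most \<open>num * S\<close>. One more than this
  is beyond every settling path.\<close>

definition Big :: nat where "Big = num * S + 1"

abbreviation mdst :: "nat set set \<Rightarrow> nat \<Rightarrow> nat \<Rightarrow> nat" where
  "mdst F \<equiv> dst E (mask_len F Big l)"

lemma dG_le_S: "u < n \<Longrightarrow> v < n \<Longrightarrow> dG u v \<le> S"
  using pathE[of u v] dst_le path_length_le_sum[OF finE] le_trans by metis

lemma settle_lt_Big:
  assumes "k * den \<le> num * dG u v" "u < n" "v < n"
  shows "k < Big"
proof -
  have "k * 1 \<le> k * den" using stretch_quot(1) by (intro mult_le_mono) auto
  also have "\<dots> \<le> num * S" using assms(1) dG_le_S[OF assms(2,3)] mult_le_mono2 le_trans by blast
  finally show ?thesis by (simp add: Big_def)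
qed

lemma mdst_le_iff:
  assumes "u < n" "v < n" "F \<subseteq> E" "k < Big"
  shows "mdst F u v \<le> k \<longleftrightarrow> (\<exists>p. simple_path F u v p \<and> path_length l p \<le> k)"
proof -
  obtain p0 where "simple_path E u v p0" using pathE[OF assms(1,2)] by blast
  from dst_mask_le_iff[OF this assms(3,4)] show ?thesis .
qed

text \<open>Either side forces the length in question below \<open>Big\<close>, where masked
  distances are lengths of genuine paths of \<open>F\<close>.\<close>

lemma settled_iff_mdst:
  assumes "u < n" "v < n" "F \<subseteq> E"
  shows "settled F u v \<longleftrightarrow> mdst F u v * den \<le> num * dG u v"
proof
  assume "settled F u v"
  then obtain p where p: "simple_path F u v p" "path_length l p * den \<le> num * dG u v"
    unfolding settled_def by blast
  have "mdst F u v \<le> path_length l p"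
    using mdst_le_iff[OF assms settle_lt_Big[OF p(2) assms(1,2)]] p(1) by blast
  then have "mdst F u v * den \<le> path_length l p * den" by simp
  with p(2) show "mdst F u v * den \<le> num * dG u v" by linarith
next
  assume a: "mdst F u v * den \<le> num * dG u v"
  obtain p where p: "simple_path F u v p" "path_length l p \<le> mdst F u v"
    using mdst_le_iff[OF assms settle_lt_Big[OF a assms(1,2)]] by blast
  then have "path_length l p * den \<le> mdst F u v * den" by simp
  with a p(1) show "settled F u v" unfolding settled_def by (meson le_trans)
qed

end

text \<open>\<open>par\<close> is any choice of predecessors on shortest paths of \<open>F\<close>
  from \<open>u\<close>. It is constrained only where the masked distance is below
  \<open>Big\<close>; elsewhere the array that provides it may hold anything.\<close>

locale branch = inst +
  fixes F :: "nat set set" and u v :: nat and par :: "nat \<Rightarrow> nat"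
  assumes F_sub: "F \<subseteq> alive" and uv: "{u, v} \<in> alive" and unset: "\<not> settled F u v"
    and par: "\<And>x. \<lbrakk>x < n; x \<noteq> u; mdst F u x < Big\<rbrakk> \<Longrightarrow>
      {par x, x} \<in> F \<and> mdst F u (par x) + l {par x, x} = mdst F u x"
begin

section \<open>The shortest path tree of the current edge set\<close>

abbreviation "dF \<equiv> mdst F u"

lemma un: "u < n" and vn: "v < n" and u_neq_v: "u \<noteq> v"
  using alive_edge[OF uv] by auto

lemma FE: "F \<subseteq> E" using F_sub alive_sub by blast

text \<open>Tree paths, listed from the root. Every step certifies the edge and the exact distance,
  since \<open>par\<close> alone guarantees nothing at vertices whose masked distance is
  \<open>Big\<close> or more.\<close>

inductive tree_path :: "nat list \<Rightarrow> bool" where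
  tree_root: "tree_path [u]"
| tree_step: "\<lbrakk>tree_path p; y \<noteq> u; par y = last p; {last p, y} \<in> F;
    dF (last p) + l {last p, y} = dF y\<rbrakk> \<Longrightarrow> tree_path (p @ [y])"

text \<open>Lengths are positive, so \<open>dF\<close> strictly increases along the path. This gives
  distinctness and shows that the last vertex is the farthest.\<close>

lemma tree_path_props:
  "tree_path p \<Longrightarrow> p \<noteq> [] \<and> hd p = u \<and> set (path_edges p) \<subseteq> F \<and> path_length l p = dF (last p) \<and>
     (\<forall>a\<in>set p. dF a \<le> dF (last p)) \<and> distinct p"
proof (induction rule: tree_path.induct)
  case (tree_step p y)
  have "l {last p, y} \<ge> 1" using tree_step(4) FE len_pos by blast
  then have "dF (last p) < dF y" using tree_step(5) by linarith
  then have "\<forall>a\<in>set p. dF a < dF y" using tree_step.IH by fastforce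
  then show ?case using tree_step
    by (auto simp: path_edges_append path_length_append less_imp_le)
qed simp

lemma tree_path_verts: "tree_path p \<Longrightarrow> set p \<subseteq> {..<n}"
proof (rule simple_path_in_verts[OF graph, of u "last p"])
  assume "tree_path p"
  from tree_path_props[OF this] FE show "simple_path E u (last p) p"
    by (auto simp: simple_path_def)
qed (use un in simp)

text \<open>Going from \<open>x\<close> to \<open>par x\<close> lowers the distance, so the bound
  \<open>Big\<close> persists and the induction on \<open>dF x\<close> applies.\<close>

lemma tree_path_exists:
  "x < n \<Longrightarrow> dF x < Big \<Longrightarrow> \<exists>p. tree_path p \<and> last p = x"
proof (induction "dF x" arbitrary: x rule: less_induct)
  case less
  show ?case
  proof (cases "x = u")
    case True
    then show ?thesis using tree_root by force
  next
    case False
    from par[OF less.prems(1) False less.prems(2)]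
    have p: "{par x, x} \<in> F" "dF (par x) + l {par x, x} = dF x" by auto
    have "l {par x, x} \<ge> 1" "par x < n" using p(1) FE len_pos edgeD by blast+
    then obtain q where "tree_path q" "last q = par x"
      using less.hyps[of "par x"] p(2) less.prems(2) by auto
    then have "tree_path (q @ [x])" using tree_step[of q x] False p by simp
    then show ?thesis by force
  qed
qed

text \<open>The root is a fixed point. Hence \<open>n\<close> iterations collect precisely the tree
  path, whatever its length, and the program can use a plain counting loop.\<close>

definition up :: "nat \<Rightarrow> nat" where "up y = (if y = u then u else par y)"

definition anc :: "nat \<Rightarrow> nat set" where "anc x = (\<lambda>r. (up ^^ r) x) ` {..<n}"

lemma up_orbit: "tree_path p \<Longrightarrow> length p \<le> N \<Longrightarrow> (\<lambda>r. (up ^^ r) (last p)) ` {..<N} = set p"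
proof (induction arbitrary: N rule: tree_path.induct)
  case tree_root
  have "(up ^^ r) u = u" for r by (induction r) (auto simp: up_def)
  then show ?case using tree_root by (cases N) (auto simp: image_iff)
next
  case (tree_step p y)
  then obtain M where N: "N = Suc M" by (cases N) auto
  have "(\<lambda>r. (up ^^ r) y) ` {..<N} = insert y ((\<lambda>r. (up ^^ r) (up y)) ` {..<M})"
    unfolding N lessThan_Suc_eq_insert_0 by (simp add: image_image funpow_swap1 del: funpow.simps)
      (simp add: funpow_swap1)
  also have "up y = last p" using tree_step by (simp add: up_def)
  also have "(\<lambda>r. (up ^^ r) (last p)) ` {..<M} = set p"
    by (rule tree_step.IH) (use tree_step.prems N in simp)
  finally show ?case by simp
qed

lemma anc_eq: "tree_path p \<Longrightarrow> anc (last p) = set p"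
proof -
  assume p: "tree_path p"
  have "length p = card (set p)" using tree_path_props[OF p] distinct_card by metis
  also have "\<dots> \<le> n" using tree_path_verts[OF p] card_mono[of "{..<n}" "set p"] by simp
  finally show ?thesis unfolding anc_def by (rule up_orbit[OF p])
qed

section \<open>Edges that complete a tree path\<close>

definition off :: "nat \<Rightarrow> nat set set" where "off x = {e \<in> alive. e \<inter> anc x = {}}"

definition completes :: "nat \<Rightarrow> nat \<Rightarrow> bool" where
  "completes x y \<longleftrightarrow> (dF x + l {x, y} + mdst (off x) y v) * den \<le> num * dG u v"

text \<open>The property kept for all vertices in the queue: the whole tree path, not only its end,
  stays in the neighborhood.\<close>

definition reach :: "nat \<Rightarrow> bool" where
  "reach x \<longleftrightarrow> (\<exists>p. tree_path p \<and> last p = x \<and> set p \<subseteq> nbhd u v)"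

lemma off_sub: "off x \<subseteq> alive" by (auto simp: off_def)

lemma reach_root: "reach u"
proof -
  have "set [u, v] \<subseteq> nbhd u v"
    by (rule nbhd_path[OF uv])
      (use uv u_neq_v alive_iff in \<open>auto simp: simple_path_edge path_length_def\<close>)
  then show ?thesis unfolding reach_def using tree_root by (intro exI[of _ "[u]"]) auto
qed

lemma reach_lt: "reach x \<Longrightarrow> x < n"
  unfolding reach_def using tree_path_verts tree_path_props last_in_set by blast

text \<open>The test certifies lengths only; what has to be shown is that the tree path and the
  completing path are disjoint, so that their concatenation is a simple settling path.\<close>

lemma completes_path:
  assumes p: "tree_path p" "last p = x" and xy: "{x, y} \<in> alive" and c: "completes x y"
  obtains q where "simple_path alive u v (p @ q)" "q \<noteq> []" "hd q = y"
    "path_length l (p @ q) * den \<le> num * dG u v"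
proof -
  have yn: "y < n" using alive_edge[OF xy] by simp
  have dle: "mdst (off x) y v < Big" "dF x < Big"
    using settle_lt_Big[OF c[unfolded completes_def] un vn] by linarith+
  have offE: "off x \<subseteq> E" using off_sub alive_sub by blast
  obtain q where q: "simple_path (off x) y v q" "path_length l q \<le> mdst (off x) y v"
    using mdst_le_iff[OF yn vn offE dle(1)] by blast
  have q': "q \<noteq> []" "hd q = y" "last q = v" "distinct q" "set (path_edges q) \<subseteq> off x"
    using q(1) by (auto simp: simple_path_def)
  note P = tree_path_props[OF p(1)]
  have ancp: "anc x = set p" using anc_eq[OF p(1)] p(2) by simp
  \<comment> \<open>If \<open>v\<close> were on the tree path, \<open>dF v <= dF x\<close> would
    make the path of \<open>F\<close> to \<open>v\<close> short enough to settle the pair.\<close>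
  have vp: "v \<notin> set p"
  proof
    assume "v \<in> set p"
    then have "dF v \<le> dF x" using P p(2) by auto
    then have "dF v * den \<le> (dF x + l {x, y} + mdst (off x) y v) * den" by simp
    then have "settled F u v"
      using c settled_iff_mdst[OF un vn FE] unfolding completes_def by linarith
    then show False using unset by simp
  qed
  \<comment> \<open>If \<open>q\<close> has an edge, each of its vertices lies on an edge of
    \<open>off x\<close> and thus avoids the tree path. If \<open>q\<close> is the single vertex
    \<open>v\<close>, the mask says nothing and \<open>vp\<close> takes over.\<close>
  have disj: "set p \<inter> set q = {}"
  proof (cases "length q \<ge> 2")
    case True
    {
      fix z assume z: "z \<in> set q"
      obtain e where "e \<in> set (path_edges q)" "z \<in> e" using ex_edge_of_vertex[OF z True] by blast
      then have "z \<notin> set p" using q'(5) ancp by (auto simp: off_def)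
    }
    then show ?thesis by blast
  next
    case False
    then have "q = [v]" using q'(1,3) by (cases q; cases "tl q") auto
    then show ?thesis using vp by simp
  qed
  have e: "path_edges (p @ q) = path_edges p @ {x, y} # path_edges q"
    using path_edges_append[of p q] P q' p(2) by simp
  have "set (path_edges q) \<subseteq> alive" "set (path_edges p) \<subseteq> alive"
    using q'(5) off_sub[of x] P F_sub by blast+
  then have "simple_path alive u v (p @ q)"
    unfolding simple_path_def e using P q' disj xy by simp
  moreover have "path_length l (p @ q) \<le> dF x + l {x, y} + mdst (off x) y v"
    using path_length_append[of p q l] P q' p(2) q(2) by simp
  then have "path_length l (p @ q) * den \<le> (dF x + l {x, y} + mdst (off x) y v) * den" by simp
  then have "path_length l (p @ q) * den \<le> num * dG u v" using c unfolding completes_def by linarith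
  ultimately show thesis using that q' by blast
qed

text \<open>The path from \<open>completes_path\<close> is settling, so all its vertices lie in the
  neighborhood. For the last claim, passing the test puts \<open>dF y\<close> below
  \<open>Big\<close>, so the assumption on \<open>par\<close> applies to \<open>y\<close> and makes
  the edge a tree edge.\<close>

lemma completes_nbhd:
  assumes "reach x" "{x, y} \<in> alive" "completes x y"
  shows "x \<in> nbhd u v" "y \<in> nbhd u v" "y \<noteq> u" "y < n"
    and "par y = x \<Longrightarrow> {x, y} \<in> F \<Longrightarrow> reach y"
proof -
  obtain p where p: "tree_path p" "last p = x" "set p \<subseteq> nbhd u v"
    using assms(1) unfolding reach_def by blast
  note P = tree_path_props[OF p(1)]
  obtain q where q: "simple_path alive u v (p @ q)" "q \<noteq> []" "hd q = y"
    "path_length l (p @ q) * den \<le> num * dG u v"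
    using completes_path[OF p(1,2) assms(2,3)] by blast
  have sub: "set (p @ q) \<subseteq> nbhd u v" by (rule nbhd_path[OF uv q(1,4)])
  have yq: "y \<in> set q" using q(2,3) hd_in_set by blast
  show "x \<in> nbhd u v" using p P last_in_set by blast
  show ynb: "y \<in> nbhd u v" using sub yq by auto
  show yu: "y \<noteq> u" using q(1) yq P hd_in_set[of p] by (auto simp: simple_path_def)
  show yn: "y < n" using alive_edge[OF assms(2)] by simp
  assume py: "par y = x" "{x, y} \<in> F"
  have "dF y \<le> dF x + l {x, y}"
  proof -
    have "dF y \<le> path_length (mask_len F Big l) (p @ [y])"
      by (rule dst_le_walk) (use P p(2) py(2) FE in \<open>auto simp: path_edges_append\<close>)
    also have "\<dots> = path_length l (p @ [y])"
      by (rule path_length_mask) (use P p(2) py(2) in \<open>auto simp: path_edges_append\<close>)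
    finally show ?thesis using P p(2) by (simp add: path_length_append)
  qed
  also have "\<dots> < Big"
    using settle_lt_Big[OF assms(3)[unfolded completes_def] un vn] by linarith
  finally have "dF y < Big" .
  from par[OF yn yu this] py have "dF x + l {x, y} = dF y" by simp
  then have "tree_path (p @ [y])" using tree_step[OF p(1) yu] py p(2) by simp
  then show "reach y" unfolding reach_def using p(3) ynb by (intro exI[of _ "p @ [y]"]) auto
qed

text \<open>By distinctness the rest of the path avoids the tree path, so it competes in the minimum
  that the test evaluates. Along a settling path, no tree edge is therefore rejected by the
  exploration.\<close>

lemma completes_prefix:
  assumes p: "tree_path p" and d: "distinct (p @ z # r)" "last (z # r) = v"
    "set (path_edges (p @ z # r)) \<subseteq> alive" "path_length l (p @ z # r) * den \<le> num * dG u v"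
  shows "completes (last p) z"
proof -
  note P = tree_path_props[OF p]
  have e: "path_edges (p @ z # r) = path_edges p @ {last p, z} # path_edges (z # r)"
    using path_edges_append[of p "z # r"] P by simp
  have sub: "set (path_edges (z # r)) \<subseteq> off (last p)"
  proof
    fix f assume f: "f \<in> set (path_edges (z # r))"
    have "f \<subseteq> set (z # r)" by (rule path_edges_subset[OF f])
    then have "f \<inter> anc (last p) = {}" using anc_eq[OF p] d(1) by auto
    moreover have "f \<in> alive" using f d(3) e by auto
    ultimately show "f \<in> off (last p)" by (simp add: off_def)
  qed
  have "mdst (off (last p)) z v \<le> path_length (mask_len (off (last p)) Big l) (z # r)"
    by (rule dst_le_walk) (use d(2) sub off_sub alive_sub in auto)
  also have "\<dots> = path_length l (z # r)" by (rule path_length_mask[OF sub])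
  finally have "dF (last p) + l {last p, z} + mdst (off (last p)) z v \<le> path_length l (p @ z # r)"
    using path_length_append[of p "z # r" l] P by simp
  then have "(dF (last p) + l {last p, z} + mdst (off (last p)) z v) * den
      \<le> path_length l (p @ z # r) * den" by simp
  with d(4) show ?thesis unfolding completes_def by linarith
qed

lemma first_missing_edge:
  assumes "p \<noteq> []" "\<not> set (path_edges p) \<subseteq> F"
  shows "\<exists>p1 y p2. p = p1 @ y # p2 \<and> p1 \<noteq> [] \<and> set (path_edges p1) \<subseteq> F \<and> {last p1, y} \<notin> F"
  using assms
proof (induction p)
  case (Cons x p)
  then have ne: "p \<noteq> []" by auto
  show ?case
  proof (cases "{x, hd p} \<in> F")
    case False
    then show ?thesis using ne by (intro exI[of _ "[x]"]) (auto intro!: exI[of _ "hd p"] exI[of _ "tl p"])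
  next
    case True
    then obtain p1 y p2 where "p = p1 @ y # p2" "p1 \<noteq> []" "set (path_edges p1) \<subseteq> F" "{last p1, y} \<notin> F"
      using Cons ne by (auto simp: path_edges_Cons)
    then show ?thesis using True
      by (intro exI[of _ "x # p1"]) (auto simp: path_edges_Cons)
  qed
qed simp

text \<open>A shortest \<open>u\<close>-\<open>v\<close>-path of \<open>H\<close> runs in \<open>F\<close> up to its first edge outside \<open>F\<close>. Replacing this
  initial part by the path of the shortest path tree of \<open>F\<close> gives another shortest walk, hence
  a simple path.\<close>

lemma branching_edge:
  assumes H: "F \<subseteq> H" "H \<subseteq> alive" "settled H u v"
    and Q0: "u \<in> Q" and Q1: "\<And>x y. \<lbrakk>x \<in> Q; {x, y} \<in> F; par y = x; completes x y\<rbrakk> \<Longrightarrow> y \<in> Q"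
  shows "\<exists>x\<in>Q. \<exists>y. {x, y} \<in> H \<and> {x, y} \<notin> F \<and> completes x y"
proof -
  obtain P0 where P0: "simple_path H u v P0" "path_length l P0 * den \<le> num * dG u v"
    using H(3) unfolding settled_def by blast
  obtain P where P: "simple_path H u v P" "path_length l P = dst H l u v"
    using dst_attained[OF P0(1)] by blast
  have "path_length l P \<le> path_length l P0" using dst_le[OF P0(1), of l] P(2) by simp
  then have "path_length l P * den \<le> path_length l P0 * den" by simp
  then have Ps: "path_length l P * den \<le> num * dG u v" using P0(2) by linarith
  have P': "P \<noteq> []" "hd P = u" "last P = v" "distinct P" "set (path_edges P) \<subseteq> H"
    using P(1) by (auto simp: simple_path_def)
  have "\<not> set (path_edges P) \<subseteq> F"
    using unset Ps P' unfolding settled_def simple_path_def by blast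
  from first_missing_edge[OF P'(1) this] obtain p1 y p2 where s: "P = p1 @ y # p2" "p1 \<noteq> []"
    "set (path_edges p1) \<subseteq> F" "{last p1, y} \<notin> F" by blast
  let ?x = "last p1"
  have eP: "path_edges P = path_edges p1 @ {?x, y} # path_edges (y # p2)"
    using path_edges_append[of p1 "y # p2"] s by simp
  have lP: "path_length l P = path_length l p1 + l {?x, y} + path_length l (y # p2)"
    using path_length_append[of p1 "y # p2" l] s by simp
  have hp1: "hd p1 = u" using P'(2) s by simp
  have dx: "dF ?x \<le> path_length l p1"
  proof -
    have "dF ?x \<le> path_length (mask_len F Big l) p1"
      by (rule dst_le_walk) (use s hp1 FE in auto)
    then show ?thesis using path_length_mask[OF s(3)] by simp
  qed
  have "dF ?x < Big" using dx lP settle_lt_Big[OF Ps un vn] by linarith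
  moreover have xy: "{?x, y} \<in> H" using P'(5) eP by auto
  then have "?x < n" using alive_edge H(2) by blast
  ultimately obtain p where p: "tree_path p" "last p = ?x" using tree_path_exists by blast
  note T = tree_path_props[OF p(1)]
  let ?W = "p @ y # p2"
  have eW: "path_edges ?W = path_edges p @ {?x, y} # path_edges (y # p2)"
    using path_edges_append[of p "y # p2"] T p by simp
  have eWH: "set (path_edges ?W) \<subseteq> H" unfolding eW using T H(1) P'(5) eP by auto
  have lW: "path_length l ?W \<le> path_length l P"
    using path_length_append[of p "y # p2" l] T p dx lP by simp
  have lastW: "last ?W = v" using P'(3) s by (simp split: if_splits)
  have "simple_path H u v ?W"
  proof (rule shortest_walk_simple[of _ _ _ _ l])
    show "path_length l ?W \<le> path_length l q" if "simple_path H u v q" for q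
      using dst_le[OF that, of l] lW P(2) by simp
  qed (use T eWH lastW H(2) alive_sub len_pos in auto)
  then have dW: "distinct ?W" by (simp add: simple_path_def)
  have "path_length l ?W * den \<le> path_length l P * den" using lW by simp
  then have Ws: "path_length l ?W * den \<le> num * dG u v" using Ps by linarith
  have eWa: "set (path_edges ?W) \<subseteq> alive" using eWH H(2) by blast
  have lastY: "last (y # p2) = v" using lastW by simp
  have c: "completes ?x y"
    using completes_prefix[OF p(1) dW lastY eWa Ws] p(2) by simp
  \<comment> \<open>\<open>Q\<close> stands for the vertices of the final queue. Every prefix of
    \<open>p\<close> extends to the settling path \<open>?W\<close>, so each tree edge on the way
    passes the test and the closure property of \<open>Q\<close> carries over to the next
    vertex.\<close>
  have "last p0 \<in> Q" if "tree_path p0" "p = p0 @ r" for p0 r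
    using that
  proof (induction arbitrary: r rule: tree_path.induct)
    case tree_root
    then show ?case using Q0 by simp
  next
    case (tree_step p0 z)
    have "last p0 \<in> Q" by (rule tree_step.IH[of "z # r"]) (use tree_step in simp)
    moreover have "completes (last p0) z"
      using completes_prefix[OF tree_step(1), of z "r @ y # p2"] dW lastW eWa Ws tree_step.prems
      by simp
    ultimately show ?case using Q1[of "last p0" z] tree_step by simp
  qed
  from this[OF p(1), of "[]"] have "?x \<in> Q" using p(2) by simp
  then show ?thesis using xy s(4) c by blast
qed

end

section \<open>The preprocessing program\<close>

lemma word_store_upd [simp]: "word_store B s \<Longrightarrow> (\<And>i. f i \<le> B) \<Longrightarrow> word_store B (s(a := f))"
  by (simp add: word_store_def)

text \<open>Private arrays: 5 to 10 the scalars \<open>n\<close>, \<open>m\<close>, numerator and denominator of the stretch,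
  \<open>W\<close>, \<open>\<mu>\<close>; 11 the length of forbidden edges; 12 and 13 the end points, 14 the lengths and 15 the
  weights of the edges; 16 the distances of their end points; 17 and 18 mark the edges that settle
  themselves and the trivial ones; 19 is an edge mask, 20 a distance vector from vertex 25.\<close>

definition set_graph :: com where
  "set_graph = (0[Num 0] ::= Sc 5 ;; 0[Num 1] ::= Sc 6 ;;
     For 23 6 (1[Sc 23] ::= Cell 12 (Sc 23) ;; 2[Sc 23] ::= Cell 13 (Sc 23) ;;
       If (Cell 19 (Sc 23)) (3[Sc 23] ::= Cell 14 (Sc 23)) (3[Sc 23] ::= Sc 11)))"

definition relax :: "nat \<Rightarrow> nat \<Rightarrow> com" where
  "relax a b = If (Cell 20 (Cell a (Sc 23)) \<oplus> Cell 3 (Sc 23) \<prec> Cell 20 (Cell b (Sc 23)))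
     (20[Cell b (Sc 23)] ::= Cell 20 (Cell a (Sc 23)) \<oplus> Cell 3 (Sc 23)) Skip"

text \<open>\<open>m * Big\<close> serves as infinity. By \<open>mdst_le\<close> it is an upper
  bound on every masked distance, so it fits into a word and requires no special treatment.\<close>

definition bellman_ford :: com where
  "bellman_ford = (21 ::= Sc 6 \<otimes> Sc 11 ;; For 23 5 (20[Sc 23] ::= Sc 21) ;; 20[Sc 25] ::= Num 0 ;;
     For 24 5 (For 23 6 (relax 12 13 ;; relax 13 12)))"

lemma writes_set_graph [simp]: "writes set_graph = {0, 1, 2, 3, 23}"
  by (auto simp: set_graph_def)

lemma writes_relax [simp]: "writes (relax a b) = {20}"
  by (auto simp: relax_def)

lemma writes_bellman_ford [simp]: "writes bellman_ford = {20, 21, 23, 24}"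
  by (auto simp: bellman_ford_def)

text \<open>\<open>bound\<close> gathers all demands on the word size:
  \<open>4 * ((m + 1) * Big)\<close> covers every sum of lengths and distances that is formed, its
  factor the multiplication by \<open>den\<close>, \<open>n * n\<close> the indices of the distance
  matrix and \<open>m * m\<close> those of the table of marks per level.\<close>

locale prog = inst +
  fixes p1 p2 :: "nat \<Rightarrow> nat" and B :: nat
  assumes bij: "bij_betw (\<lambda>i. {p1 i, p2 i}) {..<card E} E"
    and bound: "(den + num + 1) * (4 * ((card E + 1) * Big)) + n * n + card E * card E + n + card E +
      budget I + mu I + sum (weight I) E + 5 \<le> B"
begin

section \<open>Word bounds and the graph handed to the distance algorithms\<close>

abbreviation "m \<equiv> card E"
abbreviation "e i \<equiv> {p1 i, p2 i}"

lemma eE: "i < m \<Longrightarrow> e i \<in> E"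
  using bij by (auto simp: bij_betw_def)

lemma e_inj: "i < m \<Longrightarrow> j < m \<Longrightarrow> e i = e j \<longleftrightarrow> i = j"
  using bij by (auto simp: bij_betw_def inj_on_def)

lemma e_surj: "f \<in> E \<Longrightarrow> \<exists>i<m. f = e i"
  using bij by (auto simp: bij_betw_def)

lemma endp: "i < m \<Longrightarrow> p1 i < n \<and> p2 i < n \<and> p1 i \<noteq> p2 i"
  using eE edgeD by blast

lemma Big_pos: "1 \<le> Big" by (simp add: Big_def)

lemma num_S_Big: "num * S < Big" by (simp add: Big_def)

lemma num_dG_Big: "u < n \<Longrightarrow> v < n \<Longrightarrow> num * dG u v < Big"
  using dG_le_S[of u v] num_S_Big mult_le_mono2[of "dG u v" S num] by linarith

lemma len_le_Big: "f \<in> E \<Longrightarrow> l f \<le> Big"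
proof -
  assume "f \<in> E"
  then have "l f \<le> S" using finE by (intro member_le_sum) auto
  also have "S \<le> num * S" using stretch_quot by simp
  finally show ?thesis using num_S_Big by simp
qed

lemma mask_len_bounds: "f \<in> E \<Longrightarrow> 1 \<le> mask_len X Big l f \<and> mask_len X Big l f \<le> Big"
  using len_le_Big len_pos Big_pos by (auto simp: mask_len_def)

lemma den_bound: "x \<le> 4 * ((m + 1) * Big) \<Longrightarrow> x * den \<le> B"
proof -
  assume "x \<le> 4 * ((m + 1) * Big)"
  then have "x * den \<le> (4 * ((m + 1) * Big)) * (den + num + 1)" by (intro mult_le_mono) auto
  then show ?thesis using bound by (simp only: mult.commute)
qed

lemma dist_bound: "x \<le> 4 * ((m + 1) * Big) \<Longrightarrow> x \<le> B"
proof -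
  assume a: "x \<le> 4 * ((m + 1) * Big)"
  have "x * 1 \<le> x * den" using stretch_quot(1) by (intro mult_le_mono2)
  then show ?thesis using den_bound[OF a] by linarith
qed

lemma Big_le: "Big \<le> B" by (rule dist_bound) simp

lemma num_bound: "u < n \<Longrightarrow> v < n \<Longrightarrow> num * dG u v \<le> B"
  using num_dG_Big[of u v] Big_le by linarith

lemma small_bounds: "n * n \<le> B" "m * m + m \<le> B" "n \<le> B" "m \<le> B" "5 \<le> B" "sum (weight I) E \<le> B"
    "mu I \<le> B" "num \<le> B" "den \<le> B"
proof -
  have "num \<le> (den + num + 1) * (4 * ((m + 1) * Big))" "den \<le> (den + num + 1) * (4 * ((m + 1) * Big))"
    using mult_le_mono2[of 1 "4 * ((m + 1) * Big)" "den + num + 1"] Big_pos by auto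
  then show "num \<le> B" "den \<le> B" using bound by linarith+
qed (use bound in linarith)+

lemma in_bounds:
  assumes "i < m"
  shows "p1 i \<le> B" "p2 i \<le> B" "l (e i) \<le> B" "weight I (e i) \<le> B"
proof -
  show "p1 i \<le> B" "p2 i \<le> B" using endp[OF assms] small_bounds by linarith+
  show "l (e i) \<le> B" using len_le_Big[OF eE[OF assms]] Big_le by linarith
  have "weight I (e i) \<le> sum (weight I) E"
    using finE eE[OF assms] by (intro member_le_sum) auto
  then show "weight I (e i) \<le> B" using small_bounds(6) by linarith
qed

lemma mdst_le: "x < n \<Longrightarrow> y < n \<Longrightarrow> mdst X x y \<le> m * Big"
proof -
  assume "x < n" "y < n"
  then obtain p where p: "simple_path E x y p" using pathE by blast
  have "mdst X x y \<le> path_length (mask_len X Big l) p" by (rule dst_le[OF p])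
  also have "\<dots> \<le> sum (mask_len X Big l) E" by (rule path_length_le_sum[OF finE p])
  also have "\<dots> \<le> m * Big" using sum_bounded_above[of E "mask_len X Big l" Big] mask_len_bounds by simp
  finally show ?thesis .
qed

lemma mdst_E: "mdst E = dG"
proof -
  have *: "path_length (mask_len E Big l) p = path_length l p" if "simple_path E x y p" for p x y
    using that by (intro path_length_mask) (auto simp: simple_path_def)
  have "(\<exists>p. simple_path E x y p \<and> path_length (mask_len E Big l) p = k) \<longleftrightarrow>
      (\<exists>p. simple_path E x y p \<and> path_length l p = k)" for x y k
    using * by metis
  then show ?thesis unfolding dst_def by (intro ext) simp
qed

definition inputs :: "store \<Rightarrow> bool" where
  "inputs s \<longleftrightarrow> s 5 0 = n \<and> s 6 0 = m \<and> s 7 0 = num \<and> s 8 0 = den \<and> s 9 0 = budget I \<and>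
     s 10 0 = mu I \<and> s 11 0 = Big \<and>
     (\<forall>i<m. s 12 i = p1 i \<and> s 13 i = p2 i \<and> s 14 i = l (e i) \<and> s 15 i = weight I (e i))"

lemma inputs_cong: "inputs s \<Longrightarrow> (\<And>a. 5 \<le> a \<Longrightarrow> a \<le> 15 \<Longrightarrow> s' a = s a) \<Longrightarrow> inputs s'"
  unfolding inputs_def by simp

lemma inputsD:
  assumes "inputs s"
  shows "s 5 0 = n" "s 6 0 = m" "s 7 0 = num" "s 8 0 = den" "s 9 0 = budget I"
     "s 10 0 = mu I" "s 11 0 = Big"
     "i < m \<Longrightarrow> s 12 i = p1 i" "i < m \<Longrightarrow> s 13 i = p2 i" "i < m \<Longrightarrow> s 14 i = l (e i)"
     "i < m \<Longrightarrow> s 15 i = weight I (e i)"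
  using assms by (auto simp: inputs_def)

lemma inputs_upd [simp]: "15 < a \<or> a < 5 \<Longrightarrow> inputs (s(a := f)) = inputs s"
  by (auto simp: inputs_def)

definition loaded :: "nat set set \<Rightarrow> store \<Rightarrow> bool" where
  "loaded X s \<longleftrightarrow> s 0 0 = n \<and> s 0 1 = m \<and>
     (\<forall>i<m. s 1 i = p1 i \<and> s 2 i = p2 i \<and> s 3 i = mask_len X Big l (e i))"

lemma loaded_cong: "loaded X s \<Longrightarrow> (\<And>a. a \<le> 3 \<Longrightarrow> s' a = s a) \<Longrightarrow> loaded X s'"
  unfolding loaded_def by simp

lemma loaded_upd [simp]: "3 < a \<Longrightarrow> loaded X (s(a := f)) = loaded X s"
  by (auto simp: loaded_def)

lemma loaded_encodes: "loaded X s \<Longrightarrow> encodes_graph n E (mask_len X Big l) s"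
proof -
  assume a: "loaded X s"
  have "bij_betw (\<lambda>i. {s 1 i, s 2 i}) {..<m} E \<longleftrightarrow> bij_betw (\<lambda>i. e i) {..<m} E"
    by (rule bij_betw_cong) (use a in \<open>simp add: loaded_def\<close>)
  then show ?thesis using a bij by (simp add: encodes_graph_def loaded_def)
qed

definition flags :: "nat \<Rightarrow> nat set set \<Rightarrow> store \<Rightarrow> bool" where
  "flags a X s \<longleftrightarrow> (\<forall>i<m. s a i = of_bool (e i \<in> X))"

lemma flags_upd [simp]: "a \<noteq> b \<Longrightarrow> flags a X (s(b := f)) = flags a X s"
  by (simp add: flags_def)

lemma set_graph_wp:
  assumes "word_store B s" "inputs s" "flags 19 X s"
  shows "wp B set_graph (\<lambda>t s'. t \<le> m * 6 + 10 \<and> loaded X s') s"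
proof -
  let ?s1 = "s(0 := (s 0)(0 := n, 1 := m))"
  let ?c = "1[Sc 23] ::= Cell 12 (Sc 23) ;; 2[Sc 23] ::= Cell 13 (Sc 23) ;;
       If (Cell 19 (Sc 23)) (3[Sc 23] ::= Cell 14 (Sc 23)) (3[Sc 23] ::= Sc 11)"
  let ?I = "\<lambda>k s'. s' 0 0 = n \<and> s' 0 1 = m \<and>
     (\<forall>i<k. s' 1 i = p1 i \<and> s' 2 i = p2 i \<and> s' 3 i = mask_len X Big l (e i))"
  have ws: "word_store B ?s1" using assms(1) small_bounds by auto
  have "wp B (For 23 6 ?c) (\<lambda>t s'. t \<le> m * (4 + 2) + 2 \<and> ?I m s') ?s1"
  proof (rule wp_For[where I = ?I, OF ws])
    fix k s'
    assume a: "k < m" "s' 23 0 = k" "word_store B s'"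
      "\<And>a. a \<notin> insert 23 (writes ?c) \<Longrightarrow> s' a = ?s1 a" "?I k s'"
    have i: "inputs s'" by (rule inputs_cong[OF assms(2)]) (subst a(4); simp)
    have f: "s' 19 k = of_bool (e k \<in> X)" using a(4)[of 19] assms(3) a(1) by (simp add: flags_def)
    show "wp B ?c (\<lambda>t s'. t \<le> 4 \<and> ?I (Suc k) s') s'"
      using a(1,2,3,5) inputsD[OF i] f Big_le small_bounds in_bounds[OF a(1)]
      by (auto simp: mask_len_def less_Suc_eq)
  qed (use assms in \<open>auto simp: inputs_def\<close>)
  then have "wp B (For 23 6 ?c) (\<lambda>t s'. Suc (Suc t) \<le> m * 6 + 10 \<and> loaded X s') ?s1"
    by (rule wp_conseq[OF _ ws]) (auto simp: loaded_def)
  then show ?thesis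
    unfolding set_graph_def using assms small_bounds by (auto simp: inputsD)
qed

lemma relax_wp:
  assumes "word_store B s" "s 23 0 = i" "s a i = x" "s b i = y" "s 3 i = c" "s 20 x + c \<le> B" "1 \<le> B"
  shows "wp B (relax a b)
    (\<lambda>t s'. t \<le> 2 \<and> s' = s(20 := (s 20)(y := min (s 20 y) (s 20 x + c)))) s"
  unfolding relax_def using assms by (auto simp: min_def not_less)

text \<open>Two invariants enclose the distance vector: \<open>low\<close> keeps it at or above the
  true distances (and at most \<open>m * Big\<close>), and after \<open>k\<close> rounds
  \<open>up k\<close> keeps it at or below the length of every walk with at most \<open>k\<close>
  edges.\<close>

lemma bellman_ford_wp:
  assumes "word_store B s" "inputs s" "loaded X s" "s 25 0 = r" "r < n"
  shows "wp B bellman_ford (\<lambda>t s'. t \<le> n * (m * 6 + 10) + 10 \<and> (\<forall>x<n. s' 20 x = mdst X r x)) s"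
proof -
  let ?L = "mask_len X Big l"
  define low where "low D \<longleftrightarrow> (\<forall>x<n. mdst X r x \<le> D x \<and> D x \<le> m * Big)" for D :: "nat \<Rightarrow> nat"
  \<comment> \<open>\<open>length p <= Suc k\<close> counts vertices, so \<open>wk k\<close>
    describes walks with at most \<open>k\<close> edges. \<open>upe k i\<close> below records that
    edge \<open>i\<close> has been relaxed in the current round, in both directions.\<close>
  define wk where "wk k p \<longleftrightarrow> p \<noteq> [] \<and> hd p = r \<and> set (path_edges p) \<subseteq> E \<and> length p \<le> Suc k" for k p
  define up where "up k D \<longleftrightarrow> (\<forall>p. wk k p \<longrightarrow> D (last p) \<le> path_length ?L p)" for k and D :: "nat \<Rightarrow> nat"
  define upe where "upe k i D \<longleftrightarrow> (\<forall>p b. wk k p \<longrightarrow> {last p, b} = e i \<longrightarrow>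
    D b \<le> path_length ?L p + ?L (e i))" for k i and D :: "nat \<Rightarrow> nat"
  have DB: "D \<le> m * Big \<Longrightarrow> D + Big \<le> B" for D by (rule dist_bound) simp
  have mB: "m * Big \<le> B" by (rule dist_bound) simp
  have rB: "r \<le> B" using assms(5) small_bounds(3) by linarith
  have tri: "mdst X r y \<le> mdst X r x + ?L {x, y}" if "{x, y} \<in> E" for x y
  proof -
    have "x < n" using edgeD that by blast
    then obtain p where p: "simple_path E r x p" "path_length ?L p = mdst X r x"
      using pathE assms(5) dst_attained by metis
    have "mdst X r y \<le> path_length ?L (p @ [y])"
      by (rule dst_le_walk) (use p that in \<open>auto simp: simple_path_def path_edges_append\<close>)
    then show ?thesis using p by (auto simp: simple_path_def path_length_append)
  qed
  have low_min: "low (D(y := min (D y) (D x + ?L {x, y})))" if "low D" "{x, y} \<in> E" for D x y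
  proof -
    have "mdst X r y \<le> D x + ?L {x, y}" "D y \<le> m * Big" "mdst X r y \<le> D y"
      using that(1) tri[OF that(2)] edgeD[OF that(2)] unfolding low_def
      by (meson add_le_mono1 le_trans)+
    then show ?thesis using that(1) unfolding low_def by (simp add: min.coboundedI1)
  qed
  let ?rx = "relax 12 13 ;; relax 13 12"
  have inner: "wp B (For 23 6 ?rx) (\<lambda>t s'. t \<le> m * (4 + 2) + 2 \<and> low (s' 20) \<and> up (Suc k) (s' 20)) s1"
    if s1: "word_store B s1" "inputs s1" "loaded X s1" "low (s1 20)" "up k (s1 20)" for s1 k
  proof -
    let ?I = "\<lambda>j s'. low (s' 20) \<and> up k (s' 20) \<and> (\<forall>i<j. upe k i (s' 20))"
    have "wp B (For 23 6 ?rx) (\<lambda>t s'. t \<le> m * (4 + 2) + 2 \<and> ?I m s') s1"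
    proof (rule wp_For[where I = ?I, OF s1(1)])
      fix j s'
      assume a: "j < m" "s' 23 0 = j" "word_store B s'"
        "\<And>a. a \<notin> insert 23 (writes ?rx) \<Longrightarrow> s' a = s1 a" "?I j s'"
      let ?x = "p1 j" and ?y = "p2 j" and ?c = "?L (e j)"
      let ?D = "s' 20"
      let ?D1 = "?D(?y := min (?D ?y) (?D ?x + ?c))"
      let ?D2 = "?D1(?x := min (?D1 ?x) (?D1 ?y + ?c))"
      have i: "inputs s'" by (rule inputs_cong[OF s1(2)]) (subst a(4); simp)
      have ld: "loaded X s'" by (rule loaded_cong[OF s1(3)]) (subst a(4); simp)
      have xy: "?x < n" "?y < n" "?x \<noteq> ?y" using endp[OF a(1)] by auto
      have c: "1 \<le> ?c" "?c \<le> Big" using mask_len_bounds[OF eE[OF a(1)]] by auto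
      have lw: "low ?D" and u: "up k ?D" and ue: "\<forall>i<j. upe k i ?D" using a(5) by auto
      have b1: "?D ?x + ?c \<le> B" using lw xy c DB[of "?D ?x"] by (auto simp: low_def)
      have lw1: "low ?D1"
        by (rule low_min[OF lw eE[OF a(1)]])
      have b2: "?D1 ?y + ?c \<le> B" using lw1 xy c DB[of "?D1 ?y"] by (auto simp: low_def simp del: fun_upd_apply)
      have ec: "{?y, ?x} = e j" by blast
      have lw2: "low ?D2"
        using low_min[OF lw1, of ?y ?x] eE[OF a(1)] unfolding ec by simp
      \<comment> \<open>Relaxation only lowers entries, so upper bounds obtained from earlier edges
        of the round survive.\<close>
      have mono: "?D2 z \<le> ?D z" for z by (auto simp: min_def)
      have u2: "up k ?D2" using u mono le_trans unfolding up_def by blast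
      have ue2: "upe k i ?D2" if "i < Suc j" for i
      proof (cases "i = j")
        case False
        then have "upe k i ?D" using ue that by simp
        then show ?thesis using mono le_trans unfolding upe_def by blast
      next
        case True
        have "?D2 ?y \<le> ?D ?x + ?c" using xy by (simp add: min_def)
        moreover have "?D2 ?x \<le> ?D ?y + ?c" using xy by (simp add: min_def)
        ultimately have D2: "?D2 b \<le> ?D a + ?c" if "{a, b} = e j" for a b
          using that unfolding doubleton_eq_iff by blast
        show ?thesis unfolding upe_def True
        proof (intro allI impI)
          fix p b assume p: "wk k p" "{last p, b} = e j"
          have "?D (last p) \<le> path_length ?L p" using u p(1) unfolding up_def by blast
          with D2[OF p(2)] show "?D2 b \<le> path_length ?L p + ?c" by linarith
        qed
      qed
      have "wp B (relax 12 13) (\<lambda>t s''. t \<le> 2 \<and> s'' = s'(20 := ?D1)) s'"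
        by (rule relax_wp[OF a(3,2)])
          (use inputsD(8,9)[OF i a(1)] ld a(1) b1 small_bounds in \<open>auto simp: loaded_def\<close>)
      then show "wp B ?rx (\<lambda>t s'. t \<le> 4 \<and> ?I (Suc j) s') s'"
        unfolding wp_Seq
      proof (rule wp_conseq[OF _ a(3)])
        fix t :: nat and s'' assume t: "t \<le> 2 \<and> s'' = s'(20 := ?D1)" and ws: "word_store B s''"
        have "wp B (relax 13 12) (\<lambda>t s3. t \<le> 2 \<and>
            s3 = s''(20 := (s'' 20)(?x := min (s'' 20 ?x) (s'' 20 ?y + ?c)))) s''"
          by (rule relax_wp[OF ws, of j])
            (use t a(1,2) inputsD(8,9)[OF i a(1)] ld b2 small_bounds in \<open>auto simp: loaded_def\<close>)
        then show "wp B (relax 13 12) (\<lambda>t'. \<lambda>s'. t + t' \<le> 4 \<and> ?I (Suc j) s') s''"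
        proof (rule wp_conseq[OF _ ws])
          fix t' :: nat and s3
          assume "t' \<le> 2 \<and> s3 = s''(20 := (s'' 20)(?x := min (s'' 20 ?x) (s'' 20 ?y + ?c)))"
          then have "t' \<le> 2" "s3 20 = ?D2" using t by auto
          then show "t + t' \<le> 4 \<and> ?I (Suc j) s3" using lw2 u2 ue2 t by simp
        qed
      qed
    qed (use s1 in \<open>auto simp: inputs_def\<close>)
    then show ?thesis
    proof (rule wp_conseq[OF _ s1(1)])
      fix t :: nat and s' assume t: "t \<le> m * (4 + 2) + 2 \<and> ?I m s'"
      have "s' 20 (last p) \<le> path_length ?L p" if p: "wk (Suc k) p" for p
      proof (cases "wk k p")
        case False
        then have "length p = Suc (Suc k)" using p by (auto simp: wk_def)
        then obtain q b where q: "p = q @ [b]" "length q = Suc k"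
          by (cases p rule: rev_cases) auto
        then have q: "p = q @ [b]" "q \<noteq> []" by auto
        then have eq: "path_edges p = path_edges q @ [{last q, b}]"
          by (simp add: path_edges_append)
        then have "{last q, b} \<in> E" using p by (simp add: wk_def)
        then obtain i where i: "i < m" "{last q, b} = e i" using e_surj by blast
        have "wk k q" using p q eq by (auto simp: wk_def)
        then have "s' 20 b \<le> path_length ?L q + ?L (e i)" using t i unfolding upe_def by blast
        then show ?thesis using q i by (simp add: path_length_append)
      qed (use t in \<open>auto simp: up_def\<close>)
      then show "t \<le> m * (4 + 2) + 2 \<and> low (s' 20) \<and> up (Suc k) (s' 20)"
        using t by (simp add: up_def)
    qed
  qed
  let ?s1 = "s(21 := (s 21)(0 := m * Big))"
  have ws1: "word_store B ?s1" using assms(1) mB by auto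
  have l1: "wp B (For 23 5 (20[Sc 23] ::= Sc 21)) (\<lambda>t s'. t \<le> n * (1 + 2) + 2 \<and> (\<forall>x<n. s' 20 x = m * Big)) ?s1"
  proof (rule wp_For[where I = "\<lambda>k s'. \<forall>x<k. s' 20 x = m * Big", OF ws1])
    fix k s'
    assume a: "k < n" "s' 23 0 = k" "word_store B s'"
        "\<And>a. a \<notin> insert 23 (writes (20[Sc 23] ::= Sc 21)) \<Longrightarrow> s' a = ?s1 a" "\<forall>x<k. s' 20 x = m * Big"
    then show "wp B (20[Sc 23] ::= Sc 21) (\<lambda>t s'. t \<le> 1 \<and> (\<forall>x<Suc k. s' 20 x = m * Big)) s'"
      using a(4)[of 21] mB by (auto simp: less_Suc_eq)
  qed (use assms(2) in \<open>auto simp: inputs_def\<close>)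
  let ?o = "For 24 5 (For 23 6 ?rx)"
  have l2: "wp B ?o (\<lambda>t s'. t \<le> n * (m * 6 + 2 + 2) + 2 \<and> low (s' 20) \<and> up n (s' 20)) s2"
    if s2: "word_store B s2" "inputs s2" "loaded X s2" "\<And>x. x < n \<Longrightarrow> s2 20 x = (if x = r then 0 else m * Big)"
    for s2
  proof (rule wp_For[where I = "\<lambda>k s'. low (s' 20) \<and> up k (s' 20)", OF s2(1)])
    fix k s'
    assume a: "k < n" "s' 24 0 = k" "word_store B s'"
        "\<And>a. a \<notin> insert 24 (writes (For 23 6 ?rx)) \<Longrightarrow> s' a = s2 a" "low (s' 20) \<and> up k (s' 20)"
    have i: "inputs s'" by (rule inputs_cong[OF s2(2)]) (subst a(4); simp)
    have ld: "loaded X s'" by (rule loaded_cong[OF s2(3)]) (subst a(4); simp)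
    show "wp B (For 23 6 ?rx) (\<lambda>t s'. t \<le> m * 6 + 2 \<and> low (s' 20) \<and> up (Suc k) (s' 20)) s'"
      using inner[OF a(3) i ld] a(5) by simp
  next
    have "low (s2 20)" unfolding low_def using s2(4) mdst_le[OF assms(5)] by auto
    moreover have "up 0 (s2 20)" unfolding up_def
    proof (intro allI impI)
      fix p assume "wk 0 p"
      then have "p = [r]" by (cases p) (auto simp: wk_def)
      then show "s2 20 (last p) \<le> path_length ?L p" using s2(4) assms(5) by simp
    qed
    ultimately show "low (s2 20) \<and> up 0 (s2 20)" by simp
  qed (use s2(2) in \<open>auto simp: inputs_def\<close>)
  \<comment> \<open>A simple path has at most \<open>n\<close> vertices, so \<open>n\<close> rounds
    cover a shortest one.\<close>
  have fin: "D x = mdst X r x" if D: "low D" "up n D" and x: "x < n" for D x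
  proof (rule antisym)
    obtain p where p: "simple_path E r x p" "path_length ?L p = mdst X r x"
      using pathE[OF assms(5) x] dst_attained by metis
    have "set p \<subseteq> {..<n}" using simple_path_in_verts[OF graph p(1)] assms(5) by simp
    then have "length p \<le> n"
      using p(1) card_mono[of "{..<n}" "set p"] distinct_card[of p] by (simp add: simple_path_def)
    then have "wk n p" using p(1) by (auto simp: wk_def simple_path_def)
    then show "D x \<le> mdst X r x" using D(2) p by (auto simp: up_def simple_path_def)
  qed (use D(1) x in \<open>simp add: low_def\<close>)
  have rest: "wp B (20[Sc 25] ::= Num 0 ;; ?o)
      (\<lambda>t s'. t \<le> 1 + (n * (m * 6 + 2 + 2) + 2) \<and> (\<forall>x<n. s' 20 x = mdst X r x)) s2"
    if s2: "word_store B s2" "inputs s2" "loaded X s2" "\<forall>x<n. s2 20 x = m * Big" "s2 25 0 = r" for s2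
  proof -
    let ?s3 = "s2(20 := (s2 20)(r := 0))"
    have w: "word_store B ?s3" using s2(1) by auto
    have "wp B ?o (\<lambda>t s'. t \<le> n * (m * 6 + 2 + 2) + 2 \<and> low (s' 20) \<and> up n (s' 20)) ?s3"
      by (rule l2[OF w]) (use s2 in auto)
    then have "wp B ?o (\<lambda>t s'. Suc t \<le> 1 + (n * (m * 6 + 2 + 2) + 2) \<and> (\<forall>x<n. s' 20 x = mdst X r x)) ?s3"
      by (rule wp_conseq[OF _ w]) (use fin in auto)
    then show ?thesis using s2 rB by simp
  qed
  have "wp B (For 23 5 (20[Sc 23] ::= Sc 21) ;; 20[Sc 25] ::= Num 0 ;; ?o)
      (\<lambda>t' s'. 1 + t' \<le> n * (m * 6 + 10) + 10 \<and> (\<forall>x<n. s' 20 x = mdst X r x)) ?s1"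
      unfolding wp_Seq[of B "For 23 5 c" for c]
    proof (rule wp_conseq[OF l1 ws1])
      fix t :: nat and s'
      assume a: "t \<le> n * (1 + 2) + 2 \<and> (\<forall>x<n. s' 20 x = m * Big)" "word_store B s'"
        "\<And>a. a \<notin> writes (For 23 5 (20[Sc 23] ::= Sc 21)) \<Longrightarrow> s' a = ?s1 a"
      have i: "inputs s'" by (rule inputs_cong[OF assms(2)]) (subst a(3); simp)
      have ld: "loaded X s'" by (rule loaded_cong[OF assms(3)]) (subst a(3); simp)
      have "s' 25 0 = r" using a(3)[of 25] assms(4) by simp
      from rest[OF a(2) i ld conjunct2[OF a(1)] this]
      show "wp B (20[Sc 25] ::= Num 0 ;; ?o) (\<lambda>t' s'. 1 + (t + t') \<le> n * (m * 6 + 10) + 10 \<and>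
          (\<forall>x<n. s' 20 x = mdst X r x)) s'"
        by (rule wp_conseq[OF _ a(2)]) (use a(1) in \<open>auto simp: algebra_simps\<close>)
    qed
  then show ?thesis
    unfolding bellman_ford_def wp_Seq[of B "21 ::= Sc 6 \<otimes> Sc 11"]
    using inputsD(1,2,7)[OF assms(2)] mB small_bounds Big_le by (simp del: wp_Seq)
qed

end

definition copy_array :: "nat \<Rightarrow> nat \<Rightarrow> com" where
  "copy_array a b = For 23 6 (a[Sc 23] ::= Cell b (Sc 23))"

definition from_edge :: com where
  "from_edge = (25 ::= Cell 12 (Sc 22) ;; bellman_ford)"

definition find_alive :: com where
  "find_alive = (For 23 6 (19[Sc 23] ::= Num 1) ;; set_graph ;;
     For 22 6 (from_edge ;; 16[Sc 22] ::= Cell 20 (Cell 13 (Sc 22)) ;;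
       17[Sc 22] ::= Num 1 \<ominus> (Sc 7 \<otimes> Cell 16 (Sc 22) \<prec> Cell 14 (Sc 22) \<otimes> Sc 8)))"

text \<open>The mask is rebuilt in each round as all surviving edges except the one under
  examination. An edge whose ends are then too far apart is mandatory; weight 0 makes it trivial
  regardless.\<close>

definition find_trivial :: com where
  "find_trivial = For 22 6 (copy_array 19 17 ;; 19[Sc 22] ::= Num 0 ;; set_graph ;; from_edge ;;
     If (Cell 17 (Sc 22))
       (If (Cell 15 (Sc 22))
         (18[Sc 22] ::= (Sc 7 \<otimes> Cell 16 (Sc 22) \<prec> Cell 20 (Cell 13 (Sc 22)) \<otimes> Sc 8))
         (18[Sc 22] ::= Num 1))
       (18[Sc 22] ::= Num 0))"

definition find_critical :: com where
  "find_critical = (copy_array 19 18 ;; set_graph ;; 26 ::= Num 0 ;;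
     For 22 6 (from_edge ;;
       If (Cell 17 (Sc 22))
         (If (Sc 7 \<otimes> Cell 16 (Sc 22) \<prec> Cell 20 (Cell 13 (Sc 22)) \<otimes> Sc 8) (26 ::= Num 1) Skip) Skip))"

definition check_weight :: com where
  "check_weight = (27 ::= Num 0 ;;
     For 23 6 (If (Cell 29 (Sc 23)) (27 ::= Sc 27 \<oplus> Cell 15 (Sc 23)) Skip) ;;
     28 ::= Num 1 \<ominus> (Sc 9 \<prec> Sc 27))"

lemma writes_copy_array [simp]: "writes (copy_array a b) = {23, a}"
  by (auto simp: copy_array_def)

lemma writes_from_edge [simp]: "writes from_edge = {20, 21, 23, 24, 25}"
  by (auto simp: from_edge_def)

lemma writes_find_alive [simp]:
  "writes find_alive = {0, 1, 2, 3, 16, 17, 19, 20, 21, 22, 23, 24, 25}"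
  by (auto simp: find_alive_def)

lemma writes_find_trivial [simp]:
  "writes find_trivial = {0, 1, 2, 3, 18, 19, 20, 21, 22, 23, 24, 25}"
  by (auto simp: find_trivial_def)

lemma writes_find_critical [simp]:
  "writes find_critical = {0, 1, 2, 3, 19, 20, 21, 22, 23, 24, 25, 26}"
  by (auto simp: find_critical_def)

lemma writes_check_weight [simp]: "writes check_weight = {23, 27, 28}"
  by (auto simp: check_weight_def)

context prog
begin

section \<open>Correctness and time of the preprocessing\<close>

abbreviation "dist_time \<equiv> n * (m * 6 + 10) + 11"

lemma copy_array_wp:
  assumes "word_store B s" "inputs s" "a \<noteq> b" "a \<notin> {6, 23}" "b \<noteq> 23" "flags b X s"
  shows "wp B (copy_array a b) (\<lambda>t s'. t \<le> m * 3 + 2 \<and> flags a X s') s"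
proof -
  let ?I = "\<lambda>k s'. \<forall>i<k. s' a i = of_bool (e i \<in> X)"
  have "wp B (copy_array a b) (\<lambda>t s'. t \<le> m * (1 + 2) + 2 \<and> ?I m s') s"
    unfolding copy_array_def
  proof (rule wp_For[where I = ?I, OF assms(1)])
    fix k s'
    assume a: "k < m" "s' 23 0 = k" "word_store B s'"
      "\<And>c. c \<notin> insert 23 (writes (a[Sc 23] ::= Cell b (Sc 23))) \<Longrightarrow> s' c = s c" "?I k s'"
    have "s' b k = of_bool (e k \<in> X)" using a(4)[of b] a(1) assms by (simp add: flags_def)
    then show "wp B (a[Sc 23] ::= Cell b (Sc 23)) (\<lambda>t s'. t \<le> 1 \<and> ?I (Suc k) s') s'"
      using a(2,3,5) small_bounds by (auto simp: less_Suc_eq)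
  qed (use assms in \<open>auto simp: inputs_def\<close>)
  then show ?thesis unfolding flags_def by (rule wp_conseq[OF _ assms(1)]) auto
qed

lemma from_edge_wp:
  assumes "word_store B s" "inputs s" "loaded X s" "s 22 0 = i" "i < m"
  shows "wp B from_edge (\<lambda>t s'. t \<le> dist_time \<and> s' 20 (p2 i) = mdst X (p1 i) (p2 i)) s"
proof -
  let ?s1 = "s(25 := (s 25)(0 := p1 i))"
  have ws: "word_store B ?s1" using assms(1) in_bounds[OF assms(5)] by auto
  have "wp B bellman_ford (\<lambda>t s'. t \<le> n * (m * 6 + 10) + 10 \<and> (\<forall>x<n. s' 20 x = mdst X (p1 i) x)) ?s1"
    by (rule bellman_ford_wp[OF ws]) (use assms endp[OF assms(5)] in auto)
  then have "wp B bellman_ford (\<lambda>t s'. Suc t \<le> dist_time \<and> s' 20 (p2 i) = mdst X (p1 i) (p2 i)) ?s1"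
    by (rule wp_conseq[OF _ ws]) (use endp[OF assms(5)] in auto)
  then show ?thesis unfolding from_edge_def
    using assms inputsD(8)[OF assms(2,5)] in_bounds[OF assms(5)] small_bounds(4) by simp
qed

definition dists :: "store \<Rightarrow> bool" where
  "dists s \<longleftrightarrow> (\<forall>i<m. s 16 i = dG (p1 i) (p2 i))"

lemma edge_dist_bounds:
  assumes "i < m"
  shows "num * dG (p1 i) (p2 i) \<le> B" "l (e i) * den \<le> B" "mdst X (p1 i) (p2 i) * den \<le> B"
    "mdst X (p1 i) (p2 i) \<le> B" "dG (p1 i) (p2 i) \<le> B"
proof -
  note p = endp[OF assms]
  have lb: "l (e i) \<le> Big" using len_le_Big eE[OF assms] by blast
  show "num * dG (p1 i) (p2 i) \<le> B" using num_bound p by blast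
  show "l (e i) * den \<le> B" by (rule den_bound) (use lb in simp)
  have b: "mdst Y (p1 i) (p2 i) \<le> 4 * ((m + 1) * Big)" for Y
    using mdst_le[of "p1 i" "p2 i" Y] p by simp
  show "mdst X (p1 i) (p2 i) * den \<le> B" by (rule den_bound[OF b])
  show "mdst X (p1 i) (p2 i) \<le> B" by (rule dist_bound[OF b])
  show "dG (p1 i) (p2 i) \<le> B" using dist_bound[OF b[of E]] mdst_E by simp
qed

lemma find_alive_wp:
  assumes "word_store B s" "inputs s"
  shows "wp B find_alive
    (\<lambda>t s'. t \<le> m * (dist_time + 13) + 20 \<and> inputs s' \<and> dists s' \<and> flags 17 alive s') s"
proof -
  let ?c0 = "19[Sc 23] ::= Num 1"
  have l0: "wp B (For 23 6 ?c0) (\<lambda>t s'. t \<le> m * (1 + 2) + 2 \<and> (\<forall>i<m. s' 19 i = 1)) s"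
  proof (rule wp_For[where I = "\<lambda>k s'. \<forall>i<k. s' 19 i = 1", OF assms(1)])
    fix k s'
    assume "k < m" "s' 23 0 = k" "word_store B s'" "\<forall>i<k. s' 19 i = 1"
    then show "wp B ?c0 (\<lambda>t s'. t \<le> 1 \<and> (\<forall>i<Suc k. s' 19 i = 1)) s'"
      using small_bounds by (auto simp: less_Suc_eq)
  qed (use assms in \<open>auto simp: inputs_def\<close>)
  let ?c = "from_edge ;; 16[Sc 22] ::= Cell 20 (Cell 13 (Sc 22)) ;;
       17[Sc 22] ::= Num 1 \<ominus> (Sc 7 \<otimes> Cell 16 (Sc 22) \<prec> Cell 14 (Sc 22) \<otimes> Sc 8)"
  let ?I = "\<lambda>k s'. \<forall>i<k. s' 16 i = dG (p1 i) (p2 i) \<and> s' 17 i = of_bool (e i \<in> alive)"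
  have l1: "wp B (For 22 6 ?c) (\<lambda>t s'. t \<le> m * (dist_time + 2 + 2) + 2 \<and> ?I m s') s1"
    if s1: "word_store B s1" "inputs s1" "loaded E s1" for s1
  proof (rule wp_For[where I = ?I, OF s1(1)])
    fix k s'
    assume a: "k < m" "s' 22 0 = k" "word_store B s'"
      "\<And>a. a \<notin> insert 22 (writes ?c) \<Longrightarrow> s' a = s1 a" "?I k s'"
    have i: "inputs s'" by (rule inputs_cong[OF s1(2)]) (subst a(4); simp)
    have ld: "loaded E s'" by (rule loaded_cong[OF s1(3)]) (subst a(4); simp)
    have al: "e k \<in> alive \<longleftrightarrow> l (e k) * den \<le> num * dG (p1 k) (p2 k)"
      using alive_iff[of "p1 k" "p2 k"] eE[OF a(1)] by simp
    show "wp B ?c (\<lambda>t s'. t \<le> dist_time + 2 \<and> ?I (Suc k) s') s'"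
      unfolding wp_Seq[of B from_edge]
    proof (rule wp_conseq[OF from_edge_wp[OF a(3) i ld a(2,1)] a(3)])
      fix t :: nat and s''
      assume b: "t \<le> dist_time \<and> s'' 20 (p2 k) = mdst E (p1 k) (p2 k)" "word_store B s''"
        "\<And>a. a \<notin> writes from_edge \<Longrightarrow> s'' a = s' a"
      have i'': "inputs s''" by (rule inputs_cong[OF i]) (subst b(3); simp)
      have I'': "?I k s''" "s'' 22 0 = k" using a(2,5) b(3) by simp_all
      show "wp B (16[Sc 22] ::= Cell 20 (Cell 13 (Sc 22)) ;;
         17[Sc 22] ::= Num 1 \<ominus> (Sc 7 \<otimes> Cell 16 (Sc 22) \<prec> Cell 14 (Sc 22) \<otimes> Sc 8))
           (\<lambda>t' s'. t + t' \<le> dist_time + 2 \<and> ?I (Suc k) s') s''"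
        using b(1,2) I'' inputsD[OF i''] a(1) al edge_dist_bounds[OF a(1)] in_bounds[OF a(1)]
          small_bounds by (auto simp: less_Suc_eq mdst_E)
    qed
  qed (use s1 in \<open>auto simp: inputs_def\<close>)
  show ?thesis
    unfolding find_alive_def wp_Seq[of B "For 23 6 c" for c]
  apply (rule wp_conseq[OF l0 assms(1)])
  subgoal premises a for t s1
  proof -
    have i: "inputs s1" by (rule inputs_cong[OF assms(2)]) (subst a(3); simp)
    have f: "flags 19 E s1" using a(1) eE by (simp add: flags_def)
    show "wp B (set_graph ;; For 22 6 ?c) (\<lambda>t' s2. t + t' \<le> m * (dist_time + 13) + 20
         \<and> inputs s2 \<and> dists s2 \<and> flags 17 alive s2) s1"
      unfolding wp_Seq[of B set_graph]
    proof (rule wp_conseq[OF set_graph_wp[OF a(2) i f] a(2)])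
      fix t1 :: nat and s2
      assume b: "t1 \<le> m * 6 + 10 \<and> loaded E s2" "word_store B s2"
        "\<And>a. a \<notin> writes set_graph \<Longrightarrow> s2 a = s1 a"
      have i2: "inputs s2" by (rule inputs_cong[OF i]) (subst b(3); simp)
      have ld: "loaded E s2" using b(1) by simp
      show "wp B (For 22 6 ?c) (\<lambda>t2 s2. t + (t1 + t2) \<le> m * (dist_time + 13) + 20
         \<and> inputs s2 \<and> dists s2 \<and> flags 17 alive s2) s2"
      proof (rule wp_conseq[OF l1[OF b(2) i2 ld] b(2)])
        fix t2 :: nat and s3
        assume c: "t2 \<le> m * (dist_time + 2 + 2) + 2 \<and> ?I m s3" "word_store B s3"
          "\<And>a. a \<notin> writes (For 22 6 ?c) \<Longrightarrow> s3 a = s2 a"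
        have "inputs s3" by (rule inputs_cong[OF i2]) (subst c(3); simp)
        then show "t + (t1 + t2) \<le> m * (dist_time + 13) + 20
         \<and> inputs s3 \<and> dists s3 \<and> flags 17 alive s3"
          using a(1) b(1) c(1) by (simp add: dists_def flags_def algebra_simps)
      qed
    qed
  qed
  done
qed

definition ready :: "store \<Rightarrow> bool" where
  "ready s \<longleftrightarrow> inputs s \<and> dists s \<and> flags 17 alive s \<and> flags 18 triv s"

lemma ready_cong: "ready s \<Longrightarrow> (\<And>a. 5 \<le> a \<Longrightarrow> a \<le> 18 \<Longrightarrow> s' a = s a) \<Longrightarrow> ready s'"
  unfolding ready_def inputs_def dists_def flags_def by simp

lemma triv_e_iff:
  assumes "i < m"
  shows "e i \<in> triv \<longleftrightarrow> e i \<in> alive \<and>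
    (num * dG (p1 i) (p2 i) < mdst (alive - {e i}) (p1 i) (p2 i) * den \<or> weight I (e i) = 0)"
proof -
  have "alive - {e i} \<subseteq> E" using alive_sub by blast
  then have "settled (alive - {e i}) (p1 i) (p2 i) \<longleftrightarrow>
      mdst (alive - {e i}) (p1 i) (p2 i) * den \<le> num * dG (p1 i) (p2 i)"
    using settled_iff_mdst endp[OF assms] by blast
  then show ?thesis using triv_iff[of "p1 i" "p2 i"] by (simp add: not_le)
qed

lemma find_trivial_wp:
  assumes "word_store B s" "inputs s" "dists s" "flags 17 alive s"
  shows "wp B find_trivial (\<lambda>t s'. t \<le> m * (dist_time + 9 * m + 20) + 2 \<and> ready s') s"
proof -
  let ?r = "If (Cell 17 (Sc 22))
       (If (Cell 15 (Sc 22))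
         (18[Sc 22] ::= (Sc 7 \<otimes> Cell 16 (Sc 22) \<prec> Cell 20 (Cell 13 (Sc 22)) \<otimes> Sc 8))
         (18[Sc 22] ::= Num 1))
       (18[Sc 22] ::= Num 0)"
  let ?c = "copy_array 19 17 ;; 19[Sc 22] ::= Num 0 ;; set_graph ;; from_edge ;; ?r"
  let ?I = "\<lambda>k s'. \<forall>i<k. s' 18 i = of_bool (e i \<in> triv)"
  let ?T = "dist_time + 9 * m + 18"
  have "wp B (For 22 6 ?c) (\<lambda>t s'. t \<le> m * (?T + 2) + 2 \<and> ?I m s') s"
  proof (rule wp_For[where I = ?I, OF assms(1)])
    fix k s0
    assume a: "k < m" "s0 22 0 = k" "word_store B s0"
      "\<And>a. a \<notin> insert 22 (writes ?c) \<Longrightarrow> s0 a = s a" "?I k s0"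
    have i0: "inputs s0" by (rule inputs_cong[OF assms(2)]) (subst a(4); simp)
    have f0: "flags 17 alive s0" "dists s0" using assms(3,4) a(4) by (simp_all add: flags_def dists_def)
    show "wp B ?c (\<lambda>t s'. t \<le> ?T \<and> ?I (Suc k) s') s0"
      unfolding wp_Seq[of B "copy_array x y" for x y]
    proof (rule wp_conseq[OF copy_array_wp[OF a(3) i0 _ _ _ f0(1)] a(3)])
      fix t :: nat and s1
      assume b: "t \<le> m * 3 + 2 \<and> flags 19 alive s1" "word_store B s1"
        "\<And>a. a \<notin> writes (copy_array 19 17) \<Longrightarrow> s1 a = s0 a"
      let ?s2 = "s1(19 := (s1 19)(k := 0))"
      have i2: "inputs ?s2" using inputs_cong[OF i0, of s1] b(3) by simp
      have f2: "flags 19 (alive - {e k}) ?s2"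
        using b(1) a(1) e_inj by (auto simp: flags_def)
      have w2: "word_store B ?s2" using b(2) by simp
      have k1: "s1 22 0 = k" using a(2) b(3) by simp
      have kB: "k \<le> B" using a(1) small_bounds by linarith
      have "wp B (set_graph ;; from_edge ;; ?r) (\<lambda>t' s'. Suc (t + t') \<le> ?T \<and> ?I (Suc k) s') ?s2"
        unfolding wp_Seq[of B set_graph]
      proof (rule wp_conseq[OF set_graph_wp[OF w2 i2 f2] w2])
        fix t1 :: nat and s3
        assume c: "t1 \<le> m * 6 + 10 \<and> loaded (alive - {e k}) s3" "word_store B s3"
          "\<And>a. a \<notin> writes set_graph \<Longrightarrow> s3 a = ?s2 a"
        have i3: "inputs s3" by (rule inputs_cong[OF i2]) (subst c(3); simp)
        have k3: "s3 22 0 = k" using k1 c(3) by simp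
        show "wp B (from_edge ;; ?r) (\<lambda>t' s'. Suc (t + (t1 + t')) \<le> ?T \<and> ?I (Suc k) s') s3"
          unfolding wp_Seq[of B from_edge]
        proof (rule wp_conseq[OF from_edge_wp[OF c(2) i3 conjunct2[OF c(1)] k3 a(1)] c(2)])
          fix t2 :: nat and s4
          assume d: "t2 \<le> dist_time \<and> s4 20 (p2 k) = mdst (alive - {e k}) (p1 k) (p2 k)"
            "word_store B s4" "\<And>a. a \<notin> writes from_edge \<Longrightarrow> s4 a = s3 a"
          have i4: "inputs s4" by (rule inputs_cong[OF i3]) (subst d(3); simp)
          have "s4 22 0 = k" using k3 d(3) by simp
          moreover have "s4 17 = s0 17" "s4 16 = s0 16" "s4 18 = s0 18"
            using b(3) c(3) d(3) by simp_all
          then have "?I k s4" "s4 17 k = of_bool (e k \<in> alive)" "s4 16 k = dG (p1 k) (p2 k)"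
            using a(1,5) f0 by (simp_all add: flags_def dists_def)
          ultimately show "wp B ?r (\<lambda>t' s'. Suc (t + (t1 + (t2 + t'))) \<le> ?T \<and> ?I (Suc k) s') s4"
            using b(1) c(1) d(1,2) inputsD[OF i4] a(1) triv_e_iff[OF a(1)] edge_dist_bounds[OF a(1)]
              in_bounds[OF a(1)] small_bounds by (auto simp: less_Suc_eq)
        qed
      qed
      then show "wp B (19[Sc 22] ::= Num 0 ;; set_graph ;; from_edge ;; ?r)
         (\<lambda>t' s'. t + t' \<le> ?T \<and> ?I (Suc k) s') s1"
        using k1 kB b(2) by (simp add: wp_Seq[of B "19[Sc 22] ::= Num 0"] del: wp_Seq)
    qed simp_all
  qed (use assms in \<open>auto simp: inputs_def\<close>)
  then have "wp B find_trivial (\<lambda>t s'. t \<le> m * (?T + 2) + 2 \<and> ?I m s') s"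
    by (simp add: find_trivial_def)
  then show ?thesis
  proof (rule wp_conseq[OF _ assms(1)])
    fix t :: nat and s'
    assume a: "t \<le> m * (?T + 2) + 2 \<and> ?I m s'" "\<And>a. a \<notin> writes find_trivial \<Longrightarrow> s' a = s a"
    have "inputs s'" by (rule inputs_cong[OF assms(2)]) (subst a(2); simp)
    moreover have "s' 16 = s 16" "s' 17 = s 17" using a(2) by simp_all
    ultimately show "t \<le> m * (dist_time + 9 * m + 20) + 2 \<and> ready s'"
      using a(1) assms(3,4) by (simp add: ready_def dists_def flags_def)
  qed
qed

lemma settles_all_e:
  "settles_all F \<longleftrightarrow> (\<forall>i<m. e i \<in> alive \<longrightarrow> settled F (p1 i) (p2 i))"
proof
  assume h: "\<forall>i<m. e i \<in> alive \<longrightarrow> settled F (p1 i) (p2 i)"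
  show "settles_all F" unfolding settles_all_def
  proof (intro allI impI)
    fix u v assume uv: "{u, v} \<in> alive"
    then obtain j where "j < m" "{u, v} = e j" using e_surj alive_sub by blast
    moreover from this have "settled F (p1 j) (p2 j)" using h uv by auto
    ultimately show "settled F u v" using settled_commute[of F] by (auto simp: doubleton_eq_iff)
  qed
qed (simp add: settles_all_def)

lemma find_critical_wp:
  assumes "word_store B s" "ready s"
  shows "wp B find_critical (\<lambda>t s'. t \<le> m * (dist_time + 14) + 20 \<and>
    (s' 26 0 = 0 \<longleftrightarrow> settles_all triv)) s"
proof -
  let ?r = "If (Cell 17 (Sc 22))
         (If (Sc 7 \<otimes> Cell 16 (Sc 22) \<prec> Cell 20 (Cell 13 (Sc 22)) \<otimes> Sc 8) (26 ::= Num 1) Skip) Skip"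
  let ?c = "from_edge ;; ?r"
  let ?I = "\<lambda>k s'. s' 26 0 = 0 \<longleftrightarrow> (\<forall>i<k. e i \<in> alive \<longrightarrow> settled triv (p1 i) (p2 i))"
  have i: "inputs s" and f: "flags 17 alive s" "flags 18 triv s" "dists s"
    using assms(2) by (auto simp: ready_def)
  have st: "settled triv (p1 k) (p2 k) \<longleftrightarrow> mdst triv (p1 k) (p2 k) * den \<le> num * dG (p1 k) (p2 k)"
    if "k < m" for k
    using settled_iff_mdst[of "p1 k" "p2 k" triv] endp[OF that] triv_sub alive_sub by auto
  have l1: "wp B (For 22 6 ?c) (\<lambda>t s'. t \<le> m * (dist_time + 3 + 2) + 2 \<and> ?I m s') s1"
    if s1: "word_store B s1" "inputs s1" "loaded triv s1" "s1 17 = s 17" "s1 16 = s 16" "s1 26 0 = 0" for s1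
  proof (rule wp_For[where I = ?I, OF s1(1)])
    fix k s'
    assume a: "k < m" "s' 22 0 = k" "word_store B s'"
      "\<And>a. a \<notin> insert 22 (writes ?c) \<Longrightarrow> s' a = s1 a" "?I k s'"
    have i': "inputs s'" by (rule inputs_cong[OF s1(2)]) (subst a(4); simp)
    have ld: "loaded triv s'" by (rule loaded_cong[OF s1(3)]) (subst a(4); simp)
    have s': "s' 16 = s 16" "s' 17 = s 17" using a(4) s1 by simp_all
    show "wp B ?c (\<lambda>t s'. t \<le> dist_time + 3 \<and> ?I (Suc k) s') s'"
      unfolding wp_Seq
    proof (rule wp_conseq[OF from_edge_wp[OF a(3) i' ld a(2,1)] a(3)])
      fix t :: nat and s''
      assume b: "t \<le> dist_time \<and> s'' 20 (p2 k) = mdst triv (p1 k) (p2 k)" "word_store B s''"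
        "\<And>a. a \<notin> writes from_edge \<Longrightarrow> s'' a = s' a"
      have i'': "inputs s''" by (rule inputs_cong[OF i']) (subst b(3); simp)
      have "?I k s''" "s'' 22 0 = k" using a(2,5) b(3) by simp_all
      moreover have "s'' 17 k = of_bool (e k \<in> alive)" "s'' 16 k = dG (p1 k) (p2 k)"
        using b(3) s' a(1) f by (simp_all add: flags_def dists_def)
      ultimately show "wp B ?r (\<lambda>t' s'. t + t' \<le> dist_time + 3 \<and> ?I (Suc k) s') s''"
        using b(1,2) inputsD[OF i''] a(1) st[OF a(1)] edge_dist_bounds[OF a(1)] in_bounds[OF a(1)]
          small_bounds by (auto simp: less_Suc_eq not_le)
    qed
  qed (use s1 in \<open>auto simp: inputs_def\<close>)
  show ?thesis
    unfolding find_critical_def wp_Seq[of B "copy_array x y" for x y]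
  proof (rule wp_conseq[OF copy_array_wp[OF assms(1) i _ _ _ f(2)] assms(1)])
    fix t :: nat and s1
    assume b: "t \<le> m * 3 + 2 \<and> flags 19 triv s1" "word_store B s1"
      "\<And>a. a \<notin> writes (copy_array 19 18) \<Longrightarrow> s1 a = s a"
    have i1: "inputs s1" by (rule inputs_cong[OF i]) (subst b(3); simp)
    show "wp B (set_graph ;; 26 ::= Num 0 ;; For 22 6 ?c) (\<lambda>t' s'. t + t' \<le> m * (dist_time + 14) + 20 \<and>
        (s' 26 0 = 0 \<longleftrightarrow> settles_all triv)) s1"
      unfolding wp_Seq[of B set_graph]
    proof (rule wp_conseq[OF set_graph_wp[OF b(2) i1 conjunct2[OF b(1)]] b(2)])
      fix t1 :: nat and s2
      assume c: "t1 \<le> m * 6 + 10 \<and> loaded triv s2" "word_store B s2"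
        "\<And>a. a \<notin> writes set_graph \<Longrightarrow> s2 a = s1 a"
      have i2: "inputs s2" by (rule inputs_cong[OF i1]) (subst c(3); simp)
      let ?s3 = "s2(26 := (s2 26)(0 := 0))"
      have w3: "word_store B ?s3" using c(2) by simp
      have "wp B (For 22 6 ?c) (\<lambda>t s'. t \<le> m * (dist_time + 3 + 2) + 2 \<and> ?I m s') ?s3"
        by (rule l1[OF w3]) (use i2 c b(3) in simp_all)
      then have "wp B (For 22 6 ?c) (\<lambda>t' s'. t + (t1 + Suc t') \<le> m * (dist_time + 14) + 20 \<and>
        (s' 26 0 = 0 \<longleftrightarrow> settles_all triv)) ?s3"
      proof (rule wp_conseq[OF _ w3])
        fix t2 :: nat and s4 assume d: "t2 \<le> m * (dist_time + 3 + 2) + 2 \<and> ?I m s4"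
        from settles_all_e[of triv]
        show "t + (t1 + Suc t2) \<le> m * (dist_time + 14) + 20 \<and> (s4 26 0 = 0 \<longleftrightarrow> settles_all triv)"
          using b(1) c(1) d by (simp add: algebra_simps)
      qed
      then show "wp B (26 ::= Num 0 ;; For 22 6 ?c) (\<lambda>t' s'. t + (t1 + t') \<le> m * (dist_time + 14) + 20 \<and>
        (s' 26 0 = 0 \<longleftrightarrow> settles_all triv)) s2"
        unfolding wp_Seq[of B "26 ::= Num 0"] by simp
    qed
  qed simp_all
qed

lemma sum_flags:
  assumes "X \<subseteq> E"
  shows "(\<Sum>i<m. of_bool (e i \<in> X) * weight I (e i)) = sum (weight I) X"
proof -
  have "(\<Sum>i<m. of_bool (e i \<in> X) * weight I (e i)) = (\<Sum>f\<in>E. of_bool (f \<in> X) * weight I f)"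
    by (rule sum.reindex_bij_betw[OF bij])
  also have "\<dots> = sum (weight I) X"
    using assms finE by (intro sum.mono_neutral_cong_right) auto
  finally show ?thesis .
qed

lemma check_weight_wp:
  assumes "word_store B s" "inputs s" "flags 29 X s" "X \<subseteq> E"
  shows "wp B check_weight (\<lambda>t s'. t \<le> m * 4 + 10 \<and>
    s' 28 0 = of_bool (sum (weight I) X \<le> budget I)) s"
proof -
  let ?c = "If (Cell 29 (Sc 23)) (27 ::= Sc 27 \<oplus> Cell 15 (Sc 23)) Skip"
  let ?I = "\<lambda>k s'. s' 27 0 = (\<Sum>i<k. of_bool (e i \<in> X) * weight I (e i))"
  let ?s1 = "s(27 := (s 27)(0 := 0))"
  have w1: "word_store B ?s1" using assms(1) by simp
  have "wp B (For 23 6 ?c) (\<lambda>t s'. t \<le> m * (2 + 2) + 2 \<and> ?I m s') ?s1"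
  proof (rule wp_For[where I = ?I, OF w1])
    fix k s'
    assume a: "k < m" "s' 23 0 = k" "word_store B s'"
      "\<And>a. a \<notin> insert 23 (writes ?c) \<Longrightarrow> s' a = ?s1 a" "?I k s'"
    have i: "inputs s'" by (rule inputs_cong[OF assms(2)]) (subst a(4); simp)
    have f: "s' 29 k = of_bool (e k \<in> X)" using a(1) a(4)[of 29] assms(3) by (simp add: flags_def)
    \<comment> \<open>Partial sums are at most the total weight of all edges, which fits into a
      word.\<close>
    have "(\<Sum>i<Suc k. of_bool (e i \<in> X) * weight I (e i)) \<le> (\<Sum>i<m. of_bool (e i \<in> X) * weight I (e i))"
      using a(1) by (intro sum_mono2) auto
    also have "\<dots> \<le> sum (weight I) E" unfolding sum_flags[OF assms(4)] using assms(4) finE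
      by (intro sum_mono2) auto
    finally have "(\<Sum>i<Suc k. of_bool (e i \<in> X) * weight I (e i)) \<le> B" using small_bounds by linarith
    then show "wp B ?c (\<lambda>t s'. t \<le> 2 \<and> ?I (Suc k) s') s'"
      using a(2,3,5) f inputsD(11)[OF i a(1)] in_bounds[OF a(1)] small_bounds by auto
  qed (use assms in \<open>auto simp: inputs_def\<close>)
  then have "wp B (For 23 6 ?c ;; 28 ::= Num 1 \<ominus> (Sc 9 \<prec> Sc 27)) (\<lambda>t s'. Suc t \<le> m * 4 + 10 \<and>
    s' 28 0 = of_bool (sum (weight I) X \<le> budget I)) ?s1"
    unfolding wp_Seq
  proof (rule wp_conseq[OF _ w1])
    fix t :: nat and s'
    assume a: "t \<le> m * (2 + 2) + 2 \<and> ?I m s'" "word_store B s'"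
      "\<And>a. a \<notin> writes (For 23 6 ?c) \<Longrightarrow> s' a = ?s1 a"
    have "s' 27 0 = sum (weight I) X" using a(1) sum_flags[OF assms(4)] by simp
    moreover have "s' 9 0 = budget I" using a(3)[of 9] inputsD(5)[OF assms(2)] by simp
    moreover have "s' 27 0 \<le> B" "s' 9 0 \<le> B" using a(2) by auto
    ultimately show "wp B (28 ::= Num 1 \<ominus> (Sc 9 \<prec> Sc 27)) (\<lambda>t' s'. Suc (t + t') \<le> m * 4 + 10 \<and>
    s' 28 0 = of_bool (sum (weight I) X \<le> budget I)) s'"
      using a(1,2) small_bounds by auto
  qed
  then show ?thesis unfolding check_weight_def wp_Seq[of B "27 ::= Num 0"] by simp
qed

end

section \<open>Calling the all-pairs shortest paths algorithm\<close>

text \<open>Renaming keeps the arrays of \<open>Q\<close> apart from the private ones.\<close>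

definition shift :: "nat \<Rightarrow> nat" where "shift a = (if a < 5 then a else a + 100)"

definition apsp_call :: "com \<Rightarrow> com" where "apsp_call Q = ren_com shift Q"

lemma writes_apsp_call [simp]: "5 \<le> a \<Longrightarrow> a < 105 \<Longrightarrow> a \<notin> writes (apsp_call Q)"
  by (auto simp: apsp_call_def writes_ren shift_def split: if_splits)

lemma inj_shift: "inj shift"
  by (auto simp: inj_def shift_def split: if_splits)

definition query :: "com \<Rightarrow> com" where
  "query Q = (set_graph ;; apsp_call Q)"

lemma writes_query [simp]: "5 \<le> a \<Longrightarrow> a \<noteq> 23 \<Longrightarrow> a < 105 \<Longrightarrow> a \<notin> writes (query Q)"
  by (simp add: query_def)

text \<open>Array 29 holds the current edge set, 30 the number of chosen edges, 31 the chosen edges.\<close>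

definition build_edges :: com where
  "build_edges = (copy_array 29 18 ;; For 22 30 (29[Cell 31 (Sc 22)] ::= Num 1))"

text \<open>The value \<open>m\<close> in array 36 means that no pair is unsettled. Later hits
  overwrite earlier ones; any unsettled pair serves for branching.\<close>

definition find_unsettled :: "com \<Rightarrow> com" where
  "find_unsettled Q = (copy_array 19 29 ;; query Q ;; 36 ::= Sc 6 ;;
     For 22 6 (If (Cell 17 (Sc 22))
       (If (Sc 7 \<otimes> Cell 16 (Sc 22) \<prec>
             Cell 4 (Cell 12 (Sc 22) \<otimes> Sc 5 \<oplus> Cell 13 (Sc 22)) \<otimes> Sc 8)
         (36 ::= Sc 22) Skip) Skip))"

text \<open>\<open>Less\<close> is the only comparison available: that neither strict inequality
  holds expresses that the edge is tight, so the end in \<open>a\<close> precedes the end in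
  \<open>b\<close> on a shortest path.\<close>

definition set_parent :: "nat \<Rightarrow> nat \<Rightarrow> com" where
  "set_parent a b =
     If (Cell 39 (Cell a (Sc 22)) \<oplus> Cell 14 (Sc 22) \<prec> Cell 39 (Cell b (Sc 22))) Skip
       (If (Cell 39 (Cell b (Sc 22)) \<prec> Cell 39 (Cell a (Sc 22)) \<oplus> Cell 14 (Sc 22)) Skip
         (40[Cell b (Sc 22)] ::= Cell a (Sc 22)))"

definition init_branch :: com where
  "init_branch = (37 ::= Cell 12 (Sc 36) ;; 38 ::= Cell 13 (Sc 36) ;;
     For 22 5 (39[Sc 22] ::= Cell 4 (Sc 37 \<otimes> Sc 5 \<oplus> Sc 22)) ;;
     For 22 6 (33[Sc 30 \<otimes> Sc 6 \<oplus> Sc 22] ::= Num 0) ;;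
     For 22 6 (If (Cell 29 (Sc 22)) (set_parent 12 13 ;; set_parent 13 12) Skip))"

lemma writes_build_edges [simp]: "writes build_edges = {22, 23, 29}"
  by (auto simp: build_edges_def)

lemma writes_find_unsettled [simp]:
  "5 \<le> a \<Longrightarrow> a < 105 \<Longrightarrow> a \<notin> {19, 22, 23, 36} \<Longrightarrow> a \<notin> writes (find_unsettled Q)"
  by (simp add: find_unsettled_def)

lemma writes_set_parent [simp]: "writes (set_parent a b) = {40}"
  by (auto simp: set_parent_def)

lemma writes_init_branch [simp]: "writes init_branch = {22, 33, 37, 38, 39, 40}"
  by (auto simp: init_branch_def)

text \<open>The guarantee for \<open>Q\<close> is taken only for masked length functions on the
  graph at hand, which are the inputs it is called on.\<close>

locale search = prog +
  fixes Q :: com and A :: "nat \<Rightarrow> nat \<Rightarrow> nat"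
  assumes apsp: "\<And>X s. \<lbrakk>word_store B s; encodes_graph n E (mask_len X Big l) s\<rbrakk> \<Longrightarrow>
      \<exists>t s'. exec B Q s t s' \<and> t \<le> A n (card E) \<and>
        (\<forall>u<n. \<forall>v<n. ereal (real (s' 4 (u * n + v))) = sp_dist E (mask_len X Big l) u v)"
begin

abbreviation "At \<equiv> A n m"

lemma apsp_dst:
  assumes "word_store B s" "encodes_graph n E (mask_len X Big l) s"
  shows "\<exists>t s'. exec B Q s t s' \<and> t \<le> At \<and> (\<forall>u<n. \<forall>v<n. s' 4 (u * n + v) = mdst X u v)"
proof -
  from apsp[OF assms] obtain t s' where a: "exec B Q s t s'" "t \<le> At"
    "\<forall>u<n. \<forall>v<n. ereal (real (s' 4 (u * n + v))) = sp_dist E (mask_len X Big l) u v" by blast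
  have "s' 4 (u * n + v) = mdst X u v" if uv: "u < n" "v < n" for u v
  proof -
    obtain p where "simple_path E u v p" using pathE[OF uv] by blast
    from sp_dist_eq_dst[OF this, of "mask_len X Big l"]
    have "ereal (real (s' 4 (u * n + v))) = ereal (real (mdst X u v))"
      using a(3)[rule_format, OF uv] by (rule trans[rotated])
    then show ?thesis by simp
  qed
  with a(1,2) show ?thesis by blast
qed

lemma apsp_call_wp:
  assumes "word_store B s" "loaded X s"
  shows "wp B (apsp_call Q) (\<lambda>t s'. t \<le> At \<and> (\<forall>u<n. \<forall>v<n. s' 4 (u * n + v) = mdst X u v)) s"
proof -
  have "word_store B (s \<circ> shift)" using assms(1) by (simp add: word_store_def)
  moreover have "loaded X (s \<circ> shift)" using assms(2) by (simp add: loaded_def shift_def)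
  ultimately obtain t s' where a: "exec B Q (s \<circ> shift) t s'" "t \<le> At"
    "\<forall>u<n. \<forall>v<n. s' 4 (u * n + v) = mdst X u v"
    using apsp_dst loaded_encodes by blast
  obtain s'' where s'': "exec B (apsp_call Q) s t s''" "s'' \<circ> shift = s'"
    using exec_ren[OF inj_shift a(1), of s] unfolding apsp_call_def by blast
  have eq: "s'' 4 = s' 4" using s''(2) by (auto simp: shift_def)
  have "\<forall>u<n. \<forall>v<n. s'' 4 (u * n + v) = mdst X u v" unfolding eq by (rule a(3))
  then show ?thesis using s''(1) a(2) unfolding wp_def by blast
qed

text \<open>Every cell of the distance matrix may initially be wrong, hence has to be written.\<close>

lemma A_ge: "n * n \<le> At"
proof -
  let ?L = "mask_len E Big l"
  \<comment> \<open>Array 4 starts with 1 on the diagonal and 0 elsewhere. True distances are 0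
    exactly on the diagonal, so each of the \<open>n * n\<close> cells is initially wrong.\<close>
  define s :: store where "s = (\<lambda>a i.
    if a = 0 then if i = 0 then n else if i = 1 then m else 0
    else if a = 1 then if i < m then p1 i else 0
    else if a = 2 then if i < m then p2 i else 0
    else if a = 3 then if i < m then ?L (e i) else 0
    else if a = 4 then of_bool (i div n = i mod n) else 0)"
  have "?L (e i) \<le> B" if "i < m" for i
    using mask_len_bounds[OF eE[OF that], of E] Big_le by linarith
  then have "word_store B s" unfolding word_store_def s_def
    using small_bounds in_bounds by (auto simp: of_bool_def)
  moreover have "loaded E s" by (simp add: loaded_def s_def)
  ultimately obtain t s' where a: "exec B Q s t s'" "t \<le> At"
    "\<forall>u<n. \<forall>v<n. s' 4 (u * n + v) = mdst E u v"
    using apsp_dst loaded_encodes by blast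
  have "s' 4 j \<noteq> s 4 j" if j: "j < n * n" for j
  proof -
    let ?u = "j div n" and ?v = "j mod n"
    have u: "?u < n" using j less_mult_imp_div_less by blast
    have v: "?v < n" using n_pos by simp
    have "?u * n + ?v = j" by simp
    then have s': "s' 4 j = mdst E ?u ?v" using a(3) u v by metis
    show ?thesis
    proof (cases "?u = ?v")
      case True
      then show ?thesis using s' by (simp add: s_def)
    next
      case False
      obtain p where p: "simple_path E ?u ?v p" "path_length ?L p = mdst E ?u ?v"
        using pathE[OF u v] dst_attained by metis
      have "path_edges p \<noteq> []"
        using p(1) False by (cases p rule: path_edges.cases) (auto simp: simple_path_def)
      then obtain f where f: "f \<in> set (path_edges p)" by (cases "path_edges p") auto
      then have "f \<in> E" using p(1) by (auto simp: simple_path_def)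
      then have "1 \<le> mdst E ?u ?v"
        using path_length_edge_le[OF f, of ?L] p(2) mask_len_bounds[of f E] by linarith
      then show ?thesis using s' False by (simp add: s_def)
    qed
  qed
  then have "{..<n * n} \<subseteq> {j. s' 4 j \<noteq> s 4 j}" by blast
  then have "card {..<n * n} \<le> card {j. s' 4 j \<noteq> s 4 j}"
    using exec_changed[OF a(1)] by (intro card_mono) auto
  also have "\<dots> \<le> t" using exec_changed[OF a(1)] by blast
  finally show ?thesis using a(2) by simp
qed

lemma m_le: "m \<le> n * n"
proof -
  have "inj_on (\<lambda>i. (p1 i, p2 i)) {..<m}"
  proof (rule inj_onI)
    fix i j assume "i \<in> {..<m}" "j \<in> {..<m}" "(p1 i, p2 i) = (p1 j, p2 j)"
    then show "i = j" using e_inj[of i j] by simp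
  qed
  then have "card {..<m} \<le> card ({..<n} \<times> {..<n})"
    by (rule card_inj_on_le) (use endp in auto)
  then show ?thesis by (simp add: card_cartesian_product)
qed

text \<open>This permits every overhead that is linear in \<open>n\<close> and \<open>m\<close> to
  be charged to one call of \<open>Q\<close>.\<close>

lemma small_At: "1 \<le> At" "n \<le> At" "m \<le> At"
proof -
  have "1 \<le> n * n" "n \<le> n * n" using n_pos by (simp_all add: Suc_le_eq)
  then show "1 \<le> At" "n \<le> At" "m \<le> At" using A_ge m_le by linarith+
qed

lemma query_wp:
  assumes "word_store B s" "inputs s" "flags 19 X s"
  shows "wp B (query Q) (\<lambda>t s'. t \<le> At + m * 6 + 10 \<and>
    (\<forall>u<n. \<forall>v<n. s' 4 (u * n + v) = mdst X u v)) s"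
  unfolding query_def wp_Seq
proof (rule wp_conseq[OF set_graph_wp[OF assms] assms(1)])
  fix t :: nat and s1
  assume a: "t \<le> m * 6 + 10 \<and> loaded X s1" "word_store B s1"
  show "wp B (apsp_call Q) (\<lambda>t' s'. t + t' \<le> At + m * 6 + 10 \<and>
    (\<forall>u<n. \<forall>v<n. s' 4 (u * n + v) = mdst X u v)) s1"
    by (rule wp_conseq[OF apsp_call_wp[OF a(2) conjunct2[OF a(1)]] a(2)]) (use a(1) in auto)
qed

lemma build_edges_wp:
  assumes "word_store B s" "ready s" "s 30 0 = length cs" "\<And>k. k < length cs \<Longrightarrow> s 31 k = cs ! k"
    "set cs \<subseteq> {..<m}"
  shows "wp B build_edges (\<lambda>t s'. t \<le> m * 3 + length cs * 3 + 4 \<and>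
    flags 29 (triv \<union> e ` set cs) s') s"
proof -
  have i: "inputs s" and f: "flags 18 triv s" using assms(2) by (auto simp: ready_def)
  let ?c = "29[Cell 31 (Sc 22)] ::= Num 1"
  show ?thesis
    unfolding build_edges_def wp_Seq
  proof (rule wp_conseq[OF copy_array_wp[OF assms(1) i _ _ _ f] assms(1)])
    fix t :: nat and s1
    assume a: "t \<le> m * 3 + 2 \<and> flags 29 triv s1" "word_store B s1"
      "\<And>a. a \<notin> writes (copy_array 29 18) \<Longrightarrow> s1 a = s a"
    let ?I = "\<lambda>k. flags 29 (triv \<union> e ` set (take k cs))"
    have "wp B (For 22 30 ?c) (\<lambda>t s'. t \<le> length cs * (1 + 2) + 2 \<and> ?I (length cs) s') s1"
    proof (rule wp_For[where I = ?I, OF a(2)])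
      fix k s'
      assume b: "k < length cs" "s' 22 0 = k" "word_store B s'"
        "\<And>a. a \<notin> insert 22 (writes ?c) \<Longrightarrow> s' a = s1 a" "?I k s'"
      have k: "s' 31 k = cs ! k" using b(1) b(4)[of 31] a(3)[of 31] assms(4) by simp
      have km: "cs ! k < m" using assms(5) b(1) nth_mem by blast
      have "k \<le> B" "cs ! k \<le> B" using word_storeD[OF b(3), of 31 k] word_storeD[OF b(3), of 22 0] b(2) k by auto
      then show "wp B ?c (\<lambda>t s'. t \<le> 1 \<and> ?I (Suc k) s') s'"
        using b(1,2,3,5) k km e_inj small_bounds
        by (auto simp: flags_def take_Suc_conv_app_nth)
    qed (use a assms in auto)
    then show "wp B (For 22 30 ?c) (\<lambda>t' s'. t + t' \<le> m * 3 + length cs * 3 + 4 \<and>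
        flags 29 (triv \<union> e ` set cs) s') s1"
      by (rule wp_conseq[OF _ a(2)]) (use a(1) in auto)
  qed simp_all
qed

lemma mat_index: "u < n \<Longrightarrow> v < n \<Longrightarrow> u * n + v \<le> B" and mat_index': "u < n \<Longrightarrow> u * n \<le> B"
proof -
  have *: "u * n + v < n * n" if "u < n" "v < n" for u v
  proof -
    have "Suc u * n \<le> n * n" using that(1) by (intro mult_le_mono1) simp
    then show ?thesis using that(2) by simp
  qed
  show "u < n \<Longrightarrow> v < n \<Longrightarrow> u * n + v \<le> B" using *[of u v] small_bounds(1) by linarith
  show "u < n \<Longrightarrow> u * n \<le> B" using *[of u 0] n_pos small_bounds(1) by linarith
qed

definition "matrix X s \<longleftrightarrow> (\<forall>u<n. \<forall>v<n. s 4 (u * n + v) = mdst X u v)"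

definition "unsettled_at F s \<longleftrightarrow> s 36 0 = m \<and> settles_all F \<or>
  s 36 0 < m \<and> e (s 36 0) \<in> alive \<and> \<not> settled F (p1 (s 36 0)) (p2 (s 36 0))"

lemma find_unsettled_wp:
  assumes "word_store B s" "ready s" "flags 29 F s" "F \<subseteq> E"
  shows "wp B (find_unsettled Q) (\<lambda>t s'. t \<le> At + m * 15 + 20 \<and> matrix F s' \<and>
    unsettled_at F s') s"
proof -
  have i: "inputs s" and f: "dists s" "flags 17 alive s" using assms(2) by (auto simp: ready_def)
  let ?c = "If (Cell 17 (Sc 22))
       (If (Sc 7 \<otimes> Cell 16 (Sc 22) \<prec>
             Cell 4 (Cell 12 (Sc 22) \<otimes> Sc 5 \<oplus> Cell 13 (Sc 22)) \<otimes> Sc 8)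
         (36 ::= Sc 22) Skip) Skip"
  let ?I = "\<lambda>k s'. s' 36 0 = m \<and> (\<forall>i<k. e i \<in> alive \<longrightarrow> settled F (p1 i) (p2 i)) \<or>
     s' 36 0 < m \<and> e (s' 36 0) \<in> alive \<and> \<not> settled F (p1 (s' 36 0)) (p2 (s' 36 0))"
  have l1: "wp B (For 22 6 ?c) (\<lambda>t s'. t \<le> m * (3 + 2) + 2 \<and> ?I m s') s1"
    if s1: "word_store B s1" "inputs s1" "matrix F s1" "s1 17 = s 17" "s1 16 = s 16" "s1 36 0 = m" for s1
  proof (rule wp_For[where I = ?I, OF s1(1)])
    fix k s'
    assume a: "k < m" "s' 22 0 = k" "word_store B s'"
      "\<And>a. a \<notin> insert 22 (writes ?c) \<Longrightarrow> s' a = s1 a" "?I k s'"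
    have i': "inputs s'" by (rule inputs_cong[OF s1(2)]) (subst a(4); simp)
    have st: "settled F (p1 k) (p2 k) \<longleftrightarrow> mdst F (p1 k) (p2 k) * den \<le> num * dG (p1 k) (p2 k)"
      using settled_iff_mdst[OF _ _ assms(4)] endp[OF a(1)] by blast
    have mx: "s' 4 (p1 k * n + p2 k) = mdst F (p1 k) (p2 k)"
      using a(4)[of 4] s1(3) endp[OF a(1)] by (simp add: matrix_def)
    have "s' 17 k = of_bool (e k \<in> alive)" "s' 16 k = dG (p1 k) (p2 k)"
      using a(1) a(4)[of 16] a(4)[of 17] s1(4,5) f by (simp_all add: flags_def dists_def)
    then show "wp B ?c (\<lambda>t s'. t \<le> 3 \<and> ?I (Suc k) s') s'"
      using a(1,2,3,5) inputsD[OF i'] st mx edge_dist_bounds[OF a(1)] in_bounds[OF a(1)]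
          small_bounds mat_index mat_index' endp[OF a(1)] by (auto simp: less_Suc_eq not_le)
  qed (use s1 in \<open>auto simp: inputs_def\<close>)
  show ?thesis
    unfolding find_unsettled_def wp_Seq[of B "copy_array x y" for x y]
  proof (rule wp_conseq[OF copy_array_wp[OF assms(1) i _ _ _ assms(3)] assms(1)])
    fix t :: nat and s1
    assume b: "t \<le> m * 3 + 2 \<and> flags 19 F s1" "word_store B s1"
      "\<And>a. a \<notin> writes (copy_array 19 29) \<Longrightarrow> s1 a = s a"
    have i1: "inputs s1" by (rule inputs_cong[OF i]) (subst b(3); simp)
    show "wp B (query Q ;; 36 ::= Sc 6 ;; For 22 6 ?c) (\<lambda>t' s'. t + t' \<le> At + m * 15 + 20 \<and> matrix F s' \<and>
    unsettled_at F s') s1"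
      unfolding wp_Seq[of B "query Q"]
      apply (rule wp_conseq[OF query_wp[OF b(2) i1 conjunct2[OF b(1)]] b(2)])
      subgoal premises c for t1 s2
      proof -
        have i2: "inputs s2" by (rule inputs_cong[OF i1]) (subst c(3); simp)
        let ?s3 = "s2(36 := (s2 36)(0 := m))"
        have w3: "word_store B ?s3" using c(2) small_bounds by auto
        have "wp B (For 22 6 ?c) (\<lambda>t s'. t \<le> m * (3 + 2) + 2 \<and> ?I m s') ?s3"
          by (rule l1[OF w3]) (use i2 c b(3) in \<open>simp_all add: matrix_def\<close>)
        then have "wp B (For 22 6 ?c) (\<lambda>t' s'. t + (t1 + Suc t') \<le> At + m * 15 + 20 \<and> matrix F s' \<and>
          unsettled_at F s') ?s3"
        proof (rule wp_conseq[OF _ w3])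
          fix t2 :: nat and s4 assume d: "t2 \<le> m * (3 + 2) + 2 \<and> ?I m s4"
            "\<And>a. a \<notin> writes (For 22 6 ?c) \<Longrightarrow> s4 a = ?s3 a"
          have "matrix F s4" using d(2)[of 4] c(1) by (simp add: matrix_def)
          then show "t + (t1 + Suc t2) \<le> At + m * 15 + 20 \<and> matrix F s4 \<and>
            unsettled_at F s4"
            using b(1) c(1) d(1) settles_all_e[of F] by (auto simp: unsettled_at_def)
        qed
        then show ?thesis
          using inputsD(2)[OF i2] small_bounds by (simp add: wp_Seq[of B "36 ::= Sc 6"] del: wp_Seq)
      qed
      done
  qed simp_all
qed

text \<open>The predecessor of \<open>x\<close> on a shortest masked path works: a length below
  \<open>Big\<close> means that the path stays in \<open>F\<close>.\<close>

lemma parent_exists: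
  assumes "F \<subseteq> E" "u < n" "x < n" "x \<noteq> u" "mdst F u x < Big"
  shows "\<exists>p. {p, x} \<in> F \<and> mdst F u p + l {p, x} = mdst F u x"
proof -
  let ?L = "mask_len F Big l"
  obtain P where P: "simple_path E u x P" "path_length ?L P = mdst F u x"
    using pathE[OF assms(2,3)] dst_attained[of E u x _ ?L] by blast
  have PF: "set (path_edges P) \<subseteq> F" by (rule path_avoids_mask[of F Big l P]) (use P(2) assms(5) in simp)
  have "P \<noteq> []" "hd P = u" "last P = x" using P(1) by (auto simp: simple_path_def)
  then obtain q where q: "P = q @ [x]" "q \<noteq> []" "hd q = u"
    using assms(4) by (cases P rule: rev_cases) (auto simp: hd_append split: if_splits)
  let ?p = "last q"
  have eP: "path_edges P = path_edges q @ [{?p, x}]" using q by (simp add: path_edges_append)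
  have pF: "{?p, x} \<in> F" using PF eP by simp
  have lP: "path_length ?L P = path_length ?L q + l {?p, x}"
    using q pF path_length_append[of q "[x]" ?L] by (simp add: mask_len_def)
  have "mdst F u ?p \<le> path_length ?L q"
    by (rule dst_le_walk) (use q PF eP assms(1) in auto)
  moreover have "mdst F u x \<le> mdst F u ?p + l {?p, x}"
  proof -
    have "?p < n" using pF assms(1) edgeD by blast
    then obtain r where r: "simple_path E u ?p r" "path_length ?L r = mdst F u ?p"
      using pathE[OF assms(2)] dst_attained[of E u ?p _ ?L] by blast
    have "mdst F u x \<le> path_length ?L (r @ [x])"
      by (rule dst_le_walk) (use r pF assms(1) in \<open>auto simp: simple_path_def path_edges_append\<close>)
    then show ?thesis using r pF by (auto simp: simple_path_def path_length_append mask_len_def)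
  qed
  ultimately show ?thesis using pF lP P(2) by (intro exI[of _ ?p]) simp
qed

lemma set_parent_wp:
  assumes "word_store B s" "s 22 0 = i" "s a i = x" "s b i = y" "s 39 x + s 14 i \<le> B" "1 \<le> B"
  shows "wp B (set_parent a b) (\<lambda>t s'. t \<le> 3 \<and>
    s' = (if s 39 x + s 14 i = s 39 y then s(40 := (s 40)(y := x)) else s)) s"
proof -
  have "i \<le> B" "x \<le> B" "y \<le> B" using assms(1-4) by auto
  then show ?thesis unfolding set_parent_def using assms by auto
qed

text \<open>Each edge of \<open>F\<close> writes itself into array 40 wherever it is tight, and by
  \<open>parent_exists\<close> every vertex concerned has a tight edge. Overwriting is harmless, as
  all values that tight edges write are valid parents.\<close>

lemma init_branch_wp:
  assumes s: "word_store B s" "ready s" "flags 29 F s" "F \<subseteq> alive" "matrix F s" "s 36 0 = c" "c < m"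
    "s 30 0 = L" "L < m"
  defines "u \<equiv> p1 c"
  shows "wp B init_branch (\<lambda>t s'. t \<le> n * 3 + m * 13 + 10 \<and> s' 37 0 = u \<and> s' 38 0 = p2 c \<and>
    (\<forall>x<n. s' 39 x = mdst F u x) \<and> (\<forall>j<m. s' 33 (L * m + j) = 0) \<and> (\<forall>j<L * m. s' 33 j = s 33 j) \<and>
    (\<forall>x<n. x \<noteq> u \<longrightarrow> mdst F u x < Big \<longrightarrow>
      {s' 40 x, x} \<in> F \<and> mdst F u (s' 40 x) + l {s' 40 x, x} = mdst F u x)) s"
proof -
  have i: "inputs s" using s(2) by (auto simp: ready_def)
  have un: "u < n" using endp[OF s(7)] u_def by simp
  let ?d = "mdst F u"
  have dB: "?d x + Big \<le> B" "?d x \<le> B" if "x < n" for x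
  proof -
    show "?d x + Big \<le> B" by (rule dist_bound) (use mdst_le[OF un that, of F] in simp)
    then show "?d x \<le> B" by simp
  qed
  have LmB: "L * m + j < m * m" if "j < m" for j
  proof -
    have "Suc L * m \<le> m * m" using s(9) by (intro mult_le_mono1) simp
    then show ?thesis using that by simp
  qed
  have LmB': "L * m + j \<le> B" "L * m \<le> B" if "j < m" for j
    using LmB[OF that] small_bounds(2) by linarith+
  let ?s2 = "s(37 := (s 37)(0 := u), 38 := (s 38)(0 := p2 c))"
  have w2: "word_store B ?s2" using s(1) in_bounds[OF s(7)] u_def by auto
  let ?c1 = "39[Sc 22] ::= Cell 4 (Sc 37 \<otimes> Sc 5 \<oplus> Sc 22)"
  let ?I1 = "\<lambda>k s'. \<forall>x<k. s' 39 x = ?d x"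
  have l1: "wp B (For 22 5 ?c1) (\<lambda>t s'. t \<le> n * (1 + 2) + 2 \<and> ?I1 n s') ?s2"
  proof (rule wp_For[where I = ?I1, OF w2])
    fix k s'
    assume a: "k < n" "s' 22 0 = k" "word_store B s'"
      "\<And>a. a \<notin> insert 22 (writes ?c1) \<Longrightarrow> s' a = ?s2 a" "?I1 k s'"
    have "s' 4 (u * n + k) = ?d k" using a(4)[of 4] s(5) a(1) un by (simp add: matrix_def)
    moreover have "s' 37 0 = u" "s' 5 0 = n"
      using a(4)[of 37] a(4)[of 5] inputsD(1)[OF i] by auto
    moreover have "k \<le> B" "u \<le> B" using a(1) un small_bounds by linarith+
    ultimately show "wp B ?c1 (\<lambda>t s'. t \<le> 1 \<and> ?I1 (Suc k) s') s'"
      using a(1,2,3,5) dB[OF a(1)] mat_index[OF un a(1)] mat_index'[OF un] small_bounds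
      by (auto simp: less_Suc_eq)
  qed (use i in \<open>auto simp: inputs_def\<close>)
  let ?c2 = "33[Sc 30 \<otimes> Sc 6 \<oplus> Sc 22] ::= Num 0"
  let ?I2 = "\<lambda>k s'. (\<forall>j<k. s' 33 (L * m + j) = 0) \<and> (\<forall>j<L * m. s' 33 j = s 33 j)"
  have l2: "wp B (For 22 6 ?c2) (\<lambda>t s'. t \<le> m * (1 + 2) + 2 \<and> ?I2 m s') s3"
    if s3: "word_store B s3" "s3 6 0 = m" "s3 30 0 = L" "s3 33 = s 33" for s3
  proof (rule wp_For[where I = ?I2, OF s3(1)])
    fix k s'
    assume a: "k < m" "s' 22 0 = k" "word_store B s'"
      "\<And>a. a \<notin> insert 22 (writes ?c2) \<Longrightarrow> s' a = s3 a" "?I2 k s'"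
    have "s' 30 0 = L" "s' 6 0 = m" using a(4)[of 30] a(4)[of 6] s3 by auto
    moreover have "k \<le> B" "L \<le> B" using a(1) s(9) small_bounds by linarith+
    ultimately show "wp B ?c2 (\<lambda>t s'. t \<le> 1 \<and> ?I2 (Suc k) s') s'"
      using a(1,2,3,5) LmB'[OF a(1)] small_bounds by (auto simp: less_Suc_eq)
  qed (use s3 in auto)
  define ok where "ok x p \<longleftrightarrow> {p, x} \<in> F \<and> ?d p + l {p, x} = ?d x" for x p
  let ?c3 = "If (Cell 29 (Sc 22)) (set_parent 12 13 ;; set_parent 13 12) Skip"
  let ?I3 = "\<lambda>k s'. \<forall>i<k. \<forall>x p. e i = {p, x} \<longrightarrow> ok x p \<longrightarrow> ok x (s' 40 x)"
  have l3: "wp B (For 22 6 ?c3) (\<lambda>t s'. t \<le> m * (7 + 2) + 2 \<and> ?I3 m s') s4"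
    if s4: "word_store B s4" "inputs s4" "flags 29 F s4" "\<forall>x<n. s4 39 x = ?d x" for s4
  proof (rule wp_For[where I = ?I3, OF s4(1)])
    fix k s'
    assume a: "k < m" "s' 22 0 = k" "word_store B s'"
      "\<And>a. a \<notin> insert 22 (writes ?c3) \<Longrightarrow> s' a = s4 a" "?I3 k s'"
    have i': "inputs s'" by (rule inputs_cong[OF s4(2)]) (subst a(4); simp)
    have f: "s' 29 k = of_bool (e k \<in> F)" using a(1) a(4)[of 29] s4(3) by (simp add: flags_def)
    let ?x = "p1 k" and ?y = "p2 k" and ?l = "l (e k)"
    have xy: "?x < n" "?y < n" "?x \<noteq> ?y" using endp[OF a(1)] by auto
    have D: "s' 39 ?x = ?d ?x" "s' 39 ?y = ?d ?y" using a(4)[of 39] s4(4) xy by auto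
    have lB: "?l \<le> Big" using len_le_Big eE[OF a(1)] by blast
    have ec: "{?y, ?x} = e k" by blast
    show "wp B ?c3 (\<lambda>t s'. t \<le> 7 \<and> ?I3 (Suc k) s') s'"
    proof (cases "e k \<in> F")
      case False
      then have "\<not> ok x p" if "e k = {p, x}" for x p using that by (simp add: ok_def)
      then show ?thesis using f False a small_bounds by (auto simp: less_Suc_eq)
    next
      case True
      let ?g = "\<lambda>f x y. if ?d x + ?l = ?d y then f(y := x) else f"
      let ?f1 = "?g (s' 40) ?x ?y"
      let ?f2 = "?g ?f1 ?y ?x"
      \<comment> \<open>A valid parent can only be replaced by the other end of a tight edge of
        \<open>F\<close>, which is again valid.\<close>
      have pres: "ok z (f z) \<Longrightarrow> ok z (?g f x y z)" if "{x, y} = e k" for f x y z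
        using that True by (auto simp: ok_def)
      have new: "ok y p \<Longrightarrow> ok y (?g f p y y)" if "e k = {p, y}" for f y p
        using that by (auto simp: ok_def)
      have r: "wp B (set_parent 12 13) (\<lambda>t s''. t \<le> 3 \<and>
        s'' = (if s' 39 ?x + s' 14 k = s' 39 ?y then s'(40 := (s' 40)(?y := ?x)) else s')) s'"
        by (rule set_parent_wp[OF a(3,2)])
          (use inputsD[OF i'] a(1) D dB(1)[OF xy(1)] lB small_bounds in auto)
      have "wp B (set_parent 12 13 ;; set_parent 13 12) (\<lambda>t s''. Suc t \<le> 7 \<and> s'' 40 = ?f2) s'"
        unfolding wp_Seq
      proof (rule wp_conseq[OF r a(3)])
        fix t :: nat and s1
        assume t: "t \<le> 3 \<and>
          s1 = (if s' 39 ?x + s' 14 k = s' 39 ?y then s'(40 := (s' 40)(?y := ?x)) else s')"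
          and w1: "word_store B s1" and fr: "\<And>a. a \<notin> writes (set_parent 12 13) \<Longrightarrow> s1 a = s' a"
        have f1: "s1 40 = ?f1" using t D inputsD(10)[OF i' a(1)] by auto
        have z: "s1 22 = s' 22" "s1 12 = s' 12" "s1 13 = s' 13" "s1 14 = s' 14" "s1 39 = s' 39"
          using fr by simp_all
        have r2: "wp B (set_parent 13 12) (\<lambda>t s''. t \<le> 3 \<and>
          s'' = (if s1 39 ?y + s1 14 k = s1 39 ?x then s1(40 := (s1 40)(?x := ?y)) else s1)) s1"
          by (rule set_parent_wp[OF w1])
            (use z inputsD[OF i'] a(1,2) D dB(1)[OF xy(2)] lB small_bounds in auto)
        show "wp B (set_parent 13 12) (\<lambda>t' s''. Suc (t + t') \<le> 7 \<and> s'' 40 = ?f2) s1"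
        proof (rule wp_conseq[OF r2 w1])
          fix t' :: nat and s''
          assume t': "t' \<le> 3 \<and>
            s'' = (if s1 39 ?y + s1 14 k = s1 39 ?x then s1(40 := (s1 40)(?x := ?y)) else s1)"
          have "s'' 40 = ?f2"
            unfolding conjunct2[OF t'] z(4,5) D inputsD(10)[OF i' a(1)] f1[symmetric] by simp
          then show "Suc (t + t') \<le> 7 \<and> s'' 40 = ?f2" using t t' by simp
        qed
      qed
      then have "wp B (set_parent 12 13 ;; set_parent 13 12) (\<lambda>t s''. Suc t \<le> 7 \<and> ?I3 (Suc k) s'') s'"
      proof (rule wp_conseq[OF _ a(3)])
        fix t :: nat and s'' assume t: "Suc t \<le> 7 \<and> s'' 40 = ?f2"
        have "ok x (?f2 x)" if i: "i < Suc k" and ei: "e i = {p, x}" and o: "ok x p" for i x p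
        proof (cases "i < k")
          case True
          then have "ok x (s' 40 x)" using a(5) ei o by blast
          then show ?thesis using pres[OF ec] pres[of ?x ?y] by blast
        next
          case False
          then have "i = k" using i by simp
          then have "p = ?x \<and> x = ?y \<or> p = ?y \<and> x = ?x" using ei by (auto simp: doubleton_eq_iff)
          then show ?thesis
          proof
            assume h: "p = ?x \<and> x = ?y"
            then have "ok x (?f1 x)" using new[of ?x ?y "s' 40"] o by blast
            then show ?thesis using pres[OF ec] by blast
          next
            assume h: "p = ?y \<and> x = ?x"
            then show ?thesis using new[of ?y ?x ?f1] o ec by blast
          qed
        qed
        then show "Suc t \<le> 7 \<and> ?I3 (Suc k) s''" using t by simp
      qed
      then show ?thesis using f True a(1,2,3) small_bounds by simp
    qed
  qed (use s4 in \<open>auto simp: inputs_def\<close>)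
  have fin: "ok x (s' 40 x)" if h: "?I3 m s'" and x: "x < n" "x \<noteq> u" "?d x < Big" for s' x
  proof -
    have "F \<subseteq> E" using s(4) alive_sub by blast
    then obtain p where p: "ok x p"
      using parent_exists[OF _ un x] unfolding ok_def by blast
    then have "{p, x} \<in> E" using \<open>F \<subseteq> E\<close> by (auto simp: ok_def)
    then obtain i where "i < m" "e i = {p, x}" using e_surj by metis
    with h p show ?thesis by blast
  qed
  have "wp B (For 22 5 ?c1 ;; For 22 6 ?c2 ;; For 22 6 ?c3) (\<lambda>t s'. Suc (Suc t) \<le> n * 3 + m * 13 + 10 \<and> s' 37 0 = u \<and> s' 38 0 = p2 c \<and>
    (\<forall>x<n. s' 39 x = ?d x) \<and> (\<forall>j<m. s' 33 (L * m + j) = 0) \<and> (\<forall>j<L * m. s' 33 j = s 33 j) \<and>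
    (\<forall>x<n. x \<noteq> u \<longrightarrow> ?d x < Big \<longrightarrow> ok x (s' 40 x))) ?s2"
    unfolding wp_Seq[of B "For 22 5 c" for c]
    apply (rule wp_conseq[OF l1 w2])
    subgoal premises a for t s3
      unfolding wp_Seq
      apply (rule wp_conseq[OF l2 a(2)])
      subgoal by (rule a(2))
      subgoal using a(3)[of 6] inputsD(2)[OF i] by simp
      subgoal using a(3)[of 30] s(8) by simp
      subgoal using a(3)[of 33] by simp
      subgoal premises b for t1 s4
        apply (rule wp_conseq[OF l3 b(2)])
        subgoal by (rule b(2))
        subgoal by (rule inputs_cong[OF i]) (subst b(3); simp add: a(3))
        subgoal using a(3)[of 29] b(3)[of 29] s(3) by (simp add: flags_def)
        subgoal using a(1) b(3)[of 39] by simp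
        subgoal premises c for t2 s5
          using a(1) b(1) c(1) fin[of s5] a(3)[of 37] a(3)[of 38] b(3)[of 37] b(3)[of 38] b(3)[of 39]
            c(3)[of 37] c(3)[of 38] c(3)[of 39] c(3)[of 33] by auto
        done
      done
    done
  then show ?thesis
    unfolding init_branch_def wp_Seq[of B "37 ::= x" for x] wp_Seq[of B "38 ::= x" for x] ok_def
    using s inputsD(8,9)[OF i s(7)] in_bounds[OF s(7)] small_bounds u_def by (simp del: wp_Seq)
qed

end

section \<open>Finding the branching edges\<close>

abbreviation bneq (infix "\<noteq>\<^sub>e" 50) where "x \<noteq>\<^sub>e y \<equiv> (x \<prec> y) \<oplus> (y \<prec> x)"

text \<open>Array 41 is a queue of vertices with head 43 and length 42; 40 holds the parents, 39 the
  distances from vertex 37 within the current edge set, 44 marks the ancestors of vertex 45, and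
  33 marks the branching edges of every level.\<close>

definition mark_path :: com where
  "mark_path = (For 22 5 (44[Sc 22] ::= Num 0) ;; 46 ::= Sc 45 ;;
     For 22 5 (44[Sc 46] ::= Num 1 ;; If (Sc 46 \<noteq>\<^sub>e Sc 37) (46 ::= Cell 40 (Sc 46)) Skip))"

definition mask_path :: com where
  "mask_path = For 22 6 (19[Sc 22] ::= Cell 17 (Sc 22) \<otimes> (Num 1 \<ominus> Cell 44 (Cell 12 (Sc 22)))
     \<otimes> (Num 1 \<ominus> Cell 44 (Cell 13 (Sc 22))))"

text \<open>The edge is read in the direction from \<open>a\<close> to \<open>b\<close>. Of the
  edges of \<open>F\<close> only tree edges are followed, so no vertex is entered from two sides; an
  edge outside \<open>F\<close> that passes the test becomes a branching edge.\<close>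

definition extend :: "nat \<Rightarrow> nat \<Rightarrow> com" where
  "extend a b = If (Cell a (Sc 22) \<noteq>\<^sub>e Sc 45) Skip
     (If (Sc 7 \<otimes> Cell 16 (Sc 36) \<prec>
         (Cell 39 (Sc 45) \<oplus> Cell 14 (Sc 22) \<oplus> Cell 4 (Cell b (Sc 22) \<otimes> Sc 5 \<oplus> Sc 38)) \<otimes> Sc 8) Skip
       (If (Cell 29 (Sc 22))
         (If (Cell 40 (Cell b (Sc 22)) \<noteq>\<^sub>e Sc 45) Skip
           (41[Sc 42] ::= Cell b (Sc 22) ;; 42 ::= Sc 42 \<oplus> Num 1))
         (33[Sc 30 \<otimes> Sc 6 \<oplus> Sc 22] ::= Num 1)))"

definition visit :: "com \<Rightarrow> com" where
  "visit Q = (45 ::= Cell 41 (Sc 43) ;; mark_path ;; mask_path ;; query Q ;;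
     For 22 6 (If (Cell 17 (Sc 22)) (extend 12 13 ;; extend 13 12) Skip) ;; 43 ::= Sc 43 \<oplus> Num 1)"

definition find_branching :: "com \<Rightarrow> com" where
  "find_branching Q = (41[Num 0] ::= Sc 37 ;; 42 ::= Num 1 ;; 43 ::= Num 0 ;;
     While (Sc 43 \<prec> Sc 42) (visit Q))"

lemma writes_mark_path [simp]: "writes mark_path = {22, 44, 46}"
  by (auto simp: mark_path_def)

lemma writes_mask_path [simp]: "writes mask_path = {22, 19}"
  by (auto simp: mask_path_def)

lemma writes_extend [simp]: "writes (extend a b) = {33, 41, 42}"
  by (auto simp: extend_def)

lemma writes_visit [simp]:
  "5 \<le> a \<Longrightarrow> a < 105 \<Longrightarrow> a \<notin> {19, 22, 23, 33, 41, 42, 43, 44, 45, 46} \<Longrightarrow> a \<notin> writes (visit Q)"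
  by (simp add: visit_def)

lemma writes_find_branching [simp]:
  "5 \<le> a \<Longrightarrow> a < 105 \<Longrightarrow> a \<notin> {19, 22, 23, 33, 41, 42, 43, 44, 45, 46} \<Longrightarrow>
    a \<notin> writes (find_branching Q)"
  by (simp add: find_branching_def)

text \<open>\<open>c\<close> is the position of the unsettled pair in the edge list, and
  \<open>L\<close> is the level of the search, which selects the row of array 33.\<close>

locale explore = search I p1 p2 B Q A + branch I F u v par
  for I p1 p2 B Q A F u v par +
  fixes c L :: nat
  assumes triv_F: "triv \<subseteq> F" and c: "c < card (edges I)" "u = p1 c" "v = p2 c"
    and L: "L < card (edges I)"
begin

definition context_ok :: "store \<Rightarrow> bool" where
  "context_ok s \<longleftrightarrow> ready s \<and> flags 29 F s \<and> s 30 0 = L \<and> s 36 0 = c \<and> s 37 0 = u \<and> s 38 0 = v \<and>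
     (\<forall>x<n. s 39 x = dF x) \<and> s 40 = par"

lemma context_cong:
  "context_ok s \<Longrightarrow> (\<And>a. 5 \<le> a \<Longrightarrow> a \<le> 18 \<or> a \<in> {29, 30, 36, 37, 38, 39, 40} \<Longrightarrow> s' a = s a) \<Longrightarrow>
    context_ok s'"
  using ready_cong[of s s'] unfolding context_ok_def flags_def by simp

lemma context_upd [simp]:
  "18 < a \<Longrightarrow> a \<noteq> 29 \<Longrightarrow> a \<noteq> 30 \<Longrightarrow> a < 36 \<or> 40 < a \<Longrightarrow> context_ok (s(a := f)) = context_ok s"
  by (auto intro: context_cong)

lemma contextD:
  assumes "context_ok s"
  shows "inputs s" "flags 17 alive s" "flags 29 F s" "s 30 0 = L" "s 36 0 = c" "s 37 0 = u"
    "s 38 0 = v" "x < n \<Longrightarrow> s 39 x = dF x" "s 40 = par" "s 16 c = dG u v"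
  using assms c unfolding context_ok_def ready_def dists_def by simp_all

lemma par_le: "word_store B s \<Longrightarrow> context_ok s \<Longrightarrow> par y \<le> B"
  using contextD(9)[of s] word_storeD[of B s 40 y] by simp

lemma uv_bounds: "u \<le> B" "v \<le> B" "c \<le> B" "L \<le> B" "n + 1 \<le> B"
  using un vn c(1) L small_bounds bound by linarith+

lemma mark_path_wp:
  assumes "word_store B s" "context_ok s" "s 45 0 = x"
  shows "wp B mark_path (\<lambda>t s'. t \<le> n * 8 + 5 \<and> (\<forall>y<n. s' 44 y = of_bool (y \<in> anc x))) s"
proof -
  let ?c1 = "44[Sc 22] ::= Num 0"
  let ?I1 = "\<lambda>k s'. \<forall>y<k. s' 44 y = 0"
  have l1: "wp B (For 22 5 ?c1) (\<lambda>t s'. t \<le> n * (1 + 2) + 2 \<and> ?I1 n s') s"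
  proof (rule wp_For[where I = ?I1, OF assms(1)])
    fix k s'
    assume a: "k < n" "s' 22 0 = k" "word_store B s'" "?I1 k s'"
    then show "wp B ?c1 (\<lambda>t s'. t \<le> 1 \<and> ?I1 (Suc k) s') s'"
      using small_bounds by (auto simp: less_Suc_eq)
  qed (use inputsD(1)[OF contextD(1)[OF assms(2)]] in auto)
  let ?c2 = "44[Sc 46] ::= Num 1 ;; If (Sc 46 \<noteq>\<^sub>e Sc 37) (46 ::= Cell 40 (Sc 46)) Skip"
  let ?I2 = "\<lambda>k s'. s' 46 0 = (up ^^ k) x \<and>
    (\<forall>y<n. s' 44 y = of_bool (y \<in> (\<lambda>r. (up ^^ r) x) ` {..<k}))"
  have l2: "wp B (For 22 5 ?c2) (\<lambda>t s'. t \<le> n * (3 + 2) + 2 \<and> ?I2 n s') s2"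
    if s2: "word_store B s2" "context_ok s2" "s2 46 0 = x" "?I1 n s2" for s2
  proof (rule wp_For[where I = ?I2, OF s2(1)])
    fix k s'
    assume a: "k < n" "s' 22 0 = k" "word_store B s'"
      "\<And>a. a \<notin> insert 22 (writes ?c2) \<Longrightarrow> s' a = s2 a" "?I2 k s'"
    have i: "context_ok s'" by (rule context_cong[OF s2(2)]) (rule a(4); auto)
    have "(up ^^ k) x \<le> B" using word_storeD[OF a(3), of 46 0] a(5) by simp
    then show "wp B ?c2 (\<lambda>t s'. t \<le> 3 \<and> ?I2 (Suc k) s') s'"
      using a(1,2,3,5) contextD(6,9)[OF i] uv_bounds small_bounds par_le[OF a(3) i]
      by (auto simp: lessThan_Suc up_def)
  qed (use s2 inputsD(1)[OF contextD(1)[OF s2(2)]] in auto)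
  show ?thesis
    unfolding mark_path_def wp_Seq[of B "For 22 5 ?c1"]
    apply (rule wp_conseq[OF l1 assms(1)])
    subgoal premises a for t s1
    proof -
      have i1: "context_ok s1" by (rule context_cong[OF assms(2)]) (rule a(3); auto)
      let ?s2 = "s1(46 := (s1 46)(0 := x))"
      have xB: "x \<le> B" using word_storeD[OF assms(1), of 45 0] assms(3) by simp
      have w2: "word_store B ?s2" using a(2) xB by auto
      have "wp B (For 22 5 ?c2) (\<lambda>t s'. t \<le> n * (3 + 2) + 2 \<and> ?I2 n s') ?s2"
        by (rule l2[OF w2]) (use a(1) i1 in auto)
      then have "wp B (For 22 5 ?c2) (\<lambda>t' s'. t + Suc t' \<le> n * 8 + 5 \<and>
          (\<forall>y<n. s' 44 y = of_bool (y \<in> anc x))) ?s2"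
        by (rule wp_conseq[OF _ w2]) (use a(1) in \<open>auto simp: anc_def\<close>)
      then show ?thesis
        using a(3)[of 45] assms(3) xB small_bounds by (simp add: wp_Seq[of B "46 ::= Sc 45"] del: wp_Seq)
    qed
    done
qed

lemma mask_path_wp:
  assumes "word_store B s" "context_ok s" "\<forall>y<n. s 44 y = of_bool (y \<in> anc x)"
  shows "wp B mask_path (\<lambda>t s'. t \<le> m * 3 + 2 \<and> flags 19 (off x) s') s"
proof -
  let ?c = "19[Sc 22] ::= Cell 17 (Sc 22) \<otimes> (Num 1 \<ominus> Cell 44 (Cell 12 (Sc 22)))
     \<otimes> (Num 1 \<ominus> Cell 44 (Cell 13 (Sc 22)))"
  let ?I = "\<lambda>k s'. \<forall>i<k. s' 19 i = of_bool (e i \<in> off x)"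
  have "wp B mask_path (\<lambda>t s'. t \<le> m * (1 + 2) + 2 \<and> ?I m s') s"
    unfolding mask_path_def
  proof (rule wp_For[where I = ?I, OF assms(1)])
    fix k s'
    assume a: "k < m" "s' 22 0 = k" "word_store B s'"
      "\<And>a. a \<notin> insert 22 (writes ?c) \<Longrightarrow> s' a = s a" "?I k s'"
    have i: "context_ok s'" by (rule context_cong[OF assms(2)]) (rule a(4); auto)
    have "s' 44 (p1 k) = of_bool (p1 k \<in> anc x)" "s' 44 (p2 k) = of_bool (p2 k \<in> anc x)"
      using a(4)[of 44] assms(3) endp[OF a(1)] by auto
    moreover have "s' 17 k = of_bool (e k \<in> alive)"
      using contextD(2)[OF i] a(1) by (simp add: flags_def)
    moreover have "e k \<in> off x \<longleftrightarrow> e k \<in> alive \<and> p1 k \<notin> anc x \<and> p2 k \<notin> anc x"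
      by (auto simp: off_def)
    ultimately show "wp B ?c (\<lambda>t s'. t \<le> 1 \<and> ?I (Suc k) s') s'"
      using a(1,2,3,5) inputsD[OF contextD(1)[OF i]] in_bounds[OF a(1)] small_bounds
      by (auto simp: less_Suc_eq)
  qed (use inputsD(2)[OF contextD(1)[OF assms(2)]] in auto)
  then show ?thesis by (rule wp_conseq[OF _ assms(1)]) (auto simp: flags_def)
qed

lemma index_bound:
  assumes "i < m"
  shows "L * m + i \<le> B" "L * m \<le> B" "\<And>j. j < L * m \<Longrightarrow> j \<noteq> L * m + i"
proof -
  have "Suc L * m \<le> m * m" using L by (intro mult_le_mono1) simp
  then show "L * m + i \<le> B" "L * m \<le> B" using assms small_bounds(2) by simp_all
qed simp

text \<open>The final store is given exactly, so that two calls, one for each direction of an edge,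
  can be composed.\<close>

lemma extend_wp:
  assumes s: "word_store B s" "context_ok s" "s 22 0 = i" "i < m" "s 45 0 = x" "x < n"
    and ab: "s a i = a'" "s b i = b'" "e i = {a', b'}" "a' < n" "b' < n"
    and d: "\<forall>y<n. s 4 (y * n + v) = mdst (off x) y v" and q: "s 42 0 = q" "Suc q \<le> B"
  shows "wp B (extend a b) (\<lambda>t s'. t \<le> 6 \<and> s' =
    (if a' = x \<and> completes x b' then
       if e i \<in> F then if par b' = x then s(41 := (s 41)(q := b'), 42 := (s 42)(0 := Suc q)) else s
       else s(33 := (s 33)(L * m + i := 1))
     else s)) s"
proof -
  note C = contextD[OF s(2)]
  note J = inputsD[OF C(1)]
  have b: "a' \<le> B" "b' \<le> B" "x \<le> B" "i \<le> B" "q \<le> B" using ab(4,5) s(4,6) small_bounds q by linarith+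
  have lB: "l (e i) \<le> Big" using len_le_Big eE[OF s(4)] by blast
  let ?sum = "dF x + l (e i) + mdst (off x) b' v"
  have sum_le: "?sum \<le> 4 * ((m + 1) * Big)"
    using mdst_le[OF un s(6), of F] mdst_le[OF ab(5) vn, of "off x"] lB by simp
  have fitsum: "?sum * den \<le> B" "?sum \<le> B" using den_bound[OF sum_le] dist_bound[OF sum_le] by auto
  then have fit2: "dF x + l (e i) \<le> B" "mdst (off x) b' v \<le> B" "dF x \<le> B" by linarith+
  have f: "s 29 i = of_bool (e i \<in> F)" using C(3) s(4) by (simp add: flags_def)
  have d': "s 4 (b' * n + v) = mdst (off x) b' v" using d ab(5) by simp
  have comp: "completes x b' \<longleftrightarrow> \<not> num * dG u v < ?sum * den" if "a' = x"
    using that ab(3) by (simp add: completes_def not_less)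
  note facts = s ab(1,2) C(4-7,9,10) C(8)[OF s(6)] J(1,2,7,8) J(3,4) J(10)[OF s(4)] b fitsum fit2 f d'
    q uv_bounds small_bounds par_le[OF s(1,2)] in_bounds(3)[OF s(4)] num_bound[OF un vn]
    mat_index[OF ab(5) vn] mat_index'[OF ab(5)] index_bound(1,2)[OF s(4)]
    edge_dist_bounds(5)[OF c(1)] c
  show ?thesis
  proof (cases "a' = x")
    case False
    then have "a' < x \<or> x < a'" by auto
    then show ?thesis
    proof
      assume "a' < x"
      then show ?thesis unfolding extend_def using facts False by simp
    next
      assume "x < a'"
      then show ?thesis unfolding extend_def using facts False by simp
    qed
  next
    case True
    show ?thesis
    proof (cases "completes x b'")
      case False
      then show ?thesis unfolding extend_def using facts True comp by simp
    next
      case c1: True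
      show ?thesis
      proof (cases "e i \<in> F")
        case False
        then show ?thesis unfolding extend_def using facts True comp c1 by simp
      next
        case f1: True
        show ?thesis
        proof (cases "par b' = x")
          case False
          then have "par b' < x \<or> x < par b'" by auto
          then show ?thesis
          proof
            assume "par b' < x"
            then show ?thesis unfolding extend_def using facts True comp c1 f1 False by simp
          next
            assume "x < par b'"
            then show ?thesis unfolding extend_def using facts True comp c1 f1 False by simp
          qed
        next
          case p1: True
          then show ?thesis unfolding extend_def using facts True comp c1 f1 by simp
        qed
      qed
    qed
  qed
qed

section \<open>Exploring the tree with a queue\<close>

definition cand :: "nat set \<Rightarrow> nat \<Rightarrow> bool" where
  "cand X i \<longleftrightarrow> e i \<in> alive \<and> e i \<notin> F \<and> (\<exists>x\<in>X. \<exists>y. e i = {x, y} \<and> completes x y)"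

definition children :: "nat \<Rightarrow> nat \<Rightarrow> nat set" where
  "children x k = {y. \<exists>i<k. e i \<in> F \<and> e i = {x, y} \<and> par y = x \<and> completes x y}"

definition queue :: "nat list \<Rightarrow> store \<Rightarrow> bool" where
  "queue qs s \<longleftrightarrow> s 42 0 = length qs \<and> (\<forall>i<length qs. s 41 i = qs ! i)"

definition marked :: "(nat \<Rightarrow> bool) \<Rightarrow> (nat \<Rightarrow> nat) \<Rightarrow> store \<Rightarrow> bool" where
  "marked P old s \<longleftrightarrow> (\<forall>i<m. s 33 (L * m + i) = of_bool (P i)) \<and> (\<forall>j<L * m. s 33 j = old j)"

lemma marked_upd:
  assumes "marked P old s" "i < m" "\<And>j. j < m \<Longrightarrow> P' j \<longleftrightarrow> P j \<or> j = i"
  shows "marked P' old (s(33 := (s 33)(L * m + i := 1)))"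
  using assms index_bound(3)[OF assms(2)] by (auto simp: marked_def)

text \<open>The first \<open>k\<close> entries have been visited. A vertex other than the root
  enters only when its parent is visited; this clause on \<open>par\<close> excludes repetitions.
  The last clause is the closure that \<open>branching_edge\<close> asks for once \<open>k\<close>
  reaches the length.\<close>

definition progress :: "nat \<Rightarrow> nat list \<Rightarrow> bool" where
  "progress k qs \<longleftrightarrow> k \<le> length qs \<and> distinct qs \<and> u \<in> set qs \<and> (\<forall>x\<in>set qs. reach x) \<and>
     (\<forall>x\<in>set qs. x \<noteq> u \<longrightarrow> par x \<in> set (take k qs)) \<and>
     (\<forall>x\<in>set (take k qs). children x m \<subseteq> set qs)"

text \<open>The entries are distinct members of the neighborhood of a critical pair. Hence a node of
  the search tree makes at most \<open>h\<close> calls for its visits.\<close>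

lemma queue_length: "progress k qs \<Longrightarrow> length qs \<le> h" "progress k qs \<Longrightarrow> length qs \<le> n"
proof -
  assume p: "progress k qs"
  have "x \<in> nbhd u v" if "reach x" for x
    using that tree_path_props last_in_set unfolding reach_def by blast
  then have sub: "set qs \<subseteq> nbhd u v" using p by (auto simp: progress_def)
  have nb: "nbhd u v \<subseteq> {..<n}" by (rule nbhd_sub[OF un vn])
  have "\<not> settled triv u v" using unset settled_mono[OF _ triv_F] by blast
  then have cr: "{u, v} \<in> critical_pairs (preprocess I)" using uv critical_iff by blast
  have "length qs = card (set qs)" using p distinct_card[of qs] by (simp add: progress_def)
  also have le: "\<dots> \<le> card (nbhd u v)" using sub nb finite_subset by (intro card_mono) auto
  finally have "length qs \<le> card (nbhd u v)" .
  then show "length qs \<le> h" using nbhd_size_ge[OF cr] by linarith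
  have "card (nbhd u v) \<le> card {..<n}" using nb by (intro card_mono) auto
  with \<open>length qs \<le> card (nbhd u v)\<close> show "length qs \<le> n" by simp
qed

text \<open>If a child of entry \<open>k\<close> were already queued, its parent, entry
  \<open>k\<close> itself, would be among the first \<open>k\<close> entries, contrary to
  distinctness.\<close>

lemma children_new:
  assumes "progress k qs" "k < length qs" "x = qs ! k" "y \<in> children x j"
  shows "y \<notin> set qs" "reach y" "y \<noteq> u"
proof -
  obtain i where i: "e i \<in> F" "e i = {x, y}" "par y = x" "completes x y"
    using assms(4) by (auto simp: children_def)
  have rx: "reach x" using assms by (auto simp: progress_def)
  have xy: "{x, y} \<in> alive" "{x, y} \<in> F" using i F_sub by auto
  show yu: "y \<noteq> u" using completes_nbhd(3)[OF rx xy(1) i(4)] .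
  show "reach y" using completes_nbhd(5)[OF rx xy(1) i(4,3) xy(2)] .
  show "y \<notin> set qs"
  proof
    assume "y \<in> set qs"
    then have "x \<in> set (take k qs)" using assms(1) yu i(3) by (auto simp: progress_def)
    then obtain j where "j < k" "qs ! j = x" using assms(2) by (auto simp: in_set_conv_nth)
    then have "j = k" using assms(1-3) nth_eq_iff_index_eq[of qs j k] by (simp add: progress_def)
    with \<open>j < k\<close> show False by simp
  qed
qed

lemma extend_loop_wp:
  assumes s: "word_store B s" "context_ok s" "s 45 0 = x" "\<forall>y<n. s 4 (y * n + v) = mdst (off x) y v"
    and pr: "progress k qs" "k < length qs" "x = qs ! k"
    and qm: "queue qs s" "marked (cand X) old s"
  defines "body \<equiv> If (Cell 17 (Sc 22)) (extend 12 13 ;; extend 13 12) Skip"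
  shows "wp B (For 22 6 body) (\<lambda>t s'. t \<le> m * (13 + 2) + 2 \<and>
    (\<exists>ys. queue (qs @ ys) s' \<and> distinct ys \<and> set ys = children x m) \<and>
    marked (cand (insert x X)) old s') s"
proof -
  have xn: "x < n" using pr reach_lt by (auto simp: progress_def)
  \<comment> \<open>After \<open>j\<close> edges, the marks are those inherited from earlier visits
    together with those that \<open>x\<close> contributes from the first \<open>j\<close>
    edges.\<close>
  define mk where "mk j i \<longleftrightarrow> cand X i \<or> (i < j \<and> cand {x} i)" for j i
  let ?I = "\<lambda>j s'. (\<exists>ys. queue (qs @ ys) s' \<and> distinct ys \<and> set ys = children x j) \<and>
    marked (mk j) old s'"
  have "wp B (For 22 6 body) (\<lambda>t s'. t \<le> m * (13 + 2) + 2 \<and> ?I m s') s"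
  proof (rule wp_For[where I = ?I, OF s(1)])
    fix j s'
    assume a: "j < m" "s' 22 0 = j" "word_store B s'"
      "\<And>a. a \<notin> insert 22 (writes body) \<Longrightarrow> s' a = s a" "?I j s'"
    have wb: "writes body = {33, 41, 42}" by (auto simp: body_def)
    have fr: "s' a = s a" if "a \<notin> {22, 33, 41, 42}" for a using a(4)[of a] that wb by auto
    have C: "context_ok s'" by (rule context_cong[OF s(2)]) (rule fr; auto)
    note J = inputsD[OF contextD(1)[OF C]]
    have al: "s' 17 j = of_bool (e j \<in> alive)" using contextD(2)[OF C] a(1) by (simp add: flags_def)
    obtain ys where ys: "queue (qs @ ys) s'" "distinct ys" "set ys = children x j"
      and mj: "marked (mk j) old s'" using a(5) by blast
    have e: "p1 j < n" "p2 j < n" "p1 j \<noteq> p2 j" using endp[OF a(1)] by auto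
    have jB: "j \<le> B" using a(1) small_bounds by linarith
    have ch: "children x (Suc j) = children x j \<union>
        {y. e j \<in> F \<and> e j = {x, y} \<and> par y = x \<and> completes x y}"
      by (auto simp: children_def less_Suc_eq)
    have mkS: "mk (Suc j) i \<longleftrightarrow> mk j i \<or> i = j \<and> cand {x} j" for i
      by (auto simp: mk_def less_Suc_eq)
    \<comment> \<open>The queue holds distinct vertices, so index and length never exceed
      \<open>n\<close> and a word suffices.\<close>
    have lenB: "Suc (length (qs @ ys)) \<le> B"
    proof -
      have "y \<in> {..<n}" if "y \<in> children x j" for y
        using children_new(2)[OF pr that] reach_lt by simp
      moreover have "set qs \<subseteq> {..<n}" using pr(1) reach_lt by (auto simp: progress_def)
      moreover have d: "distinct (qs @ ys)"
        using pr(1) ys children_new(1)[OF pr] by (auto simp: progress_def)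
      ultimately have "card (set (qs @ ys)) \<le> card {..<n}" using ys(3) by (intro card_mono) auto
      then have "length (qs @ ys) \<le> n" using distinct_card[OF d] by simp
      then show ?thesis using uv_bounds(5) by linarith
    qed
    let ?res = "\<lambda>a' b' s. if a' = x \<and> completes x b' then
       if e j \<in> F then if par b' = x then s(41 := (s 41)(length (qs @ ys) := b'), 42 := (s 42)(0 := Suc (length (qs @ ys)))) else s
       else s(33 := (s 33)(L * m + j := 1))
     else s"
    have step: "?I (Suc j) (?res a' b' s')" if al: "e j \<in> alive" and ab: "e j = {a', b'}" "a' = x" for a' b'
    proof -
      have only: "e j = {x, y} \<longleftrightarrow> y = b'" for y using ab e(3) by (auto simp: doubleton_eq_iff)
      show ?thesis
      proof (cases "completes x b'")
        case False
        then have "children x (Suc j) = children x j" "\<not> cand {x} j"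
          unfolding ch cand_def using only by auto
        then show ?thesis using a(5) False mkS by (simp add: marked_def)
      next
        case c: True
        show ?thesis
        proof (cases "e j \<in> F")
          case False
          then have "children x (Suc j) = children x j" "cand {x} j"
            unfolding ch cand_def using c al only by auto
          moreover have "marked (mk (Suc j)) old (s'(33 := (s' 33)(L * m + j := 1)))"
            by (rule marked_upd[OF mj a(1)]) (use calculation mkS in auto)
          ultimately show ?thesis using a(5) False c ab(2) by (simp add: queue_def)
        next
          case f: True
          then have nc: "\<not> cand {x} j" by (simp add: cand_def)
          show ?thesis
          proof (cases "par b' = x")
            case False
            then have "children x (Suc j) = children x j" unfolding ch using only by auto
            then show ?thesis using a(5) False f mkS nc by (simp add: marked_def)
          next
            case p: True
            have "b' \<notin> children x j"
            proof
              assume "b' \<in> children x j"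
              then obtain i where "i < j" "e i = {x, b'}" by (auto simp: children_def)
              then show False using only[of b'] e_inj[of i j] a(1) by simp
            qed
            moreover have "children x (Suc j) = insert b' (children x j)"
              unfolding ch using only f p c by auto
            moreover have "queue (qs @ ys @ [b']) (s'(41 := (s' 41)(length (qs @ ys) := b'), 42 := (s' 42)(0 := Suc (length (qs @ ys)))))"
              using ys(1) by (auto simp: queue_def nth_append less_Suc_eq)
            ultimately have "\<exists>zs. queue (qs @ zs) (s'(41 := (s' 41)(length (qs @ ys) := b'), 42 := (s' 42)(0 := Suc (length (qs @ ys)))))
                \<and> distinct zs \<and> set zs = children x (Suc j)"
              using ys(2,3) by (intro exI[of _ "ys @ [b']"]) auto
            then show ?thesis using mj mkS nc f p c ab(2) by (simp add: marked_def)
          qed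
        qed
      qed
    qed
    have same: "?I (Suc j) s'" if "p1 j \<noteq> x" "p2 j \<noteq> x"
    proof -
      have "e j \<noteq> {x, y}" for y using that by (auto simp: doubleton_eq_iff)
      then have "children x (Suc j) = children x j" "\<not> cand {x} j"
        unfolding ch cand_def by auto
      then show ?thesis using a(5) mkS by (simp add: marked_def)
    qed
    have dj: "\<forall>y<n. s' 4 (y * n + v) = mdst (off x) y v" using fr[of 4] s(4) by simp
    have xj: "s' 45 0 = x" using fr[of 45] s(3) by simp
    have qj: "s' 42 0 = length (qs @ ys)" using ys(1) by (simp add: queue_def)
    show "wp B body (\<lambda>t s'. t \<le> 13 \<and> ?I (Suc j) s') s'"
    proof (cases "e j \<in> alive")
      case False
      then have "children x (Suc j) = children x j" "\<not> cand {x} j"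
        unfolding ch cand_def using F_sub by auto
      then have "?I (Suc j) s'" using a(5) mkS by (simp add: marked_def)
      then show ?thesis unfolding body_def using al False a(2,3) jB by simp
    next
      case al1: True
      have ec: "e j = {p2 j, p1 j}" by blast
      have r1: "wp B (extend 12 13) (\<lambda>t s''. t \<le> 6 \<and> s'' = ?res (p1 j) (p2 j) s') s'"
        by (rule extend_wp[OF a(3) C a(2,1) xj xn J(8)[OF a(1)] J(9)[OF a(1)] refl e(1,2) dj qj lenB])
      have "wp B (extend 12 13 ;; extend 13 12) (\<lambda>t s'. t + 1 \<le> 13 \<and> ?I (Suc j) s') s'"
        unfolding wp_Seq
      proof (rule wp_conseq[OF r1 a(3)])
        fix t :: nat and s''
        assume t: "t \<le> 6 \<and> s'' = ?res (p1 j) (p2 j) s'" and w: "word_store B s''"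
        show "wp B (extend 13 12) (\<lambda>t' s'. t + t' + 1 \<le> 13 \<and> ?I (Suc j) s') s''"
        \<comment> \<open>At most one end of the edge is \<open>x\<close>, so at most one of the two
          calls has an effect.\<close>
        proof (cases "p1 j = x")
          case True
          then have I'': "?I (Suc j) s''" using step[OF al1 refl] t by simp
          have fr'': "s'' a = s' a" if "a \<notin> {33, 41, 42}" for a using t that by auto
          have "s'' 22 0 = j" "s'' 45 0 = x" "s'' 13 j = p2 j"
            using fr'' a(2) xj J(9)[OF a(1)] by simp_all
          moreover have "j \<le> B" "p2 j \<le> B" "x \<le> B" using jB in_bounds[OF a(1)] True by auto
          moreover have "p2 j < x \<or> x < p2 j" using True e(3) by auto
          ultimately have "wp B (extend 13 12) (\<lambda>t' s'. t' = 2 \<and> s' = s'') s''"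
            unfolding extend_def using w small_bounds by auto
          then show ?thesis
          proof (rule wp_conseq[OF _ w])
            fix t' :: nat and s3 assume "t' = 2 \<and> s3 = s''"
            then show "t + t' + 1 \<le> 13 \<and> ?I (Suc j) s3" using I'' t by simp
          qed
        next
          case False
          then have s'': "s'' = s'" using t by simp
          have "wp B (extend 13 12) (\<lambda>t s''. t \<le> 6 \<and> s'' = ?res (p2 j) (p1 j) s') s'"
            by (rule extend_wp[OF a(3) C a(2,1) xj xn J(9)[OF a(1)] J(8)[OF a(1)] ec e(2,1) dj qj lenB])
          then show ?thesis unfolding s''
          proof (rule wp_conseq[OF _ a(3)])
            fix t' :: nat and s3 assume t': "t' \<le> 6 \<and> s3 = ?res (p2 j) (p1 j) s'"
            have "?I (Suc j) s3"
            proof (cases "p2 j = x")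
              case True
              then show ?thesis using step[OF al1 ec] t' by simp
            next
              case F2: False
              then show ?thesis using same False t' by simp
            qed
            then show "t + t' + 1 \<le> 13 \<and> ?I (Suc j) s3" using t t' by simp
          qed
        qed
      qed
      then show ?thesis unfolding body_def using al al1 a(2,3) jB small_bounds by simp
    qed
  next
    have "children x 0 = {}" by (simp add: children_def)
    moreover have "mk 0 = cand X" by (auto simp: mk_def)
    ultimately show "?I 0 s" using qm by (auto intro!: exI[of _ "[]"])
  next
    fix j s' f assume "?I j s'"
    then show "?I j (s'(22 := f))" by (simp add: queue_def marked_def)
  qed (use inputsD(2)[OF contextD(1)[OF s(2)]] in \<open>auto simp: body_def\<close>)
  then show ?thesis
  proof (rule wp_conseq[OF _ s(1)])
    fix t :: nat and s' assume t: "t \<le> m * (13 + 2) + 2 \<and> ?I m s'"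
    have "mk m i \<longleftrightarrow> cand (insert x X) i" if "i < m" for i
      using that by (auto simp: mk_def cand_def)
    then have "marked (cand (insert x X)) old s'" using t by (simp add: marked_def)
    then show "t \<le> m * (13 + 2) + 2 \<and> (\<exists>ys. queue (qs @ ys) s' \<and> distinct ys \<and> set ys = children x m) \<and>
      marked (cand (insert x X)) old s'" using t by blast
  qed
qed

abbreviation "visit_time \<equiv> At + m * 24 + n * 8 + 30"

lemma visit_wp:
  assumes s: "word_store B s" "context_ok s" "s 43 0 = k"
    and pr: "progress k qs" "k < length qs"
    and qm: "queue qs s" "marked (cand (set (take k qs))) old s"
  shows "wp B (visit Q) (\<lambda>t s'. t \<le> visit_time \<and> context_ok s' \<and> s' 43 0 = Suc k \<and>
    (\<exists>qs'. progress (Suc k) qs' \<and> queue qs' s' \<and> marked (cand (set (take (Suc k) qs'))) old s')) s"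
proof -
  define x where "x = qs ! k"
  let ?body = "If (Cell 17 (Sc 22)) (extend 12 13 ;; extend 13 12) Skip"
  let ?P = "\<lambda>s'. context_ok s' \<and> s' 43 0 = Suc k \<and>
    (\<exists>qs'. progress (Suc k) qs' \<and> queue qs' s' \<and> marked (cand (set (take (Suc k) qs'))) old s')"
  have sx: "s 41 k = x" using qm(1) pr(2) by (simp add: queue_def x_def)
  have kB: "k \<le> B" "Suc k \<le> B" using pr(2) queue_length(2)[OF pr(1)] uv_bounds(5) by linarith+
  have xB: "x \<le> B" using word_storeD[OF s(1), of 41 k] sx by simp
  have take: "take (Suc k) (qs @ ys) = take k qs @ [x]" for ys
    using pr(2) by (simp add: take_Suc_conv_app_nth x_def)
  have prog: "progress (Suc k) (qs @ ys)" if ys: "distinct ys" "set ys = children x m" for ys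
  proof -
    note new = children_new[OF pr x_def]
    have "par y = x" if "y \<in> children x m" for y using that by (auto simp: children_def)
    then show ?thesis
      using pr ys new unfolding progress_def take by (auto dest: in_set_takeD)
  qed
  let ?s1 = "s(45 := (s 45)(0 := x))"
  have w1: "word_store B ?s1" using s(1) xB by auto
  have C1: "context_ok ?s1" using s(2) by simp
  have q1: "queue qs ?s1" "marked (cand (set (take k qs))) old ?s1"
    using qm by (simp_all add: queue_def marked_def)
  have "wp B (mark_path ;; mask_path ;; query Q ;; For 22 6 ?body ;; 43 ::= Sc 43 \<oplus> Num 1)
      (\<lambda>t s'. Suc t \<le> visit_time \<and> ?P s') ?s1"
    unfolding wp_Seq[of B mark_path]
    apply (rule wp_conseq[OF mark_path_wp[OF w1 C1, of x] w1])
    subgoal by simp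
    subgoal premises a for t1 s2
    proof -
      have C2: "context_ok s2" by (rule context_cong[OF C1]) (rule a(3); auto)
      have an: "\<forall>y<n. s2 44 y = of_bool (y \<in> anc x)" using a(1) by simp
      show ?thesis
        unfolding wp_Seq[of B mask_path]
        apply (rule wp_conseq[OF mask_path_wp[OF a(2) C2 an] a(2)])
        subgoal premises b for t2 s3
        proof -
          have C3: "context_ok s3" by (rule context_cong[OF C2]) (rule b(3); auto)
          show ?thesis
            unfolding wp_Seq[of B "query Q"]
            apply (rule wp_conseq[OF query_wp[OF b(2) contextD(1)[OF C3] conjunct2[OF b(1)]] b(2)])
            subgoal premises c for t3 s4
            proof -
              have C4: "context_ok s4" by (rule context_cong[OF C3]) (rule c(3); auto)
              have fr: "s4 r = ?s1 r" if "r \<in> {33, 41, 42, 43, 45}" for r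
                using that c(3)[of r] b(3)[of r] a(3)[of r] by auto
              have x4: "s4 45 0 = x" "s4 43 0 = k" using fr s(3) by simp_all
              have q4: "queue qs s4" "marked (cand (set (take k qs))) old s4"
                using q1 fr by (simp_all add: queue_def marked_def)
              have d4: "\<forall>y<n. s4 4 (y * n + v) = mdst (off x) y v" using c(1) vn by simp
              show ?thesis
                unfolding wp_Seq[of B "For 22 6 ?body"]
                apply (rule wp_conseq[OF extend_loop_wp[OF c(2) C4 x4(1) d4 pr x_def q4] c(2)])
                subgoal premises d for t4 s5
                proof -
                  have C5: "context_ok s5" by (rule context_cong[OF C4]) (rule d(3); auto)
                  have k5: "s5 43 0 = k" using d(3)[of 43] x4(2) by simp
                  obtain ys where ys: "queue (qs @ ys) s5" "distinct ys" "set ys = children x m"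
                    and mk: "marked (cand (insert x (set (take k qs)))) old s5" using d(1) by blast
                  let ?s6 = "s5(43 := (s5 43)(0 := Suc k))"
                  have "queue (qs @ ys) ?s6" using ys(1) by (simp add: queue_def)
                  moreover have "marked (cand (set (take (Suc k) (qs @ ys)))) old ?s6"
                    using mk unfolding take by (simp add: marked_def)
                  ultimately have "?P ?s6" using C5 prog[OF ys(2,3)] by auto
                  moreover have "Suc (t1 + (t2 + (t3 + (t4 + 1)))) \<le> visit_time"
                    using a(1) b(1) c(1) d(1) by simp
                  ultimately show ?thesis using k5 kB small_bounds d(2) by simp
                qed
                done
            qed
            done
        qed
        done
    qed
    done
  then show ?thesis
    unfolding visit_def wp_Seq[of B "45 ::= x" for x]
    using sx s(3) kB xB small_bounds by (simp del: wp_Seq)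
qed

text \<open>Every visit advances the head, and the queue has at most \<open>h\<close> entries, so
  \<open>h - k\<close> bounds the visits that are still to come.\<close>

lemma visit_loop_wp:
  assumes "word_store B s" "context_ok s" "s 43 0 = k" "progress k qs" "queue qs s"
    "marked (cand (set (take k qs))) old s"
  shows "wp B (While (Sc 43 \<prec> Sc 42) (visit Q)) (\<lambda>t s'. t \<le> (h - k) * (visit_time + 1) + 1 \<and>
    (\<exists>qs'. progress (length qs') qs' \<and> marked (cand (set qs')) old s')) s"
  using assms
proof (induction "h - k" arbitrary: s k qs rule: less_induct)
  case less
  have s42: "s 42 0 = length qs" using less.prems(5) by (simp add: queue_def)
  have kl: "k \<le> length qs" using less.prems(4) by (simp add: progress_def)
  have lh: "length qs \<le> h" "length qs \<le> n" using queue_length[OF less.prems(4)] by auto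
  have b: "s 43 0 \<le> B" "s 42 0 \<le> B" "1 \<le> B" using less.prems(1) small_bounds by auto
  show ?case
  proof (cases "k = length qs")
    case True
    then have "exec B (While (Sc 43 \<prec> Sc 42) (visit Q)) s 1 s"
      using s42 less.prems(3) b by (intro exec.While_False) auto
    then show ?thesis unfolding wp_def using less.prems(4,6) True by auto
  next
    case False
    then have k: "k < length qs" using kl by simp
    obtain t1 s1 qs1 where e1: "exec B (visit Q) s t1 s1" "t1 \<le> visit_time"
      and s1: "context_ok s1" "s1 43 0 = Suc k" "progress (Suc k) qs1" "queue qs1 s1"
        "marked (cand (set (take (Suc k) qs1))) old s1"
      using visit_wp[OF less.prems(1-4) k less.prems(5,6)] unfolding wp_def by blast
    have "h - Suc k < h - k" using k lh by simp
    from less.hyps[OF this exec_word_store[OF e1(1) less.prems(1)] s1]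
    obtain t2 s2 where e2: "exec B (While (Sc 43 \<prec> Sc 42) (visit Q)) s1 t2 s2"
      "t2 \<le> (h - Suc k) * (visit_time + 1) + 1"
      and r: "\<exists>qs'. progress (length qs') qs' \<and> marked (cand (set qs')) old s2"
      unfolding wp_def by blast
    have "exec B (While (Sc 43 \<prec> Sc 42) (visit Q)) s (t1 + t2 + 1) s2"
      by (rule exec.While_True[OF _ _ e1(1) e2(1)]) (use s42 less.prems(3) b k in auto)
    moreover have "t1 + t2 + 1 \<le> (h - k) * (visit_time + 1) + 1"
    proof -
      have "h - k = Suc (h - Suc k)" using k lh by simp
      then show ?thesis using e1(2) e2(2) by simp
    qed
    ultimately show ?thesis using r unfolding wp_def by blast
  qed
qed

text \<open>Candidates are distinct two-element subsets of the neighborhood. The factor 2 on the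
  left keeps the gain of one half without a division.\<close>

lemma card_cand:
  assumes "progress k qs"
  shows "2 * card {i. i < m \<and> cand (set qs) i} \<le> h * h"
proof -
  let ?C = "{i. i < m \<and> cand (set qs) i}" and ?N = "nbhd u v"
  have fin: "finite ?N" using nbhd_sub[OF un vn] finite_subset by blast
  have "e i \<in> {T. T \<subseteq> ?N \<and> card T = 2}" if i: "i \<in> ?C" for i
  proof -
    obtain x y where xy: "x \<in> set qs" "e i = {x, y}" "completes x y" "{x, y} \<in> alive"
      using i by (auto simp: cand_def)
    have "reach x" using assms xy(1) by (auto simp: progress_def)
    then have "x \<in> ?N" "y \<in> ?N" using completes_nbhd(1,2) xy by blast+
    then show ?thesis using xy(2,4) alive_edge[OF xy(4)] by auto
  qed
  moreover have "inj_on e ?C" using e_inj by (auto intro: inj_onI)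
  moreover have "finite {T. T \<subseteq> ?N \<and> card T = 2}" using fin by simp
  ultimately have "card ?C \<le> card {T. T \<subseteq> ?N \<and> card T = 2}"
    by (intro card_inj_on_le[of e]) auto
  also have "\<dots> = card ?N choose 2" by (rule n_subsets[OF fin])
  finally have "2 * card ?C \<le> card ?N * (card ?N - 1)"
    by (simp add: choose_two)
  also have "\<dots> \<le> h * h"
  proof -
    have "\<not> settled triv u v" using unset settled_mono[OF _ triv_F] by blast
    then have "card ?N \<le> h" using uv critical_iff nbhd_size_ge by blast
    then show ?thesis by (intro mult_le_mono) auto
  qed
  finally show ?thesis .
qed

lemma find_branching_wp:
  assumes "word_store B s" "context_ok s" "marked (\<lambda>_. False) old s"
  shows "wp B (find_branching Q) (\<lambda>t s'. t \<le> h * (visit_time + 1) + 4 \<and>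
    (\<exists>C. C \<subseteq> {..<m} \<and> marked (\<lambda>i. i \<in> C) old s' \<and> 2 * card C \<le> h * h \<and>
      (\<forall>i\<in>C. e i \<in> alive \<and> e i \<notin> F) \<and>
      (\<forall>H. F \<subseteq> H \<longrightarrow> H \<subseteq> alive \<longrightarrow> settled H u v \<longrightarrow> (\<exists>i\<in>C. e i \<in> H)))) s"
    (is "wp B _ (\<lambda>t s'. _ \<and> ?P s') s")
proof -
  let ?s1 = "s(41 := (s 41)(0 := u), 42 := (s 42)(0 := 1), 43 := (s 43)(0 := 0))"
  have w1: "word_store B ?s1" using assms(1) uv_bounds small_bounds by auto
  have C1: "context_ok ?s1" using assms(2) by simp
  have p: "progress 0 [u]" using reach_root by (simp add: progress_def)
  have q: "queue [u] ?s1" by (simp add: queue_def)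
  have k: "?s1 43 0 = 0" by simp
  have mk: "marked (cand (set (take 0 [u]))) old ?s1"
    using assms(3) by (simp add: marked_def cand_def)
  have "wp B (While (Sc 43 \<prec> Sc 42) (visit Q)) (\<lambda>t s'. Suc (Suc (Suc t)) \<le> h * (visit_time + 1) + 4 \<and> ?P s') ?s1"
    apply (rule wp_conseq[OF visit_loop_wp[OF w1 C1 k p q mk] w1])
    subgoal premises a for t s'
    proof -
      obtain qs where qs: "progress (length qs) qs" "marked (cand (set qs)) old s'" using a(1) by blast
      let ?C = "{i. i < m \<and> cand (set qs) i}"
      have 1: "marked (\<lambda>i. i \<in> ?C) old s'" using qs(2) by (simp add: marked_def)
      have 2: "\<exists>i\<in>?C. e i \<in> H" if H: "F \<subseteq> H" "H \<subseteq> alive" "settled H u v" for H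
      proof -
        \<comment> \<open>When the loop ends all entries have been visited, so the queue contains
          all children that pass the test and can serve as the set \<open>Q\<close> of
          \<open>branching_edge\<close>.\<close>
        have "y \<in> set qs" if x: "x \<in> set qs" and xy: "{x, y} \<in> F" "par y = x" "completes x y" for x y
        proof -
          obtain i where "i < m" "e i = {x, y}" using xy(1) FE e_surj by (metis subsetD)
          then have "y \<in> children x m" unfolding children_def using xy by auto
          then show ?thesis using qs(1) x by (auto simp: progress_def)
        qed
        then obtain x y where xy: "x \<in> set qs" "{x, y} \<in> H" "{x, y} \<notin> F" "completes x y"
          using branching_edge[OF H, of "set qs"] qs(1) unfolding progress_def by blast
        then obtain i where i: "i < m" "{x, y} = e i" using H(2) alive_sub e_surj by blast
        have "cand (set qs) i"
          unfolding cand_def using xy H(2) unfolding i(2)[symmetric] by blast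
        then show ?thesis using xy(2) i by auto
      qed
      have "?P s'"
      proof (intro exI[of _ ?C] conjI)
        show "\<forall>i\<in>?C. e i \<in> alive \<and> e i \<notin> F" by (simp add: cand_def)
      qed (use 1 2 card_cand[OF qs(1)] in blast)+
      then show ?thesis using a(1) by simp
    qed
    done
  then show ?thesis
    unfolding find_branching_def wp_Seq[of B "41[x] ::= y" for x y] wp_Seq[of B "42 ::= x" for x]
      wp_Seq[of B "43 ::= x" for x]
    using contextD(6)[OF assms(2)] uv_bounds small_bounds by (simp del: wp_Seq)
qed

end

section \<open>The search tree\<close>

text \<open>Array 32 holds the next candidate position of every level. While 34 is set the search goes
  on; 35 is set when a new node of the search tree has been entered.\<close>

definition process_node :: "com \<Rightarrow> com" where
  "process_node Q = (build_edges ;; find_unsettled Q ;; 35 ::= Num 0 ;;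
     If (Sc 36 \<prec> Sc 6)
       (If (Sc 30 \<prec> Sc 10) (init_branch ;; find_branching Q ;; 32[Sc 30] ::= Num 0)
         (32[Sc 30] ::= Sc 6))
       (check_weight ;; (If (Sc 28) (34 ::= Num 0) Skip ;; 32[Sc 30] ::= Sc 6)))"

text \<open>One move of a depth-first traversal with an explicit stack: enter a marked candidate,
  pass over an unmarked one, return to the previous level, or stop at level 0.\<close>

definition advance :: com where
  "advance = If (Cell 32 (Sc 30) \<prec> Sc 6)
     (If (Cell 33 (Sc 30 \<otimes> Sc 6 \<oplus> Cell 32 (Sc 30)))
       (31[Sc 30] ::= Cell 32 (Sc 30) ;; 32[Sc 30] ::= Cell 32 (Sc 30) \<oplus> Num 1 ;;
         30 ::= Sc 30 \<oplus> Num 1 ;; 35 ::= Num 1)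
       (32[Sc 30] ::= Cell 32 (Sc 30) \<oplus> Num 1))
     (If (Num 0 \<prec> Sc 30) (30 ::= Sc 30 \<ominus> Num 1) (34 ::= Num 0))"

definition search_step :: "com \<Rightarrow> com" where
  "search_step Q = If (Sc 35) (process_node Q) advance"

lemma writes_process_node [simp]: "5 \<le> a \<Longrightarrow> a < 19 \<or> a \<in> {30, 31} \<Longrightarrow> a \<notin> writes (process_node Q)"
  by (auto simp: process_node_def)

lemma writes_advance [simp]: "writes advance = {30, 31, 32, 34, 35}"
  by (auto simp: advance_def)

lemma writes_search_step [simp]: "5 \<le> a \<Longrightarrow> a < 19 \<Longrightarrow> a \<notin> writes (search_step Q)"
  by (simp add: search_step_def)

context search
begin

section \<open>A single node of the search tree\<close>

definition chosen :: "nat list \<Rightarrow> nat set set" where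
  "chosen cs = triv \<union> e ` set cs"

definition valid_choice :: "nat list \<Rightarrow> bool" where
  "valid_choice cs \<longleftrightarrow> distinct cs \<and> set cs \<subseteq> {..<m} \<and> (\<forall>i\<in>set cs. e i \<in> alive \<and> e i \<notin> triv) \<and>
     length cs \<le> mu I"

definition at_level :: "nat list \<Rightarrow> store \<Rightarrow> bool" where
  "at_level cs s \<longleftrightarrow> word_store B s \<and> ready s \<and> s 30 0 = length cs \<and>
     (\<forall>k<length cs. s 31 k = cs ! k) \<and> s 28 0 = 0 \<and> s 34 0 = 1"

definition marks :: "nat set \<Rightarrow> nat \<Rightarrow> store \<Rightarrow> bool" where
  "marks C L s \<longleftrightarrow> (\<forall>i<m. s 33 (L * m + i) = of_bool (i \<in> C))"

text \<open>The frame condition of the recursion: handling a node leaves the candidate positions and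
  marks of its proper ancestors intact.\<close>

definition same_below :: "nat \<Rightarrow> store \<Rightarrow> store \<Rightarrow> bool" where
  "same_below L s s' \<longleftrightarrow> (\<forall>k<L. s' 32 k = s 32 k) \<and> (\<forall>j<L * m. s' 33 j = s 33 j)"

definition found :: "store \<Rightarrow> bool" where
  "found s \<longleftrightarrow> s 34 0 = 0 \<and> s 28 0 = 1 \<and> (\<exists>H. good H)"

lemma chosen_props:
  assumes "valid_choice cs"
  shows "chosen cs \<subseteq> alive" "card (chosen cs - triv) = length cs" "length cs \<le> m"
proof -
  show "chosen cs \<subseteq> alive" using assms triv_sub by (auto simp: chosen_def valid_choice_def)
  have "chosen cs - triv = e ` set cs" using assms by (auto simp: chosen_def valid_choice_def)
  moreover have "inj_on e (set cs)" using assms e_inj by (auto simp: valid_choice_def intro!: inj_onI)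
  ultimately show "card (chosen cs - triv) = length cs"
    using assms distinct_card[of cs] by (simp add: card_image valid_choice_def)
  have "card (set cs) \<le> card {..<m}" using assms by (intro card_mono) (auto simp: valid_choice_def)
  then show "length cs \<le> m" using assms distinct_card[of cs] by (simp add: valid_choice_def)
qed

text \<open>A chosen edge settles its own ends, so an unsettled pair is an edge not yet chosen. This
  keeps the row index of array 33 below \<open>m\<close>.\<close>

lemma chosen_lt:
  assumes "valid_choice cs" "c < m" "e c \<in> alive" "\<not> settled (chosen cs) (p1 c) (p2 c)"
  shows "length cs < m"
proof -
  have "e c \<notin> chosen cs" using settled_edge[of "p1 c" "p2 c"] assms(3,4) by blast
  then have "c \<notin> set cs" by (auto simp: chosen_def)
  then have "card (insert c (set cs)) = Suc (length cs)"
    using assms(1) distinct_card[of cs] by (simp add: valid_choice_def)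
  moreover have "card (insert c (set cs)) \<le> card {..<m}"
    using assms(1,2) by (intro card_mono) (auto simp: valid_choice_def)
  ultimately show ?thesis by simp
qed

text \<open>At depth \<open>mu\<close> the only call of \<open>Q\<close> is the one in
  \<open>find_unsettled\<close>; the \<open>h\<close> further calls of the exploration arise at
  smaller depth only.\<close>

definition node_time :: "nat \<Rightarrow> nat" where
  "node_time L = (if L < mu I then 130 * h * At else 80 * At)"

text \<open>The outcome of a node that is not itself a solution. \<open>C\<close> meets every good
  superset of the chosen edges; \<open>C = {}\<close>, encoded by position \<open>m\<close>, thus
  says that there is none.\<close>

definition expanded :: "nat list \<Rightarrow> store \<Rightarrow> store \<Rightarrow> bool" where
  "expanded cs s s' \<longleftrightarrow> at_level cs s' \<and> s' 35 0 = 0 \<and> same_below (length cs) s s' \<and>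
     (\<exists>C. C \<subseteq> {..<m} \<and> (s' 32 (length cs) = m \<and> C = {} \<or>
           s' 32 (length cs) = 0 \<and> length cs < mu I \<and> length cs < m \<and> marks C (length cs) s') \<and>
        2 * card C \<le> h * h \<and> (\<forall>i\<in>C. e i \<in> alive \<and> e i \<notin> chosen cs) \<and>
        (\<forall>H. good H \<longrightarrow> chosen cs \<subseteq> H \<longrightarrow> (\<exists>i\<in>C. e i \<in> H)))"

lemma at_levelD:
  assumes "at_level cs s"
  shows "word_store B s" "ready s" "inputs s" "s 30 0 = length cs" "\<And>k. k < length cs \<Longrightarrow> s 31 k = cs ! k"
    "s 28 0 = 0" "s 34 0 = 1"
  using assms by (auto simp: at_level_def ready_def)

lemma branching_step_wp:
  assumes s: "at_level cs s" "flags 29 (chosen cs) s" "matrix (chosen cs) s" "valid_choice cs"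
    and c: "s 36 0 = c" "c < m" "e c \<in> alive" "\<not> settled (chosen cs) (p1 c) (p2 c)"
    and L: "length cs < mu I" and h2: "2 \<le> h" and e: "s 35 0 = 0"
  shows "wp B (init_branch ;; find_branching Q ;; 32[Sc 30] ::= Num 0)
    (\<lambda>t s'. t \<le> 16 * At + 20 * At + h * (64 * At) \<and> expanded cs s s') s"
proof -
  let ?F = "chosen cs" and ?L = "length cs"
  note F = chosen_props[OF s(4)]
  have Lm: "?L < m" by (rule chosen_lt[OF s(4) c(2-4)])
  note S = at_levelD[OF s(1)]
  show ?thesis
    unfolding wp_Seq[of B init_branch]
    apply (rule wp_conseq[OF init_branch_wp[OF S(1,2) s(2) F(1) s(3) c(1,2) S(4) Lm] S(1)])
    subgoal premises a for t s1
    proof -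
      have uvc: "{p1 c, p2 c} \<in> alive" using c(3) .
      have tF: "triv \<subseteq> ?F" by (simp add: chosen_def)
      interpret ex: explore I p1 p2 B Q A ?F "p1 c" "p2 c" "s1 40" c ?L
        by unfold_locales (use F(1) c a(1) tF Lm in auto)
      have fr: "s1 r = s r" if "r \<notin> {22, 33, 37, 38, 39, 40}" for r using a(3) that by simp
      have ctx: "ex.context_ok s1"
        unfolding ex.context_ok_def
        using ready_cong[OF S(2), of s1] fr a(1) s(2) S(4) c(1) by (simp add: flags_def)
      have mk: "ex.marked (\<lambda>_. False) (s 33) s1" using a(1) by (simp add: ex.marked_def)
      show ?thesis
        unfolding wp_Seq[of B "find_branching Q"]
        apply (rule wp_conseq[OF ex.find_branching_wp[OF a(2) ctx mk] a(2)])
        subgoal premises b for t1 s2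
        proof -
          obtain C where C: "C \<subseteq> {..<m}" "ex.marked (\<lambda>i. i \<in> C) (s 33) s2" "2 * card C \<le> h * h"
            "\<forall>i\<in>C. e i \<in> alive \<and> e i \<notin> ?F"
            "\<And>H. ?F \<subseteq> H \<Longrightarrow> H \<subseteq> alive \<Longrightarrow> settled H (p1 c) (p2 c) \<Longrightarrow> \<exists>i\<in>C. e i \<in> H"
            using b(1) by blast
          have fr2: "s2 r = s r" if "5 \<le> r" "r < 105"
            "r \<notin> {19, 22, 23, 33, 37, 38, 39, 40, 41, 42, 43, 44, 45, 46}" for r
            using b(3)[of r] fr[of r] that by auto
          let ?s3 = "s2(32 := (s2 32)(?L := 0))"
          have w3: "word_store B ?s3" using b(2) by auto
          have rd: "ready ?s3" by (rule ready_cong[OF S(2)]) (simp add: fr2)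
          have al: "at_level cs ?s3" using w3 rd S fr2 by (simp add: at_level_def)
          have sb: "same_below ?L s ?s3"
            using C(2) fr2[of 32] by (simp add: same_below_def ex.marked_def)
          have mk3: "marks C ?L ?s3" using C(2) by (simp add: marks_def ex.marked_def)
          have st: "settled H (p1 c) (p2 c)" if "good H" for H
            using that c(3) by (simp add: good_def settles_all_def)
          have "expanded cs s ?s3"
            unfolding expanded_def
            using al sb fr2[of 35] e C L Lm mk3 st
            by (auto intro!: exI[of _ C] simp: good_def)
          moreover have "t + (t1 + 1) \<le> 16 * At + 20 * At + h * (64 * At)"
          proof -
            \<comment> \<open>\<open>m\<close>, \<open>n\<close> and 1 are each at most
              \<open>At\<close>, and the coefficients add up to 1 + 24 + 8 + 30 + 1 = 64.\<close>
            have "ex.visit_time + 1 \<le> 64 * At" using small_At by linarith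
            then have "h * (ex.visit_time + 1) \<le> h * (64 * At)" by (rule mult_le_mono2)
            then show ?thesis using a(1) b(1) small_At by linarith
          qed
          moreover have "s2 30 0 = ?L" "?L \<le> B" using fr2[of 30] S(4) Lm small_bounds by auto
          ultimately show ?thesis by simp
        qed
        done
    qed
    done
qed

lemma process_node_wp:
  assumes s: "at_level cs s" "valid_choice cs" and h2: "2 \<le> h"
  shows "wp B (process_node Q) (\<lambda>t s'. t \<le> node_time (length cs) \<and> (found s' \<or> expanded cs s s')) s"
proof -
  let ?F = "chosen cs" and ?L = "length cs"
  note F = chosen_props[OF s(2)]
  have FE: "?F \<subseteq> E" using F(1) alive_sub by blast
  note S = at_levelD[OF s(1)]
  have sub: "set cs \<subseteq> {..<m}" using s(2) by (simp add: valid_choice_def)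
  have LB: "?L \<le> B" using F(3) small_bounds by linarith
  let ?rest = "If (Sc 36 \<prec> Sc 6)
       (If (Sc 30 \<prec> Sc 10) (init_branch ;; find_branching Q ;; 32[Sc 30] ::= Num 0)
         (32[Sc 30] ::= Sc 6))
       (check_weight ;; (If (Sc 28) (34 ::= Num 0) Skip ;; 32[Sc 30] ::= Sc 6))"
  \<comment> \<open>Building the edge set and searching for an unsettled pair are charged
    \<open>50 * At\<close>. Terms without the factor \<open>h\<close> are absorbed by
    \<open>2 * At <= h * At\<close>.\<close>
  have nt: "78 * At + 2 \<le> node_time ?L" "?L < mu I \<Longrightarrow> 50 * At + (16 * At + 20 * At + h * (64 * At)) + 2 \<le> node_time ?L"
  proof -
    have "2 * At \<le> h * At" using h2 by simp
    moreover have "130 * h * At = 130 * (h * At)" "h * (64 * At) = 64 * (h * At)" by simp_all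
    ultimately show "78 * At + 2 \<le> node_time ?L"
      "?L < mu I \<Longrightarrow> 50 * At + (16 * At + 20 * At + h * (64 * At)) + 2 \<le> node_time ?L"
      using small_At(1) unfolding node_time_def by (simp, linarith)+
  qed
  have rest: "wp B ?rest (\<lambda>t s'. 50 * At + t \<le> node_time ?L \<and> (found s' \<or> expanded cs s s')) s3"
    if s3: "word_store B s3" "matrix ?F s3" "flags 29 ?F s3" "s3 35 0 = 0"
      "s3 36 0 = m \<and> settles_all ?F \<or>
        s3 36 0 < m \<and> e (s3 36 0) \<in> alive \<and> \<not> settled ?F (p1 (s3 36 0)) (p2 (s3 36 0))"
      and fr: "\<And>r. 5 \<le> r \<Longrightarrow> r < 105 \<Longrightarrow> r \<notin> {19, 22, 23, 29, 35, 36} \<Longrightarrow> s3 r = s r" for s3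
  proof -
    have rd: "ready s3" by (rule ready_cong[OF S(2)]) (simp add: fr)
    have i: "inputs s3" using rd by (simp add: ready_def)
    have al: "at_level cs s3" using s3(1) rd S fr by (simp add: at_level_def)
    have ex: "expanded cs s s'" if "expanded cs s3 s'" for s'
      using that fr[of 32] fr[of 33] by (simp add: expanded_def same_below_def)
    note f = inputsD(2,6)[OF i] at_levelD[OF al] LB small_bounds
    show ?thesis
    proof (cases "s3 36 0 < m")
      case True
      then have c: "e (s3 36 0) \<in> alive" "\<not> settled ?F (p1 (s3 36 0)) (p2 (s3 36 0))" using s3(5) by auto
      have cB: "s3 36 0 \<le> B" using True small_bounds by linarith
      show ?thesis
      proof (cases "?L < mu I")
        case L: True
        have "wp B (init_branch ;; find_branching Q ;; 32[Sc 30] ::= Num 0)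
            (\<lambda>t s'. 50 * At + (t + 1 + 1) \<le> node_time ?L \<and> (found s' \<or> expanded cs s s')) s3"
          by (rule wp_conseq[OF branching_step_wp[OF al s3(3,2) s(2) refl True c L h2 s3(4)] s3(1)])
            (use nt(2)[OF L] ex in auto)
        then show ?thesis
          using True L f cB by (simp del: wp_Seq)
      next
        case L: False
        then have Lmu: "?L = mu I" using s(2) by (simp add: valid_choice_def)
        let ?s4 = "s3(32 := (s3 32)(?L := m))"
        have no: "\<not> (good H \<and> ?F \<subseteq> H)" for H
        proof
          assume H: "good H \<and> ?F \<subseteq> H"
          have "H = ?F" by (rule good_full) (use H F(2) Lmu in \<open>auto simp: chosen_def\<close>)
          then have "settles_all ?F" using H by (simp add: good_def)
          then show False using c by (simp add: settles_all_def)
        qed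
        have w4: "word_store B ?s4" using s3(1) small_bounds by auto
        have "ready ?s4" by (rule ready_cong[OF rd]) simp
        then have "at_level cs ?s4" using w4 al by (simp add: at_level_def)
        then have "expanded cs s ?s4"
          unfolding expanded_def
          using s3(4) no fr[of 32] fr[of 33] by (auto simp: same_below_def intro!: exI[of _ "{}"])
        moreover have "50 * At + 3 \<le> node_time ?L" using nt(1) small_At(1) by linarith
        ultimately show ?thesis
          using True L f cB by simp
      qed
    next
      case False
      then have m36: "s3 36 0 = m" and sa: "settles_all ?F" using s3(5) by auto
      have gl: "(\<exists>H. good H \<and> ?F \<subseteq> H) \<longleftrightarrow> sum (weight I) ?F \<le> budget I"
        by (rule good_leaf) (use F sa s(2) in \<open>auto simp: chosen_def valid_choice_def\<close>)
      have "wp B (check_weight ;; (If (Sc 28) (34 ::= Num 0) Skip ;; 32[Sc 30] ::= Sc 6))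
          (\<lambda>t s'. 50 * At + (t + 1) \<le> node_time ?L \<and> (found s' \<or> expanded cs s s')) s3"
        unfolding wp_Seq[of B check_weight]
        apply (rule wp_conseq[OF check_weight_wp[OF s3(1) i s3(3) FE] s3(1)])
        subgoal premises a for t s4
        proof -
          have fr4: "s4 r = s3 r" if "r \<notin> {23, 27, 28}" for r using a(3) that by simp
          have tm: "50 * At + Suc (t + 4) \<le> node_time ?L" using a(1) nt(1) small_At by linarith
          show ?thesis
          proof (cases "sum (weight I) ?F \<le> budget I")
            case True
            let ?s5 = "s4(34 := (s4 34)(0 := 0), 32 := (s4 32)(?L := m))"
            have "found ?s5" using True a(1) gl by (auto simp: found_def)
            then show ?thesis using True a(1,2) fr4 f tm by simp
          next
            case F: False
            let ?s5 = "s4(32 := (s4 32)(?L := m))"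
            have w: "word_store B ?s5" using a(2) small_bounds by auto
            have "ready ?s5" by (rule ready_cong[OF rd]) (simp add: fr4)
            then have "at_level cs ?s5" using w al a(1) F fr4 by (simp add: at_level_def)
            then have "expanded cs s ?s5"
              unfolding expanded_def
              using s3(4) F gl fr[of 32] fr[of 33] fr4[of 32] fr4[of 33] fr4[of 35]
              by (auto simp: same_below_def intro!: exI[of _ "{}"])
            then show ?thesis using F a(1,2) fr4 f tm by simp
          qed
        qed
        done
      then show ?thesis using m36 f by (simp del: wp_Seq)
    qed
  qed
  show ?thesis
    unfolding process_node_def wp_Seq[of B build_edges]
    apply (rule wp_conseq[OF build_edges_wp[OF S(1,2,4,5) sub] S(1)])
    subgoal by simp
    subgoal premises a for t s1
    proof -
      have fr1: "s1 r = s r" if "r \<notin> {22, 23, 29}" for r using a(3) that by simp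
      have rd1: "ready s1" by (rule ready_cong[OF S(2)]) (simp add: fr1)
      have f1: "flags 29 ?F s1" using a(1) by (simp add: chosen_def)
      show ?thesis
        unfolding wp_Seq[of B "find_unsettled Q"]
        apply (rule wp_conseq[OF find_unsettled_wp[OF a(2) rd1 f1 FE] a(2)])
        subgoal premises b for t1 s2
        proof -
          let ?s3 = "s2(35 := (s2 35)(0 := 0))"
          have w3: "word_store B ?s3" using b(2) by auto
          have fr2: "s2 r = s1 r" if "5 \<le> r" "r < 105" "r \<notin> {19, 22, 23, 36}" for r using b(3) that by simp
          have "wp B ?rest (\<lambda>t s'. 50 * At + t \<le> node_time ?L \<and> (found s' \<or> expanded cs s s')) ?s3"
            by (rule rest[OF w3])
              (use b(1) f1 fr1 fr2 in \<open>simp_all add: flags_def matrix_def unsettled_at_def\<close>)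
          then have "wp B ?rest (\<lambda>t' s'. t + (t1 + Suc t') \<le> node_time ?L \<and> (found s' \<or> expanded cs s s')) ?s3"
            by (rule wp_conseq[OF _ w3]) (use a(1) b(1) F(3) small_At in auto)
          then show ?thesis
            unfolding wp_Seq[of B "35 ::= Num 0"] by (simp del: wp_Seq wp_If)
        qed
        done
    qed
    done
qed

end

definition run_search :: "com \<Rightarrow> com" where
  "run_search Q = (30 ::= Num 0 ;; 28 ::= Num 0 ;; 34 ::= Num 1 ;; 35 ::= Num 1 ;;
     While (Sc 34) (search_step Q))"

context search
begin

section \<open>Traversal of the search tree\<close>

abbreviation reaches :: "store \<Rightarrow> nat \<Rightarrow> store \<Rightarrow> bool" where
  "reaches \<equiv> iters B (Sc 34) (search_step Q)"

text \<open>The subtree below \<open>cs\<close> has been searched in vain; position \<open>m\<close>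
  makes the next move leave this level.\<close>

definition exhausted :: "nat list \<Rightarrow> store \<Rightarrow> store \<Rightarrow> bool" where
  "exhausted cs s s' \<longleftrightarrow> at_level cs s' \<and> s' 35 0 = 0 \<and> s' 32 (length cs) = m \<and>
     same_below (length cs) s s' \<and> \<not> (\<exists>H. good H \<and> chosen cs \<subseteq> H)"

text \<open>The two additional steps are the loop test and the test of array 35.\<close>

lemma reaches_advance:
  assumes "at_level cs s" "s 35 0 = 0" "wp B advance (\<lambda>t s'. t \<le> 6 \<and> P s') s"
  shows "\<exists>t s'. reaches s t s' \<and> t \<le> 8 \<and> P s'"
proof -
  note S = at_levelD[OF assms(1)]
  obtain t s' where a: "exec B advance s t s'" "t \<le> 6" "P s'" using assms(3) unfolding wp_def by blast
  have "exec B (search_step Q) s (t + 1) s'"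
    unfolding search_step_def by (rule exec.If_False[OF _ _ a(1)]) (use assms(2) S in auto)
  from iters_step[OF _ _ this iters_refl] have "reaches s (t + 1 + 0 + 1) s'"
    using S small_bounds by simp
  with a show ?thesis by (intro exI[of _ "t + 1 + 0 + 1"] exI[of _ s']) auto
qed

lemma reaches_node:
  assumes "at_level cs s" "s 35 0 = 1" "wp B (process_node Q) (\<lambda>t s'. t \<le> T \<and> P s') s"
  shows "\<exists>t s'. reaches s t s' \<and> t \<le> T + 2 \<and> P s'"
proof -
  note S = at_levelD[OF assms(1)]
  obtain t s' where a: "exec B (process_node Q) s t s'" "t \<le> T" "P s'"
    using assms(3) unfolding wp_def by blast
  have "exec B (search_step Q) s (t + 1) s'"
    unfolding search_step_def by (rule exec.If_True[OF _ _ a(1)]) (use assms(2) S small_bounds in auto)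
  from iters_step[OF _ _ this iters_refl] have "reaches s (t + 1 + 0 + 1) s'"
    using S small_bounds by simp
  with a show ?thesis by (intro exI[of _ "t + 1 + 0 + 1"] exI[of _ s']) auto
qed

lemma level_index:
  assumes "L < m" "i < m"
  shows "L * m + i \<le> B" "L * m \<le> B" "Suc L \<le> B" "Suc i \<le> B"
proof -
  have "Suc L * m \<le> m * m" using assms(1) by (intro mult_le_mono1) simp
  then show "L * m + i \<le> B" "L * m \<le> B" "Suc L \<le> B" "Suc i \<le> B" using assms small_bounds(2,4) by simp_all
qed

lemma advance_push:
  assumes s: "at_level cs s" "s 32 (length cs) = p" "p < m" "length cs < m" "marks C (length cs) s" "p \<in> C"
  shows "wp B advance (\<lambda>t s'. t \<le> 6 \<and> at_level (cs @ [p]) s' \<and> s' 35 0 = 1 \<and>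
    s' 32 = (s 32)(length cs := Suc p) \<and> s' 33 = s 33) s"
proof -
  note S = at_levelD[OF s(1)]
  let ?s' = "s(31 := (s 31)(length cs := p), 32 := (s 32)(length cs := Suc p),
    30 := (s 30)(0 := Suc (length cs)), 35 := (s 35)(0 := 1))"
  note b = level_index[OF s(4,3)]
  have w: "word_store B ?s'" using S(1) b small_bounds by auto
  have "ready ?s'" by (rule ready_cong[OF S(2)]) simp
  then have "at_level (cs @ [p]) ?s'"
    using w S by (auto simp: at_level_def nth_append less_Suc_eq)
  moreover have "s 33 (length cs * m + p) = 1" using s(3,5,6) by (simp add: marks_def)
  ultimately show ?thesis
    unfolding advance_def using S(1,4) s(2,3) b small_bounds inputsD(2)[OF S(3)] by simp
qed

lemma advance_skip:
  assumes s: "at_level cs s" "s 32 (length cs) = p" "p < m" "length cs < m" "marks C (length cs) s" "p \<notin> C"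
    and e: "s 35 0 = 0"
  shows "wp B advance (\<lambda>t s'. t \<le> 6 \<and> at_level cs s' \<and> s' 35 0 = 0 \<and>
    s' 32 = (s 32)(length cs := Suc p) \<and> s' 33 = s 33) s"
proof -
  note S = at_levelD[OF s(1)]
  let ?s' = "s(32 := (s 32)(length cs := Suc p))"
  note b = level_index[OF s(4,3)]
  have w: "word_store B ?s'" using S(1) b by auto
  have "ready ?s'" by (rule ready_cong[OF S(2)]) simp
  then have "at_level cs ?s'" using w S by (simp add: at_level_def)
  moreover have "s 33 (length cs * m + p) = 0" using s(3,5,6) by (simp add: marks_def)
  ultimately show ?thesis
    unfolding advance_def using S(1,4) s(2,3) b small_bounds inputsD(2)[OF S(3)] e by simp
qed

lemma advance_pop:
  assumes s: "at_level (cs @ [p]) s" "s 32 (Suc (length cs)) = m" "s 35 0 = 0" "Suc (length cs) \<le> m"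
  shows "wp B advance (\<lambda>t s'. t \<le> 6 \<and> at_level cs s' \<and> s' 35 0 = 0 \<and> s' 32 = s 32 \<and> s' 33 = s 33) s"
proof -
  note S = at_levelD[OF s(1)]
  let ?s' = "s(30 := (s 30)(0 := length cs))"
  have b: "Suc (length cs) \<le> B" using s(4) small_bounds by linarith
  have w: "word_store B ?s'" using S(1) b by auto
  have "ready ?s'" by (rule ready_cong[OF S(2)]) simp
  moreover have "s 31 k = cs ! k" if "k < length cs" for k using S(5)[of k] that by (simp add: nth_append)
  ultimately have "at_level cs ?s'" using w S by (simp add: at_level_def)
  then show ?thesis
    unfolding advance_def using S(1,4) s b small_bounds inputsD(2)[OF S(3)] by simp
qed

lemma advance_end:
  assumes s: "at_level [] s" "s 32 0 = m"
  shows "wp B advance (\<lambda>t s'. t \<le> 6 \<and> s' 34 0 = 0 \<and> s' 28 0 = 0) s"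
  using at_levelD[OF s(1)] s(2) small_bounds inputsD(2)[OF at_levelD(3)[OF s(1)]]
  unfolding advance_def by simp

lemma good_extends:
  assumes "good H" "chosen cs \<subseteq> H" "e i \<in> H"
  shows "chosen (cs @ [i]) \<subseteq> H"
  using assms by (auto simp: chosen_def)

text \<open>Each position costs one move, to pass it or to enter it, within 8 steps; a candidate
  adds \<open>K\<close> for its subtree and 8 for the move back.\<close>

lemma search_children:
  assumes IH: "\<And>i s. \<lbrakk>i \<in> C; at_level (cs @ [i]) s; s 35 0 = 1\<rbrakk> \<Longrightarrow>
      \<exists>t s'. reaches s t s' \<and> t \<le> K \<and> (found s' \<or> exhausted (cs @ [i]) s s')"
    and C: "C \<subseteq> {..<m}" and L: "length cs < m"
  shows "\<lbrakk>p \<le> m; at_level cs s; s 35 0 = 0; s 32 (length cs) = p; marks C (length cs) s\<rbrakk> \<Longrightarrow>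
    \<exists>t s'. reaches s t s' \<and> t \<le> (m - p) * 8 + card {i \<in> C. p \<le> i} * (K + 8) \<and>
      (found s' \<or> at_level cs s' \<and> s' 35 0 = 0 \<and> s' 32 (length cs) = m \<and> same_below (length cs) s s' \<and>
        (\<forall>i\<in>C. p \<le> i \<longrightarrow> \<not> (\<exists>H. good H \<and> chosen (cs @ [i]) \<subseteq> H)))"
proof (induction "m - p" arbitrary: p s)
  case 0
  then have "p = m" by simp
  then show ?case using 0 C
    by (intro exI[of _ 0] exI[of _ s]) (auto simp: same_below_def intro: iters_refl)
next
  case (Suc d)
  let ?L = "length cs"
  have p: "p < m" using Suc.hyps(2) by simp
  have mp: "m - p = Suc (m - Suc p)" using p by simp
  have d: "d = m - Suc p" and Sp: "Suc p \<le> m" using Suc.hyps(2) p by simp_all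
  show ?case
  proof (cases "p \<in> C")
    case False
    from reaches_advance[OF Suc.prems(2,3) advance_skip[OF Suc.prems(2,4) p L Suc.prems(5) False Suc.prems(3)]]
    obtain t1 s1 where 1: "reaches s t1 s1" "t1 \<le> 8" "at_level cs s1" "s1 35 0 = 0"
      "s1 32 = (s 32)(?L := Suc p)" "s1 33 = s 33" by blast
    have mk1: "marks C ?L s1" using Suc.prems(5) 1(6) by (simp add: marks_def)
    have pos: "s1 32 ?L = Suc p" using 1(5) by simp
    from Suc.hyps(1)[OF d Sp 1(3,4) pos mk1] obtain t2 s2 where 2: "reaches s1 t2 s2"
      "t2 \<le> (m - Suc p) * 8 + card {i \<in> C. Suc p \<le> i} * (K + 8)"
      "found s2 \<or> at_level cs s2 \<and> s2 35 0 = 0 \<and> s2 32 ?L = m \<and> same_below ?L s1 s2 \<and>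
        (\<forall>i\<in>C. Suc p \<le> i \<longrightarrow> \<not> (\<exists>H. good H \<and> chosen (cs @ [i]) \<subseteq> H))"
      by blast
    have eq: "{i \<in> C. p \<le> i} = {i \<in> C. Suc p \<le> i}" using False by (auto simp: Suc_le_eq le_less)
    have sb: "same_below ?L s s2" if "same_below ?L s1 s2"
      using that 1(5,6) by (simp add: same_below_def)
    have "\<forall>i\<in>C. p \<le> i \<longrightarrow> Suc p \<le> i" using False by (auto simp: Suc_le_eq le_less)
    then have "found s2 \<or> at_level cs s2 \<and> s2 35 0 = 0 \<and> s2 32 ?L = m \<and> same_below ?L s s2 \<and>
        (\<forall>i\<in>C. p \<le> i \<longrightarrow> \<not> (\<exists>H. good H \<and> chosen (cs @ [i]) \<subseteq> H))"
      using 2(3) sb by blast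
    moreover have "t1 + t2 \<le> (m - p) * 8 + card {i \<in> C. p \<le> i} * (K + 8)"
      using 1(2) 2(2) unfolding eq mp by simp
    ultimately show ?thesis using iters_trans[OF 1(1) 2(1)] by blast
  next
    case True
    from reaches_advance[OF Suc.prems(2,3) advance_push[OF Suc.prems(2,4) p L Suc.prems(5) True]]
    obtain t1 s1 where 1: "reaches s t1 s1" "t1 \<le> 8" "at_level (cs @ [p]) s1" "s1 35 0 = 1"
      "s1 32 = (s 32)(?L := Suc p)" "s1 33 = s 33" by blast
    from IH[OF True 1(3,4)] obtain t2 s2 where 2: "reaches s1 t2 s2" "t2 \<le> K"
      "found s2 \<or> exhausted (cs @ [p]) s1 s2" by blast
    have fin: "finite C" using C finite_subset by blast
    have eq: "{i \<in> C. p \<le> i} = insert p {i \<in> C. Suc p \<le> i}" using True by (auto simp: Suc_le_eq le_less)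
    have cd: "card {i \<in> C. p \<le> i} = Suc (card {i \<in> C. Suc p \<le> i})"
      unfolding eq using fin by (subst card_insert_disjoint) auto
    show ?thesis
    proof (cases "found s2")
      case True
      have "t1 + t2 \<le> (m - p) * 8 + card {i \<in> C. p \<le> i} * (K + 8)"
        using 1(2) 2(2) unfolding mp cd by simp
      then show ?thesis using True iters_trans[OF 1(1) 2(1)] by blast
    next
      case False
      then have ex: "at_level (cs @ [p]) s2" "s2 35 0 = 0" "s2 32 (Suc ?L) = m" "same_below (Suc ?L) s1 s2"
        "\<not> (\<exists>H. good H \<and> chosen (cs @ [p]) \<subseteq> H)" using 2(3) by (auto simp: exhausted_def)
      from reaches_advance[OF ex(1,2) advance_pop[OF ex(1,3,2)]] L
      obtain t3 s3 where 3: "reaches s2 t3 s3" "t3 \<le> 8" "at_level cs s3" "s3 35 0 = 0"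
        "s3 32 = s2 32" "s3 33 = s2 33" by auto
      have low: "s3 32 k = s1 32 k" if "k \<le> ?L" for k
        using ex(4) 3(5) that by (simp add: same_below_def)
      \<comment> \<open>The subtree works at level \<open>Suc ?L\<close> or deeper, so the marks of
        the present level are still valid on return.\<close>
      have mk: "s3 33 j = s 33 j" if "j < Suc ?L * m" for j
        using ex(4) 3(6) 1(6) that by (simp add: same_below_def)
      have mk3: "marks C ?L s3" using Suc.prems(5) mk by (simp add: marks_def)
      have pos: "s3 32 ?L = Suc p" using low[of ?L] 1(5) by simp
      obtain t4 s4 where 4: "reaches s3 t4 s4"
        "t4 \<le> (m - Suc p) * 8 + card {i \<in> C. Suc p \<le> i} * (K + 8)"
        "found s4 \<or> at_level cs s4 \<and> s4 35 0 = 0 \<and> s4 32 ?L = m \<and> same_below ?L s3 s4 \<and>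
          (\<forall>i\<in>C. Suc p \<le> i \<longrightarrow> \<not> (\<exists>H. good H \<and> chosen (cs @ [i]) \<subseteq> H))"
        using Suc.hyps(1)[OF d Sp 3(3,4) pos mk3] by blast
      have sb: "same_below ?L s s4" if "same_below ?L s3 s4"
        using that low mk 1(5) by (simp add: same_below_def)
      have "i = p \<or> Suc p \<le> i" if "p \<le> i" for i using that by auto
      then have "found s4 \<or> at_level cs s4 \<and> s4 35 0 = 0 \<and> s4 32 ?L = m \<and> same_below ?L s s4 \<and>
        (\<forall>i\<in>C. p \<le> i \<longrightarrow> \<not> (\<exists>H. good H \<and> chosen (cs @ [i]) \<subseteq> H))"
        using 4(3) sb ex(5) by blast
      moreover have "t1 + (t2 + (t3 + t4)) \<le> (m - p) * 8 + card {i \<in> C. p \<le> i} * (K + 8)"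
        using 1(2) 2(2) 3(2) 4(2) unfolding mp cd by simp
      ultimately show ?thesis
        using iters_trans[OF 1(1) iters_trans[OF 2(1) iters_trans[OF 3(1) 4(1)]]] by blast
    qed
  qed
qed

text \<open>In units of \<open>h * h * At * h ^ (2 * k)\<close>, an inner node contributes at most
  130 for itself, half of 308 for its children and less than 3 for the moves between them; 300 is a
  convenient bound on the sum.\<close>

definition tree_time :: "nat \<Rightarrow> nat" where "tree_time k = 300 * At * h ^ (2 * k)"

text \<open>At most \<open>h\<^sup>2 / 2\<close> children per node: the factor \<open>1 / 2\<close> pays for the inner nodes of the
  search tree.\<close>

lemma tree_time_Suc:
  assumes "2 \<le> h" "2 * b \<le> h * h"
  shows "130 * h * At + 2 + (m * 8 + b * (tree_time k + 8)) \<le> tree_time (Suc k)"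
proof -
  let ?X = "At * h ^ (2 * k)"
  have X: "At \<le> ?X" "1 \<le> ?X" using assms(1) small_At(1) by simp_all
  have hX: "h * At \<le> h * h * ?X"
  proof -
    have "h * At \<le> h * ?X" using X(1) by (rule mult_le_mono2)
    also have "\<dots> \<le> h * h * ?X" using assms(1) by simp
    finally show ?thesis .
  qed
  have At4: "4 * At \<le> h * h * ?X"
  proof -
    have "4 \<le> h * h" using mult_le_mono[OF assms(1,1)] by simp
    then show ?thesis using X(1) mult_le_mono by blast
  qed
  have "tree_time k + 8 \<le> 308 * ?X" using X(2) unfolding tree_time_def by simp
  then have "2 * (b * (tree_time k + 8)) \<le> 2 * (b * (308 * ?X))" by simp
  also have "\<dots> = (2 * b) * (308 * ?X)" by simp
  also have "\<dots> \<le> (h * h) * (308 * ?X)" using assms(2) by (rule mult_le_mono1)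
  finally have "2 * (b * (tree_time k + 8)) \<le> 308 * (h * h * ?X)" by simp
  moreover have "tree_time (Suc k) = 300 * (h * h * ?X)" unfolding tree_time_def by simp
  moreover have "130 * h * At = 130 * (h * At)" by simp
  ultimately show ?thesis using hX At4 small_At by linarith
qed

text \<open>Induction on the number of edges that may still be chosen. A good superset of the chosen
  edges would contain some candidate, hence extend one of the children, all of which have been
  searched in vain.\<close>

lemma search_tree:
  assumes h2: "2 \<le> h"
  shows "\<lbrakk>at_level cs s; valid_choice cs; s 35 0 = 1\<rbrakk> \<Longrightarrow>
    \<exists>t s'. reaches s t s' \<and> t \<le> tree_time (mu I - length cs) \<and> (found s' \<or> exhausted cs s s')"
proof (induction "mu I - length cs" arbitrary: cs s rule: less_induct)
  case less
  let ?L = "length cs"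
  from reaches_node[OF less.prems(1,3) process_node_wp[OF less.prems(1,2) h2]]
  obtain t1 s1 where 1: "reaches s t1 s1" "t1 \<le> node_time ?L + 2" "found s1 \<or> expanded cs s s1" by blast
  \<comment> \<open>For an inner node this is the recurrence with \<open>b = 0\<close> children; at
    depth \<open>mu\<close> it compares 80 with 300.\<close>
  have tl: "node_time ?L + 2 \<le> tree_time (mu I - ?L)"
  proof (cases "?L < mu I")
    case True
    then obtain k where k: "mu I - ?L = Suc k" using less_imp_Suc_add[of 0 "mu I - ?L"] by auto
    show ?thesis unfolding k node_time_def using tree_time_Suc[OF h2, of 0 k] True by simp
  next
    case False
    then show ?thesis using small_At(1) by (simp add: node_time_def tree_time_def)
  qed
  show ?case
  proof (cases "found s1")
    case True
    then show ?thesis using 1 tl le_trans by blast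
  next
    case False
    then have ex: "expanded cs s s1" using 1(3) by blast
    then obtain C where C: "C \<subseteq> {..<m}" "s1 32 ?L = m \<and> C = {} \<or>
           s1 32 ?L = 0 \<and> ?L < mu I \<and> ?L < m \<and> marks C ?L s1"
        "2 * card C \<le> h * h" "\<forall>i\<in>C. e i \<in> alive \<and> e i \<notin> chosen cs"
        "\<And>H. good H \<Longrightarrow> chosen cs \<subseteq> H \<Longrightarrow> \<exists>i\<in>C. e i \<in> H"
      and s1: "at_level cs s1" "s1 35 0 = 0" "same_below ?L s s1"
      unfolding expanded_def by blast
    show ?thesis
    proof (cases "s1 32 ?L = m \<and> C = {}")
      case True
      then have "exhausted cs s s1" using s1 C(5) by (auto simp: exhausted_def)
      then show ?thesis using 1 tl le_trans by blast
    next
      case False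
      then have c: "s1 32 ?L = 0" "?L < mu I" "?L < m" "marks C ?L s1" using C(2) by auto
      let ?k = "mu I - Suc ?L"
      have k: "mu I - ?L = Suc ?k" using c(2) by simp
      have IH: "\<exists>t s'. reaches s t s' \<and> t \<le> tree_time ?k \<and> (found s' \<or> exhausted (cs @ [i]) s s')"
        if i: "i \<in> C" "at_level (cs @ [i]) s" "s 35 0 = 1" for i s
      proof -
        have "i \<notin> set cs" using C(4) i(1) by (auto simp: chosen_def)
        then have "valid_choice (cs @ [i])"
          using less.prems(2) C(1,4) i(1) c(2) by (auto simp: valid_choice_def chosen_def)
        then show ?thesis using less.hyps[of "cs @ [i]" s] i(2,3) k by simp
      qed
      obtain t2 s2 where 2: "reaches s1 t2 s2"
        "t2 \<le> (m - 0) * 8 + card {i \<in> C. 0 \<le> i} * (tree_time ?k + 8)"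
        "found s2 \<or> at_level cs s2 \<and> s2 35 0 = 0 \<and> s2 32 ?L = m \<and> same_below ?L s1 s2 \<and>
        (\<forall>i\<in>C. 0 \<le> i \<longrightarrow> \<not> (\<exists>H. good H \<and> chosen (cs @ [i]) \<subseteq> H))"
        using search_children[OF IH C(1) c(3) le0 s1(1,2) c(1,4)] by blast
      have "exhausted cs s s2" if "\<not> found s2"
      proof -
        have "\<not> (\<exists>H. good H \<and> chosen cs \<subseteq> H)"
        proof
          assume "\<exists>H. good H \<and> chosen cs \<subseteq> H"
          then obtain H where H: "good H" "chosen cs \<subseteq> H" by blast
          from C(5)[OF H] obtain i where i: "i \<in> C" "e i \<in> H" by blast
          have "chosen (cs @ [i]) \<subseteq> H" by (rule good_extends[OF H i(2)])
          moreover have "\<not> (\<exists>H. good H \<and> chosen (cs @ [i]) \<subseteq> H)" using 2(3) that i(1) by simp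
          ultimately show False using H(1) by blast
        qed
        moreover have "same_below ?L s s2" using 2(3) that s1(3) by (simp add: same_below_def)
        ultimately show ?thesis using 2(3) that by (simp add: exhausted_def)
      qed
      moreover have "t1 + t2 \<le> tree_time (mu I - ?L)"
      proof -
        have "t1 \<le> 130 * h * At + 2" using 1(2) c(2) by (simp add: node_time_def)
        moreover have "t2 \<le> m * 8 + card C * (tree_time ?k + 8)" using 2(2) by simp
        ultimately show ?thesis using tree_time_Suc[OF h2 C(3), of ?k] unfolding k by linarith
      qed
      ultimately show ?thesis using iters_trans[OF 1(1) 2(1)] by blast
    qed
  qed
qed

lemma run_search_wp:
  assumes "word_store B s" "ready s" "2 \<le> h"
  shows "wp B (run_search Q) (\<lambda>t s'. t \<le> tree_time (mu I) + 20 \<and> s' 28 0 = of_bool (\<exists>H. good H)) s"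
proof -
  let ?s0 = "s(30 := (s 30)(0 := 0), 28 := (s 28)(0 := 0), 34 := (s 34)(0 := 1), 35 := (s 35)(0 := 1))"
  have w: "word_store B ?s0" using assms(1) small_bounds by auto
  have "ready ?s0" by (rule ready_cong[OF assms(2)]) simp
  then have al: "at_level [] ?s0" using w by (simp add: at_level_def)
  have vc: "valid_choice []" by (simp add: valid_choice_def)
  obtain t1 s1 where 1: "reaches ?s0 t1 s1" "t1 \<le> tree_time (mu I)" "found s1 \<or> exhausted [] ?s0 s1"
    using search_tree[OF assms(3) al vc] by auto
  have gt: "triv \<subseteq> H" if "good H" for H using that by (simp add: good_def)
  obtain t2 s2 where 2: "reaches ?s0 t2 s2" "t2 \<le> tree_time (mu I) + 8" "s2 34 0 = 0"
    "s2 28 0 = of_bool (\<exists>H. good H)"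
  proof (cases "found s1")
    case True
    then show ?thesis using that[of t1 s1] 1 by (auto simp: found_def)
  next
    case False
    then have ex: "at_level [] s1" "s1 35 0 = 0" "s1 32 0 = m" "\<not> (\<exists>H. good H)"
      using 1(3) gt by (auto simp: exhausted_def chosen_def)
    \<comment> \<open>An exhausted root still has array 34 set; the move at level 0 clears it and
      leaves the answer 0 in array 28.\<close>
    from reaches_advance[OF ex(1,2) advance_end[OF ex(1,3)]] obtain t' s' where
      r: "reaches s1 t' s'" "t' \<le> 8" "s' 34 0 = 0" "s' 28 0 = 0" by blast
    show ?thesis using that[of "t1 + t'" s'] iters_trans[OF 1(1) r(1)] 1(2) r ex(4) by auto
  qed
  have "exec B (While (Sc 34) (search_step Q)) s2 1 s2"
    by (rule exec.While_False) (use 2(3) in auto)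
  from iters_While[OF 2(1) this]
  have "wp B (While (Sc 34) (search_step Q)) (\<lambda>t s'. Suc (Suc (Suc (Suc t))) \<le> tree_time (mu I) + 20 \<and>
      s' 28 0 = of_bool (\<exists>H. good H)) ?s0"
    unfolding wp_def using 2(2,4) by (intro exI[of _ "t2 + 1"] exI[of _ s2]) auto
  then show ?thesis
    unfolding run_search_def using small_bounds by simp
qed

end

section \<open>The decision procedure\<close>

text \<open>Arrays 0 to 4 are overwritten by later calls, so the input is copied to private arrays.
  Array 11 first accumulates the sum of the lengths and is then turned into
  \<open>Big\<close>.\<close>

definition load :: com where
  "load = (5 ::= Cell 0 (Num 0) ;; 6 ::= Cell 0 (Num 1) ;; 7 ::= Cell 0 (Num 2) ;; 8 ::= Cell 0 (Num 3) ;;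
     9 ::= Cell 0 (Num 4) ;; 10 ::= Cell 0 (Num 5) ;; 11 ::= Num 0 ;;
     For 23 6 (12[Sc 23] ::= Cell 1 (Sc 23) ;; 13[Sc 23] ::= Cell 2 (Sc 23) ;;
       14[Sc 23] ::= Cell 3 (Sc 23) ;; 15[Sc 23] ::= Cell 4 (Sc 23) ;; 11 ::= Sc 11 \<oplus> Cell 3 (Sc 23)) ;;
     11 ::= Sc 7 \<otimes> Sc 11 \<oplus> Num 1)"

text \<open>Without a critical pair the trivial edges form a spanner. Only their weight has to be
  checked, and \<open>Q\<close> is not called.\<close>

definition decide :: "com \<Rightarrow> com" where
  "decide Q = (load ;; find_alive ;; find_trivial ;; find_critical ;;
     (If (Sc 26) (run_search Q) (copy_array 29 18 ;; check_weight) ;;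
     0[Num 0] ::= Sc 28))"

context prog
begin

lemma load_wp:
  assumes s: "word_store B s" "encodes_inst I s" and p: "p1 = s 1" "p2 = s 2"
  shows "wp B load (\<lambda>t s'. t \<le> m * 7 + 12 \<and> inputs s') s"
proof -
  have g: "s 0 0 = n" "s 0 (Suc 0) = m" "s 0 2 = num" "s 0 3 = den" "s 0 4 = budget I" "s 0 5 = mu I"
    "\<And>i. i < m \<Longrightarrow> s 3 i = l (e i)" "\<And>i. i < m \<Longrightarrow> s 4 i = weight I (e i)"
    using s(2) p by (simp_all add: encodes_inst_def encodes_graph_def)
  let ?s1 = "s(5 := (s 5)(0 := n), 6 := (s 6)(0 := m), 7 := (s 7)(0 := num), 8 := (s 8)(0 := den),
    9 := (s 9)(0 := budget I), 10 := (s 10)(0 := mu I), 11 := (s 11)(0 := 0))"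
  have bB: "budget I \<le> B" using bound by linarith
  have w1: "word_store B ?s1" using s(1) small_bounds bB by auto
  let ?c = "12[Sc 23] ::= Cell 1 (Sc 23) ;; 13[Sc 23] ::= Cell 2 (Sc 23) ;;
       14[Sc 23] ::= Cell 3 (Sc 23) ;; 15[Sc 23] ::= Cell 4 (Sc 23) ;; 11 ::= Sc 11 \<oplus> Cell 3 (Sc 23)"
  let ?I = "\<lambda>k s'. s' 11 0 = (\<Sum>i<k. l (e i)) \<and>
    (\<forall>i<k. s' 12 i = p1 i \<and> s' 13 i = p2 i \<and> s' 14 i = l (e i) \<and> s' 15 i = weight I (e i))"
  have sumS: "(\<Sum>i<m. l (e i)) = S" by (rule sum.reindex_bij_betw[OF bij])
  have S_le: "S \<le> num * S" using stretch_quot by simp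
  have SB: "S \<le> B" "num * S + 1 \<le> B" using S_le Big_le unfolding Big_def by linarith+
  have "wp B (For 23 6 ?c) (\<lambda>t s'. t \<le> m * (5 + 2) + 2 \<and> ?I m s') ?s1"
  proof (rule wp_For[where I = ?I, OF w1])
    fix k s'
    assume a: "k < m" "s' 23 0 = k" "word_store B s'"
      "\<And>a. a \<notin> insert 23 (writes ?c) \<Longrightarrow> s' a = ?s1 a" "?I k s'"
    have r: "s' (Suc 0) k = p1 k" "s' 2 k = p2 k" "s' 3 k = l (e k)" "s' 4 k = weight I (e k)"
      using a(4)[of 1] a(4)[of 2] a(4)[of 3] a(4)[of 4] g(7,8)[OF a(1)] p by auto
    have "(\<Sum>i<Suc k. l (e i)) \<le> (\<Sum>i<m. l (e i))" using a(1) by (intro sum_mono2) auto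
    then have "(\<Sum>i<Suc k. l (e i)) \<le> B" unfolding sumS using SB by linarith
    moreover have "k \<le> B" using a(1) small_bounds by linarith
    ultimately show "wp B ?c (\<lambda>t s'. t \<le> 5 \<and> ?I (Suc k) s') s'"
      using a(2,3,5) r in_bounds[OF a(1)] by (auto simp: less_Suc_eq)
  qed auto
  then have "wp B (For 23 6 ?c ;; 11 ::= Sc 7 \<otimes> Sc 11 \<oplus> Num 1)
      (\<lambda>t s'. Suc (Suc (Suc (Suc (Suc (Suc (Suc t)))))) \<le> m * 7 + 12 \<and> inputs s') ?s1"
    unfolding wp_Seq[of B "For 23 6 ?c"]
    apply (rule wp_conseq[OF _ w1])
    subgoal premises a for t s'
    proof -
      have fr: "s' 5 0 = n" "s' 6 0 = m" "s' 7 0 = num" "s' 8 0 = den" "s' 9 0 = budget I" "s' 10 0 = mu I"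
        using a(3) by simp_all
      have "s' 11 0 = S" using a(1) sumS by simp
      then show ?thesis using a(1,2) fr SB small_bounds
        by (auto simp: inputs_def Big_def)
    qed
    done
  then show ?thesis
    unfolding load_def wp_Seq[of B "a ::= x" for a x]
    using g small_bounds bB by (simp del: wp_Seq)
qed

end

context search
begin

lemma product_bounds: "m \<le> m * m * n" "m * n \<le> m * m * n" "m * m \<le> m * m * n"
proof -
  show mm: "m * m \<le> m * m * n" using n_pos by simp
  have "m \<le> m * m" by simp
  then show "m \<le> m * m * n" using mm by linarith
  show "m * n \<le> m * m * n" by simp
qed

lemma decide_wp:
  assumes s: "word_store B s" "encodes_inst I s" and p: "p1 = s 1" "p2 = s 2"
  shows "wp B (decide Q) (\<lambda>t s'. t \<le> 500 * (h ^ (2 * mu I) * At + m * m * n + 1) \<and>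
    s' 0 0 = (if yes_inst (preprocess I) then 1 else 0)) s"
proof -
  \<comment> \<open>27 = 6 + 10 + 11: both \<open>m * n\<close> and \<open>m\<close> are at most
    \<open>m * m * n\<close>.\<close>
  have dt: "m * dist_time \<le> 27 * (m * m * n)"
  proof -
    have "m * dist_time = 6 * (m * m * n) + 10 * (m * n) + 11 * m" by (simp add: algebra_simps)
    then show ?thesis using product_bounds by linarith
  qed
  let ?T = "500 * (h ^ (2 * mu I) * At + m * m * n + 1)"
  let ?R = "\<lambda>s'. s' 28 0 = (if yes_inst (preprocess I) then 1 else 0)"
  let ?end = "If (Sc 26) (run_search Q) (copy_array 29 18 ;; check_weight)"
  have branch: "wp B ?end (\<lambda>t s'. t \<le> 300 * (h ^ (2 * mu I) * At) + m * 7 + 30 \<and> ?R s') s4"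
    if s4: "word_store B s4" "ready s4" "s4 26 0 = 0 \<longleftrightarrow> settles_all triv" for s4
  proof (cases "settles_all triv")
    case True
    have i: "inputs s4" and f: "flags 18 triv s4" using s4(2) by (auto simp: ready_def)
    have yes: "yes_inst (preprocess I) \<longleftrightarrow> sum (weight I) triv \<le> budget I"
    proof -
      have "(\<exists>H. good H \<and> triv \<subseteq> H) \<longleftrightarrow> sum (weight I) triv \<le> budget I"
        by (rule good_leaf) (use triv_sub True in auto)
      then show ?thesis unfolding yes_inst_iff by (auto simp: good_def)
    qed
    have "wp B (copy_array 29 18 ;; check_weight) (\<lambda>t s'. t + 1 \<le> 300 * (h ^ (2 * mu I) * At) + m * 7 + 30 \<and> ?R s') s4"
      unfolding wp_Seq
      apply (rule wp_conseq[OF copy_array_wp[OF s4(1) i _ _ _ f] s4(1)])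
      subgoal by simp
      subgoal by simp
      subgoal by simp
      subgoal premises a for t s5
      proof -
        have i5: "inputs s5" by (rule inputs_cong[OF i]) (rule a(3); auto)
        have "triv \<subseteq> E" using triv_sub alive_sub by blast
        from check_weight_wp[OF a(2) i5 conjunct2[OF a(1)] this] show ?thesis
          by (rule wp_conseq[OF _ a(2)]) (use a(1) yes in auto)
      qed
      done
    then show ?thesis using s4(1,3) True by (simp del: wp_Seq)
  next
    case False
    then obtain u v where "{u, v} \<in> alive" "\<not> settled triv u v" by (auto simp: settles_all_def)
    then have h2: "2 \<le> h" using critical_iff nbhd_size_ge2 by blast
    have "wp B (run_search Q) (\<lambda>t s'. t + 1 \<le> 300 * (h ^ (2 * mu I) * At) + m * 7 + 30 \<and> ?R s') s4"
      by (rule wp_conseq[OF run_search_wp[OF s4(1,2) h2] s4(1)])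
        (auto simp: tree_time_def yes_inst_iff algebra_simps)
    moreover have "s4 26 0 \<noteq> 0" using s4(3) False by simp
    ultimately show ?thesis using s4(1) by simp
  qed
  show ?thesis
    unfolding decide_def wp_Seq[of B load]
    apply (rule wp_conseq[OF load_wp[OF s p] s(1)])
    subgoal premises a for t s1
      unfolding wp_Seq[of B find_alive]
      apply (rule wp_conseq[OF find_alive_wp[OF a(2) conjunct2[OF a(1)]] a(2)])
      subgoal premises b for t1 s2
      proof -
        have b': "inputs s2" "dists s2" "flags 17 alive s2" using b(1) by auto
        show ?thesis
          unfolding wp_Seq[of B find_trivial]
          apply (rule wp_conseq[OF find_trivial_wp[OF b(2) b'] b(2)])
          subgoal premises c for t2 s3
            unfolding wp_Seq[of B find_critical]
            apply (rule wp_conseq[OF find_critical_wp[OF c(2) conjunct2[OF c(1)]] c(2)])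
            subgoal premises d for t3 s4
            proof -
              have rd: "ready s4" by (rule ready_cong[OF conjunct2[OF c(1)]]) (rule d(3); auto)
              show ?thesis
                unfolding wp_Seq[of B ?end]
                apply (rule wp_conseq[OF branch[OF d(2) rd conjunct2[OF d(1)]] d(2)])
                subgoal premises f for t4 s5
                proof -
                  let ?M = "m * m * n"
                  have t: "t \<le> 7 * m + 12" "t1 \<le> m * dist_time + 13 * m + 20"
                    "t2 \<le> m * dist_time + 9 * (m * m) + 20 * m + 2" "t3 \<le> m * dist_time + 14 * m + 20"
                    "t4 \<le> 300 * (h ^ (2 * mu I) * At) + 7 * m + 30"
                    using a(1) b(1) c(1) d(1) f(1) by (simp_all add: algebra_simps)
                  have T: "?T = 500 * (h ^ (2 * mu I) * At) + 500 * ?M + 500" by simp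
                  have "t + (t1 + (t2 + (t3 + (t4 + 1)))) \<le> ?T"
                    unfolding T using t dt product_bounds by linarith
                  then show ?thesis using f(1,2) small_bounds(5) by simp
                qed
                done
            qed
            done
          done
      qed
      done
    done
qed

end

section \<open>Parameterized running time\<close>

definition power_program :: com where
  "power_program = (1 ::= Num 1 ;;
     While (Sc 0) (1 ::= Sc 1 \<otimes> Cell 0 (Num 1) \<otimes> Cell 0 (Num 1) ;; 0 ::= Sc 0 \<ominus> Num 1) ;;
     0 ::= Sc 1 \<oplus> Num 1)"

text \<open>The parameter function of the FPT bound, for \<open>x = mu\<close> and
  \<open>y = h\<close>. The summand 1 keeps it positive when \<open>h = 0\<close>, where the
  polynomial factor has to account for the preprocessing.\<close>

lemma computable2_power: "computable2 (\<lambda>x y. y ^ (2 * x) + 1)"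
  unfolding computable2_def
proof (rule exI[of _ power_program], intro allI)
  fix x y :: nat
  \<comment> \<open>The base \<open>y + 1\<close> is positive, so its powers increase with the
    exponent and dominate all intermediate results, also for \<open>y = 0\<close>.\<close>
  let ?B0 = "(y + 1) ^ (2 * x) + x + y + 1"
  let ?body = "1 ::= Sc 1 \<otimes> Cell 0 (Num 1) \<otimes> Cell 0 (Num 1) ;; 0 ::= Sc 0 \<ominus> Num 1"
  have run: "\<exists>t s'. exec B power_program s t s' \<and> s' 0 0 = y ^ (2 * x) + 1"
    if B: "?B0 \<le> B" and s: "word_store B s \<and> s 0 0 = x \<and> s 0 1 = y" for B s
  proof -
    have pw: "y ^ i \<le> B" if "i \<le> 2 * x" for i
    proof -
      have "y ^ i \<le> (y + 1) ^ i" by (rule power_mono) auto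
      also have "\<dots> \<le> (y + 1) ^ (2 * x)" using that by (rule power_increasing) simp
      finally show ?thesis using B by linarith
    qed
    have loop: "wp B (While (Sc 0) ?body) (\<lambda>t s'. s' 1 0 = y ^ (2 * x)) s1"
      if "word_store B s1" "s1 0 0 = i" "s1 0 1 = y" "s1 1 0 = y ^ (2 * (x - i))" "i \<le> x" for s1 i
      using that
    proof (induction i arbitrary: s1)
      case 0
      then have "exec B (While (Sc 0) ?body) s1 1 s1" by (intro exec.While_False) auto
      then show ?case unfolding wp_def using 0 by auto
    next
      case (Suc i)
      have xi: "x - i = Suc (x - Suc i)" using Suc.prems(5) by simp
      let ?k = "2 * (x - Suc i)"
      let ?s2 = "s1(1 := (s1 1)(0 := y ^ (2 * (x - i))), 0 := (s1 0)(0 := i))"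
      have b: "y ^ ?k * y \<le> B" "y ^ ?k * y * y \<le> B" "y ^ ?k \<le> B"
        using pw[of "Suc ?k"] pw[of "Suc (Suc ?k)"] pw[of ?k] Suc.prems(5) by (simp_all add: mult.commute mult.left_commute)
      have pe: "y ^ ?k * y * y = y ^ (2 * (x - i))" unfolding xi by (simp add: ac_simps)
      have "wp B ?body (\<lambda>t s'. s' = ?s2) s1"
        using Suc.prems b pe B by simp
      then obtain t where e: "exec B ?body s1 t ?s2" unfolding wp_def by blast
      have w: "word_store B ?s2" by (rule exec_word_store[OF e Suc.prems(1)])
      have "wp B (While (Sc 0) ?body) (\<lambda>t s'. s' 1 0 = y ^ (2 * x)) ?s2"
        by (rule Suc.IH[OF w]) (use Suc.prems in auto)
      then obtain t2 s3 where "exec B (While (Sc 0) ?body) ?s2 t2 s3" "s3 1 0 = y ^ (2 * x)"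
        unfolding wp_def by blast
      moreover from this have "exec B (While (Sc 0) ?body) s1 (t + t2 + 1) s3"
        by (intro exec.While_True[OF _ _ e]) (use Suc.prems B in auto)
      ultimately show ?case unfolding wp_def by blast
    qed
    let ?s1 = "s(1 := (s 1)(0 := 1))"
    have w: "word_store B ?s1" using s B by auto
    have "wp B (While (Sc 0) ?body ;; 0 ::= Sc 1 \<oplus> Num 1) (\<lambda>t s'. s' 0 0 = y ^ (2 * x) + 1) ?s1"
      unfolding wp_Seq[of B "While b c" for b c]
    proof (rule wp_conseq[OF loop[OF w, of x] w])
      fix t :: nat and s' assume a: "s' 1 0 = y ^ (2 * x)" "word_store B s'"
      have "y ^ (2 * x) \<le> (y + 1) ^ (2 * x)" by (rule power_mono) auto
      then have "y ^ (2 * x) + 1 \<le> B" using B by linarith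
      then show "wp B (0 ::= Sc 1 \<oplus> Num 1) (\<lambda>t s'. s' 0 0 = y ^ (2 * x) + 1) s'" using a by simp
    qed (use s in auto)
    then have "wp B power_program (\<lambda>t s'. s' 0 0 = y ^ (2 * x) + 1) s"
      unfolding power_program_def wp_Seq[of B "1 ::= Num 1"] using B by (simp del: wp_Seq)
    then show ?thesis unfolding wp_def by blast
  qed
  show "\<exists>B0. \<forall>B\<ge>B0. \<forall>s. word_store B s \<and> s 0 0 = x \<and> s 0 1 = y \<longrightarrow>
      (\<exists>t s'. exec B power_program s t s' \<and> s' 0 0 = y ^ (2 * x) + 1)"
    by (rule exI[of _ ?B0], intro allI impI, rule run)
qed

lemma poly_nat_mono: "x \<le> y \<Longrightarrow> poly p x \<le> poly p y" for p :: "nat poly"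
proof (induction p)
  case (pCons a p)
  then show ?case using mult_le_mono[of x y "poly p x" "poly p y"] by simp
qed simp

context inst
begin

text \<open>In a connected graph with at least two vertices every vertex lies on an edge. The
  encoding spends only logarithmically many bits on \<open>n\<close>, so \<open>n\<close> has to be
  bounded through the edges.\<close>

lemma card_verts_le: "n \<le> 2 * card E + 1"
proof (cases "n = 1")
  case False
  then have n: "2 \<le> n" using n_pos by simp
  have cover: "{..<n} \<subseteq> \<Union>E"
  proof
    fix x assume x: "x \<in> {..<n}"
    obtain y where y: "y < n" "y \<noteq> x" using n by (cases "x = 0") (auto intro: that[of 0] that[of 1])
    obtain p where p: "simple_path E x y p" using pathE x y by blast
    have len: "length p \<ge> 2" using p y(2) by (cases p; cases "tl p") (auto simp: simple_path_def)
    have "x \<in> set p" using p by (auto simp: simple_path_def)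
    from ex_edge_of_vertex[OF this len] obtain f where f: "f \<in> set (path_edges p)" "x \<in> f" by blast
    then have "f \<in> E" using p by (auto simp: simple_path_def)
    with f(2) show "x \<in> \<Union>E" by blast
  qed
  have "card f = 2" "finite f" if "f \<in> E" for f
  proof -
    obtain u v where "f = {u, v}" "u \<noteq> v" using graph \<open>f \<in> E\<close> unfolding simple_graph_def by blast
    then show "card f = 2" "finite f" by auto
  qed
  then have "card (\<Union>E) \<le> 2 * card E" "finite (\<Union>E)"
    using card_Union_le_sum_card[of E] finE by auto
  then have "card {..<n} \<le> 2 * card E" using card_mono[OF _ cover] by simp
  then show ?thesis by simp
qed simp

text \<open>Every edge occupies at least one bit, and the header at least one more;
  \<open>card_verts_le\<close> handles the vertices.\<close>

lemma size_le_encoding: "n + card E \<le> 3 * encoding_length I"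
proof -
  have "card E = (\<Sum>f\<in>E. 1)" by simp
  also have "\<dots> \<le> (\<Sum>f\<in>E. (\<Sum>v\<in>f. bits v) + bits (elen I f) + bits (weight I f))"
    by (rule sum_mono) (simp add: bits_def)
  finally have "card E + 1 \<le> encoding_length I"
    unfolding encoding_length_def bits_def[of n] by simp
  then show ?thesis using card_verts_le by linarith
qed

lemma no_edges: "n \<le> 1 \<Longrightarrow> card E = 0"
proof -
  assume "n \<le> 1"
  have "E = {}"
  proof (rule ccontr)
    assume "E \<noteq> {}"
    then obtain f where "f \<in> E" by blast
    then obtain u v where "u < n" "v < n" "u \<noteq> v" using graph unfolding simple_graph_def by blast
    with \<open>n \<le> 1\<close> show False by simp
  qed
  then show ?thesis by simp
qed

text \<open>The logarithm is at least 1 from two vertices on; for a single vertex it vanishes, but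
  so does the number of edges.\<close>

lemma square_log_bound: "real (card E * card E * n) \<le> real (card E) ^ 2 * real n * log 2 (real n)"
proof (cases "n \<le> 1")
  case True
  then show ?thesis using no_edges by simp
next
  case False
  then have "1 \<le> log 2 (real n)" using le_log_iff[of 2 "real n" 1] by simp
  then have "real (card E) ^ 2 * real n * 1 \<le> real (card E) ^ 2 * real n * log 2 (real n)"
    by (intro mult_left_mono) auto
  then show ?thesis by (simp add: power2_eq_square)
qed

text \<open>Since \<open>N >= 2\<close>, each factor 2 is absorbed by one more power of
  \<open>N\<close>. The crucial estimate is \<open>Big <= N ^ 3\<close>; it also limits the
  magnitude of the masked graphs on which \<open>Q\<close> is called.\<close>

lemma magnitude_bounds:
  defines "N \<equiv> inst_magnitude I"
  shows "(den + num + 1) * (4 * ((card E + 1) * Big)) + n * n + card E * card E + n + card E +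
      budget I + mu I + sum (weight I) E + 5 \<le> N ^ 10"
    and "graph_magnitude n E (mask_len X Big l) \<le> N ^ 5"
proof -
  have mS: "card E \<le> S"
  proof -
    have "card E = (\<Sum>f\<in>E. 1)" by simp
    also have "\<dots> \<le> S" by (rule sum_mono) (use len_pos in simp)
    finally show ?thesis .
  qed
  have N: "2 + n + S + sum (weight I) E + num + den + budget I + mu I = N"
    by (simp add: N_def inst_magnitude_def graph_magnitude_def)
  have N2: "2 \<le> N" using N by linarith
  have N1: "1 \<le> N" using N2 by linarith
  have two: "2 * N ^ k \<le> N ^ j" if "j = Suc k" for k j using N2 that by simp
  have up: "N ^ i \<le> N ^ j" if "i \<le> j" for i j using power_increasing[OF that N1] .
  have Big: "Big \<le> N ^ 3"
  proof -
    have "num * S \<le> N * N" using N by (intro mult_le_mono) linarith+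
    then have "Big \<le> N ^ 2 + 1" by (simp add: Big_def power2_eq_square)
    also have "\<dots> \<le> 2 * N ^ 2" using N1 by simp
    also have "\<dots> \<le> N ^ 3" by (rule two) simp
    finally show ?thesis .
  qed
  have "(den + num + 1) * (4 * ((card E + 1) * Big)) \<le> N * (4 * (N * N ^ 3))"
    using N mS Big by (intro mult_le_mono) linarith+
  also have "\<dots> = 2 * (2 * N ^ 5)"
  proof -
    have "N * (N * N ^ 3) = N ^ 5" by (simp add: eval_nat_numeral)
    then show ?thesis by simp
  qed
  also have "\<dots> \<le> 2 * N ^ 6" by (intro mult_le_mono2 two) simp
  also have "\<dots> \<le> N ^ 7" by (rule two) simp
  finally have 1: "(den + num + 1) * (4 * ((card E + 1) * Big)) \<le> N ^ 7" .
  have "n * n \<le> N * N" "card E * card E \<le> N * N" using N mS by (intro mult_le_mono; linarith)+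
  moreover have "2 * N ^ 2 \<le> N ^ 3" by (rule two) simp
  moreover have "N ^ 3 \<le> N ^ 7" by (rule up) simp
  ultimately have 2: "n * n + card E * card E \<le> N ^ 7"
    unfolding power2_eq_square[of N] by linarith
  have "n + card E + budget I + mu I + sum (weight I) E + 5 \<le> 4 * N" using N mS by linarith
  also have "\<dots> = 2 * (2 * N ^ 1)" by simp
  also have "\<dots> \<le> 2 * N ^ 2" by (intro mult_le_mono2 two) simp
  also have "\<dots> \<le> N ^ 3" by (rule two) simp
  also have "\<dots> \<le> N ^ 7" by (rule up) simp
  finally have 3: "n + card E + budget I + mu I + sum (weight I) E + 5 \<le> N ^ 7" .
  have "2 * N ^ 7 \<le> N ^ 8" "2 * N ^ 8 \<le> N ^ 9" "N ^ 9 \<le> N ^ 10" by (intro two up; simp)+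
  then have "3 * N ^ 7 \<le> N ^ 10" by linarith
  then show "(den + num + 1) * (4 * ((card E + 1) * Big)) + n * n + card E * card E + n + card E +
      budget I + mu I + sum (weight I) E + 5 \<le> N ^ 10" using 1 2 3 by linarith
  have "mask_len X Big l f \<le> Big" if "f \<in> E" for f
  proof -
    have "l f \<le> S" using finE that by (intro member_le_sum) auto
    also have "S \<le> num * S" using stretch_quot by simp
    finally show ?thesis by (simp add: mask_len_def Big_def)
  qed
  then have "sum (mask_len X Big l) E \<le> card E * Big"
    using sum_bounded_above[of E "mask_len X Big l" Big] by simp
  also have "\<dots> \<le> N * N ^ 3" using N mS Big by (intro mult_le_mono) linarith+
  finally have "sum (mask_len X Big l) E \<le> N ^ 4" by (simp add: eval_nat_numeral)
  moreover have "2 + n \<le> N" using N by linarith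
  moreover have "N \<le> N ^ 4" using up[of 1 4] by simp
  moreover have "2 * N ^ 4 \<le> N ^ 5" by (rule two) simp
  ultimately show "graph_magnitude n E (mask_len X Big l) \<le> N ^ 5"
    unfolding graph_magnitude_def by linarith
qed

end

text \<open>In the exponent, 10 serves the arithmetic of the program itself, and
  \<open>5 * k\<close> the calls of \<open>Q\<close>, whose inputs have magnitude at most
  \<open>N ^ 5\<close> for \<open>N = inst_magnitude I\<close>.\<close>

lemma decide_correct:
  assumes Q: "\<And>n E l B s. \<lbrakk>simple_graph {..<n} E; connected_graph {..<n} E; \<forall>e\<in>E. 1 \<le> l e;
      graph_magnitude n E l ^ k \<le> B; word_store B s; encodes_graph n E l s\<rbrakk> \<Longrightarrow>
      \<exists>t s'. exec B Q s t s' \<and> t \<le> A n (card E) \<and>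
        (\<forall>u<n. \<forall>v<n. ereal (real (s' 4 (u * n + v))) = sp_dist E l u v)"
    and I: "valid_inst I" and B: "inst_magnitude I ^ (10 + 5 * k) \<le> B"
    and s: "word_store B s" "encodes_inst I s"
  shows "\<exists>t s'. exec B (decide Q) s t s' \<and>
    t \<le> 500 * (nbhd_size (preprocess I) ^ (2 * mu I) * A (nverts I) (nedges I) +
      nedges I * nedges I * nverts I + 1) \<and>
    s' 0 0 = (if yes_inst (preprocess I) then 1 else 0)"
proof -
  interpret inst I by unfold_locales (rule I)
  let ?N = "inst_magnitude I"
  have N1: "1 \<le> ?N" by (simp add: inst_magnitude_def graph_magnitude_def)
  have B1: "?N ^ 10 \<le> B" using power_increasing[of 10 "10 + 5 * k" ?N] N1 B by simp
  have B2: "?N ^ (5 * k) \<le> B" using power_increasing[of "5 * k" "10 + 5 * k" ?N] N1 B by simp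
  interpret prog I "s 1" "s 2" B
    by unfold_locales
      (use s(2) magnitude_bounds(1) B1 in \<open>simp_all add: encodes_inst_def encodes_graph_def\<close>)
  interpret search I "s 1" "s 2" B Q A
  proof
    fix X s' assume a: "word_store B s'" "encodes_graph n E (mask_len X Big l) s'"
    have "graph_magnitude n E (mask_len X Big l) ^ k \<le> (?N ^ 5) ^ k"
      by (rule power_mono[OF magnitude_bounds(2)]) simp
    also have "\<dots> \<le> B" using B2 by (simp add: power_mult)
    finally show "\<exists>t s''. exec B Q s' t s'' \<and> t \<le> A n (card E) \<and>
        (\<forall>u<n. \<forall>v<n. ereal (real (s'' 4 (u * n + v))) = sp_dist E (mask_len X Big l) u v)"
      using Q[OF graph conn _ _ a] mask_len_bounds by blast
  qed
  show ?thesis using decide_wp[OF s refl refl] unfolding wp_def by blast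
qed

theorem corollary14:
  fixes Q :: com and APSP :: "nat \<Rightarrow> nat \<Rightarrow> nat"
  assumes "apsp_algorithm Q APSP" and "polynomially_bounded APSP"
  shows "\<exists>P T. decides_spanner P T \<and>
           fpt_time T mu (\<lambda>I. nbhd_size (preprocess I)) \<and>
           (\<lambda>I. real (T I)) \<in> O[principal {I. valid_inst I}](spanner_time_bound APSP)"
proof -
  define T where "T I = 500 * (nbhd_size (preprocess I) ^ (2 * mu I) * APSP (nverts I) (nedges I) +
      nedges I * nedges I * nverts I + 1)" for I
  from assms(1) obtain k where k0: "\<forall>n E l B s. simple_graph {..<n} E \<and> connected_graph {..<n} E \<and>
      (\<forall>e\<in>E. 1 \<le> l e) \<and> graph_magnitude n E l ^ k \<le> B \<and> word_store B s \<and> encodes_graph n E l s \<longrightarrow>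
      (\<exists>t s'. exec B Q s t s' \<and> t \<le> APSP n (card E) \<and>
        (\<forall>u<n. \<forall>v<n. ereal (real (s' 4 (u * n + v))) = sp_dist E l u v))"
    unfolding apsp_algorithm_def by (elim exE)
  have k: "\<exists>t s'. exec B Q s t s' \<and> t \<le> APSP n (card E) \<and>
        (\<forall>u<n. \<forall>v<n. ereal (real (s' 4 (u * n + v))) = sp_dist E l u v)"
    if "simple_graph {..<n} E" "connected_graph {..<n} E" "\<forall>e\<in>E. 1 \<le> l e"
      "graph_magnitude n E l ^ k \<le> B" "word_store B s" "encodes_graph n E l s" for n E l B s
    by (rule k0[THEN spec, THEN spec, THEN spec, THEN spec, THEN spec, THEN mp]) (use that in simp)
  have dec: "decides_spanner (decide Q) T"
    unfolding decides_spanner_def T_def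
  proof (rule exI[of _ "10 + 5 * k"], intro allI impI, elim conjE)
    fix I B s
    assume "valid_inst I" "inst_magnitude I ^ (10 + 5 * k) \<le> B" "word_store B s" "encodes_inst I s"
    from decide_correct[OF k this] show "\<exists>t s'. exec B (decide Q) s t s' \<and>
      t \<le> 500 * (nbhd_size (preprocess I) ^ (2 * mu I) * APSP (nverts I) (nedges I) +
      nedges I * nedges I * nverts I + 1) \<and> s' 0 0 = (if yes_inst (preprocess I) then 1 else 0)" .
  qed
  obtain p0 :: "nat poly" where p0: "\<And>n m. APSP n m \<le> poly p0 (n + m)"
    using assms(2) unfolding polynomially_bounded_def by blast
  let ?f = "\<lambda>x y :: nat. y ^ (2 * x) + 1"
  \<comment> \<open>The polynomial is evaluated at three times the encoding length, which bounds
    \<open>n + m\<close>; the cubic monomial covers \<open>m * m * n\<close>.\<close>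
  let ?p = "pcompose (p0 + monom 1 3 + 1) [:0, 3:]"
  have fpt: "fpt_time T mu (\<lambda>I. nbhd_size (preprocess I))"
    unfolding fpt_time_def
  proof (intro exI[of _ ?f] exI[of _ ?p] conjI computable2_power bigoI[where c = 500])
    have "T I \<le> 500 * (?f (mu I) (nbhd_size (preprocess I)) * poly ?p (encoding_length I))"
      if I: "valid_inst I" for I
    proof -
      interpret inst I by unfold_locales (rule I)
      let ?m = "nedges I" and ?L = "encoding_length I" and ?H = "h ^ (2 * mu I)"
      have A: "APSP n ?m \<le> poly p0 (3 * ?L)"
        using p0[of n ?m] poly_nat_mono[OF size_le_encoding, of p0] by linarith
      have "?m * ?m * n \<le> (3 * ?L) * (3 * ?L) * (3 * ?L)"
        using size_le_encoding by (intro mult_le_mono) linarith+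
      then have B: "?m * ?m * n \<le> (3 * ?L) ^ 3" by (simp add: eval_nat_numeral)
      \<comment> \<open>A sum of a parameterized and a polynomial term is bounded by a product, as
        the definition of FPT time requires.\<close>
      have "?H * APSP n ?m + ?m * ?m * n + 1 \<le> (?H + 1) * (APSP n ?m + ?m * ?m * n + 1)"
        by (simp add: algebra_simps)
      also have "\<dots> \<le> (?H + 1) * poly ?p ?L"
        using A B by (intro mult_le_mono2) (simp add: poly_pcompose poly_monom mult.commute)
      finally show ?thesis unfolding T_def by simp
    qed
    then have "real (T I) \<le> 500 * real (?f (mu I) (nbhd_size (preprocess I)) * poly ?p (encoding_length I))"
      if "valid_inst I" for I using that by (metis of_nat_le_iff of_nat_mult of_nat_numeral)
    then show "\<forall>\<^sub>F I in principal {I. valid_inst I}. norm (real (T I)) \<le>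
        500 * norm (real (?f (mu I) (nbhd_size (preprocess I)) * poly ?p (encoding_length I)))"
      unfolding eventually_principal by simp
  qed
  have "(\<lambda>I. real (T I)) \<in> O[principal {I. valid_inst I}](spanner_time_bound APSP)"
  proof (rule bigoI[where c = 500])
    have "real (T I) \<le> 500 * norm (spanner_time_bound APSP I)" if I: "valid_inst I" for I
    proof -
      interpret inst I by unfold_locales (rule I)
      have "real (T I) = 500 * (real h ^ (2 * mu I) * real (APSP n (nedges I)) +
          real (nedges I * nedges I * n) + 1)" by (simp add: T_def)
      also have "\<dots> \<le> 500 * spanner_time_bound APSP I"
        using add_increasing[OF _ square_log_bound, of "real (nedges I) ^ 3"]
        unfolding spanner_time_bound_def Let_def by (intro mult_left_mono) (simp_all del: of_nat_mult)
      finally show ?thesis by simp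
    qed
    then show "\<forall>\<^sub>F I in principal {I. valid_inst I}. norm (real (T I)) \<le> 500 * norm (spanner_time_bound APSP I)"
      unfolding eventually_principal by simp
  qed
  with dec fpt show ?thesis by blast
qed

end
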